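(* Let $n\ge 1$ and let $\mathbb{M}^n$ be spherical space $\mathbb{S}^n$, Euclidean space $\mathbb{R}^n$, or hyperbolic space $\mathbb{H}^n$. Let $N\in\mathbb{N}$ and let $K\subseteq\mathbb{M}^n$ be compact with $\lambda_n(K)>0$, and proper in the case $\mathbb{M}^n=\mathbb{S}^n$. Then $$\mathbb{E}\,U_1([K]_N)\ \ge\ \mathbb{E}\,U_1([B_K]_N),$$ where $B_K$ is a geodesic ball in $\mathbb{M}^n$ satisfying $\lambda_n(K)=\lambda_n(B_K)$.
   Context: Models. Coordinates of $\mathbb{R}^{n+1}$ are $x_0,\ldots,x_n$; $e=(1,0,\ldots,0)$; $x\cdot y=\sum_{i=0}^n x_iy_i$; $\langle x,y\rangle=x_0y_0-x_1y_1-\cdots-x_ny_n$. Set $\mathbb{S}^n=\{x\in\mathbb{R}^{n+1}: x\cdot x=1\}$; Euclidean space is the affine hyperplane $\{x\in\mathbb{R}^{n+1}: x\cdot e=1\}$, denoted $\mathbb{R}^n$; $\mathbb{H}^n=\{x\in\mathbb{R}^{n+1}: x\cdot e>0,\ \langle x,x\rangle=1\}$. The geodesic distance is $\arccos(x\cdot y)$, $\|x-y\|$, $\mathrm{arcosh}\langle x,y\rangle$, respectively; geodesic balls are balls for this distance. Measures. $\lambda_n$ is the isometry-invariant (Riemannian) volume measure on $\mathbb{M}^n$. $\mathcal{M}^n_{n-1}$ is the set of $(n-1)$-dimensional totally geodesic submanifolds of $\mathbb{M}^n$, i.e. the nonempty intersections $E\cap\mathbb{M}^n$ with $E$ an $n$-dimensional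 linear subspace of $\mathbb{R}^{n+1}$. $\mu^n_{n-1}$ is the isometry-invariant measure on $\mathcal{M}^n_{n-1}$, normalized so that $\mu^n_{n-1}(\mathcal{M}^n_{n-1})=1$ if $\mathbb{M}^n=\mathbb{S}^n$, and so that the set of $M\in\mathcal{M}^n_{n-1}$ meeting the geodesic ball of radius $1$ around $e$ has measure $1$ if $\mathbb{M}^n=\mathbb{R}^n$ or $\mathbb{H}^n$. $dM$ means $d\mu^n_{n-1}(M)$. Convexity. $K\subseteq\mathbb{M}^n$ is convex if for all $x,y\in K$ (with $x\neq -y$ if $\mathbb{M}^n=\mathbb{S}^n$) the shortest geodesic segment $[x,y]$ lies in $K$. $\mathrm{conv}\,K$ is the intersection of all convex sets containing $K$. A closed subset of $\mathbb{S}^n$ is proper if it is contained in an open hemisphere. The functional $U_1$. For $A\subseteq\mathbb{M}^n$ let $\chi(A)=1$ if $A\neq\emptyset$ and $\chi(\emptyset)=0$. For compact $K\subseteq\mathbb{M}^n$, $U_1(K)=\int_{\mathcal{M}^n_{n-1}}\chi(K\cap M)\,dM$. Random polytopes. For a compact $L\subseteq\mathbb{M}^n$ with $\lambda_n(L)>0$, $[L]_N=\mathrm{conv}\{X_1,\ldots,X_N\}$, where $X_1,\ldots,X_N$ are independent random points distributed uniformly in $L$ (with respect to $\lambda_n$); $\mathbb{E}$ denotes expectation. *)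

theory Defs
  imports "HOL-Probability.Probability"
begin

section \<open>Definitions\<close>

text \<open>
  The ambient space of dimension \<open>n + 1\<close> is \<open>real \<times> real ^ 'n\<close>, where \<open>n = CARD('n) \<ge> 1\<close>:
  the coordinate \<open>x\<^sub>0\<close> is \<open>fst x\<close>, and \<open>x\<^sub>1, \<dots>, x\<^sub>n\<close> are the components of \<open>snd x\<close>.
  The Euclidean inner product is the inner product of the product type.
\<close>

type_synonym 'n ambient = "real \<times> (real ^ 'n)"

datatype geometry = Spherical | Euclidean | Hyperbolic

definition base_point :: "'n::finite ambient" where
  "base_point = (1, 0)"

definition lorentz :: "'n::finite ambient \<Rightarrow> 'n ambient \<Rightarrow> real" where
  "lorentz x y = fst x * fst y - snd x \<bullet> snd y"

fun model_space :: "geometry \<Rightarrow> 'n::finite ambient set" where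
  "model_space Spherical = {x. x \<bullet> x = 1}"
| "model_space Euclidean = {x. x \<bullet> base_point = 1}"
| "model_space Hyperbolic = {x. x \<bullet> base_point > 0 \<and> lorentz x x = 1}"

fun gdist :: "geometry \<Rightarrow> 'n::finite ambient \<Rightarrow> 'n ambient \<Rightarrow> real" where
  "gdist Spherical x y = arccos (x \<bullet> y)"
| "gdist Euclidean x y = norm (x - y)"
| "gdist Hyperbolic x y = arcosh (lorentz x y)"

text \<open>Balls are closed, so that they are compact and random points in them are defined.\<close>

definition gball :: "geometry \<Rightarrow> 'n::finite ambient \<Rightarrow> real \<Rightarrow> 'n ambient set" where
  "gball g p r = {x \<in> model_space g. gdist g p x \<le> r}"

definition proper :: "'n::finite ambient set \<Rightarrow> bool" where
  "proper K \<longleftrightarrow> (\<exists>u \<in> model_space Spherical. K \<subseteq> {x \<in> model_space Spherical. x \<bullet> u > 0})"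

text \<open>
  In all three geometries the Riemannian volume of \<open>A\<close> is \<open>n + 1\<close> times the Lebesgue measure of
  the cone over \<open>A\<close> with apex \<open>0\<close>: for \<open>v = t x\<close> with \<open>t > 0\<close> and \<open>x\<close> in the model space one
  has \<open>dv = t\<^sup>n dt d\<lambda>\<^sub>n(x)\<close>.  It is invariant under all isometries (\<open>gvolume_invariant\<close>), and in
  the Euclidean case it is Lebesgue measure (\<open>emeasure_gvolume_Euclidean\<close>).
\<close>

definition cone_over :: "'n::finite ambient set \<Rightarrow> 'n ambient set" where
  "cone_over A = {t *\<^sub>R x | t x. 0 < t \<and> t \<le> 1 \<and> x \<in> A}"

definition gvolume :: "geometry \<Rightarrow> 'n::finite ambient measure" where
  "gvolume g = measure_of (model_space g) (sets (restrict_space borel (model_space g)))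
     (\<lambda>A. of_nat (CARD('n) + 1) * emeasure lborel (cone_over A))"

definition hyperplanes :: "geometry \<Rightarrow> 'n::finite ambient set set" where
  "hyperplanes g = {E \<inter> model_space g | E.
     subspace E \<and> dim E = CARD('n) \<and> E \<inter> model_space g \<noteq> {}}"

definition hitting :: "geometry \<Rightarrow> 'n::finite ambient set \<Rightarrow> 'n ambient set set" where
  "hitting g C = {H \<in> hyperplanes g. H \<inter> C \<noteq> {}}"

text \<open>The Borel sigma-algebra of the Fell topology on the space of hyperplanes.\<close>

definition hyperplane_algebra :: "geometry \<Rightarrow> 'n::finite ambient set measure" where
  "hyperplane_algebra g = sigma (hyperplanes g) {hitting g C | C. compact C \<and> C \<subseteq> model_space g}"

text \<open>
  The hyperplanes are the sets \<open>perp g v\<close> for normal vectors \<open>v\<close> with \<open>normal_form g v > 0\<close>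
  (\<open>hyperplanes_eq\<close>).  The linear maps induced by isometries act contragrediently on normal
  vectors; this action preserves \<open>normal_form g\<close> and Lebesgue measure.  Hence the image of
  Lebesgue measure on \<open>normals g\<close> under \<open>perp g\<close> is isometry-invariant
  (\<open>hyperplane_measure_invariant\<close>).  For instance, in the Euclidean case \<open>v = r (- t, u)\<close> with a
  unit vector \<open>u\<close> describes the hyperplane \<open>{y. u \<bullet> y = t}\<close> and \<open>dv = r\<^sup>n dr dt du\<close>.
\<close>

fun normal_form :: "geometry \<Rightarrow> 'n::finite ambient \<Rightarrow> real" where
  "normal_form Spherical v = v \<bullet> v"
| "normal_form Euclidean v = snd v \<bullet> snd v"
| "normal_form Hyperbolic v = - lorentz v v"

definition perp :: "geometry \<Rightarrow> 'n::finite ambient \<Rightarrow> 'n ambient set" where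
  "perp g v = {x \<in> model_space g. x \<bullet> v = 0}"

definition normals :: "geometry \<Rightarrow> 'n::finite ambient set" where
  "normals g = {v. 0 < normal_form g v \<and> normal_form g v \<le> 1}"

definition unnormalized_hyperplane_measure :: "geometry \<Rightarrow> 'n::finite ambient set measure" where
  "unnormalized_hyperplane_measure g =
     distr (restrict_space lborel (normals g)) (hyperplane_algebra g) (perp g)"

fun reference_hyperplanes :: "geometry \<Rightarrow> 'n::finite ambient set set" where
  "reference_hyperplanes Spherical = hyperplanes Spherical"
| "reference_hyperplanes Euclidean = hitting Euclidean (gball Euclidean base_point 1)"
| "reference_hyperplanes Hyperbolic = hitting Hyperbolic (gball Hyperbolic base_point 1)"

definition hyperplane_measure :: "geometry \<Rightarrow> 'n::finite ambient set measure" where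
  "hyperplane_measure g =
     (let \<nu> = unnormalized_hyperplane_measure g
      in scale_measure (inverse (emeasure \<nu> (reference_hyperplanes g))) \<nu>)"

text \<open>Points of shortest geodesics, parametrized by arc length, from \<open>x\<close> to \<open>y\<close>.\<close>

definition geodesic_segment ::
    "geometry \<Rightarrow> 'n::finite ambient \<Rightarrow> 'n ambient \<Rightarrow> 'n ambient set" where
  "geodesic_segment g x y =
     {\<gamma> u | \<gamma> u. u \<in> {0..gdist g x y} \<and> \<gamma> ` {0..gdist g x y} \<subseteq> model_space g \<and>
        \<gamma> 0 = x \<and> \<gamma> (gdist g x y) = y \<and>
        (\<forall>s \<in> {0..gdist g x y}. \<forall>t \<in> {0..gdist g x y}. gdist g (\<gamma> s) (\<gamma> t) = \<bar>s - t\<bar>)}"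

definition gconvex :: "geometry \<Rightarrow> 'n::finite ambient set \<Rightarrow> bool" where
  "gconvex g K \<longleftrightarrow> K \<subseteq> model_space g \<and>
     (\<forall>x \<in> K. \<forall>y \<in> K. (g = Spherical \<longrightarrow> x \<noteq> - y) \<longrightarrow> geodesic_segment g x y \<subseteq> K)"

definition gconv :: "geometry \<Rightarrow> 'n::finite ambient set \<Rightarrow> 'n ambient set" where
  "gconv g K = gconvex g hull K"

definition chi :: "'a set \<Rightarrow> ennreal" where
  "chi A = (if A = {} then 0 else 1)"

definition U1 :: "geometry \<Rightarrow> 'n::finite ambient set \<Rightarrow> ennreal" where
  "U1 g K = (\<integral>\<^sup>+ H. chi (K \<inter> H) \<partial>hyperplane_measure g)"

text \<open>
  The expectation of \<open>U\<^sub>1([L]\<^sub>N)\<close> on the canonical probability space, the \<open>N\<close>-fold product of the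
  uniform distribution on \<open>L\<close>.
\<close>

definition expected_U1 :: "geometry \<Rightarrow> nat \<Rightarrow> 'n::finite ambient set \<Rightarrow> ennreal" where
  "expected_U1 g N L =
     (\<integral>\<^sup>+ X. U1 g (gconv g (X ` {..<N})) \<partial>(\<Pi>\<^sub>M i \<in> {..<N}. uniform_measure (gvolume g) L))"


section \<open>The volume measure\<close>

fun radius :: "geometry \<Rightarrow> 'n::finite ambient \<Rightarrow> real" where
  "radius Spherical v = norm v"
| "radius Euclidean v = fst v"
| "radius Hyperbolic v = (if fst v > 0 \<and> lorentz v v > 0 then sqrt (lorentz v v) else 0)"

lemma inner_base_point [simp]: "x \<bullet> base_point = fst x" "base_point \<bullet> x = fst x"
  by (simp_all add: base_point_def inner_prod_def)

lemma lorentz_scaleR: "lorentz (a *\<^sub>R x) (b *\<^sub>R y) = a * b * lorentz x y"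
  by (simp add: lorentz_def algebra_simps)

lemma radius_scaleR:
  assumes "t > 0"
  shows "radius g (t *\<^sub>R v) = t * radius g v"
  using assms by (cases g) (auto simp: lorentz_scaleR real_sqrt_mult zero_less_mult_iff)

lemma radius_model:
  assumes "x \<in> model_space g" shows "radius g x = 1"
  using assms by (cases g) (auto simp: norm_eq_1)

lemma model_if_radius: "radius g x = 1 \<Longrightarrow> x \<in> model_space g"
  by (cases g) (auto simp: norm_eq_1 split: if_splits)

lemma radial_model:
  assumes "radius g v > 0"
  shows "v /\<^sub>R radius g v \<in> model_space g"
  using assms by (intro model_if_radius) (simp add: radius_scaleR)

lemma cone_over_eq:
  assumes "A \<subseteq> model_space g"
  shows "cone_over A = {v. 0 < radius g v \<and> radius g v \<le> 1} \<inter> (\<lambda>v. v /\<^sub>R radius g v) -` A"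
proof (intro equalityI subsetI)
  fix v assume "v \<in> cone_over A"
  then obtain t x where *: "v = t *\<^sub>R x" "0 < t" "t \<le> 1" "x \<in> A" by (auto simp: cone_over_def)
  then have "radius g v = t" using assms by (auto simp: radius_scaleR radius_model)
  with * show "v \<in> {v. 0 < radius g v \<and> radius g v \<le> 1} \<inter> (\<lambda>v. v /\<^sub>R radius g v) -` A"
    by simp
next
  fix v assume *: "v \<in> {v. 0 < radius g v \<and> radius g v \<le> 1} \<inter> (\<lambda>v. v /\<^sub>R radius g v) -` A"
  then have "v = radius g v *\<^sub>R (v /\<^sub>R radius g v)" by simp
  with * show "v \<in> cone_over A" unfolding cone_over_def by blast
qed

lemma borel_measurable_radius [measurable]: "radius g \<in> borel_measurable borel"
proof -
  have [measurable]: "(\<lambda>v::'a ambient. fst v) \<in> borel_measurable borel"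
    "(\<lambda>v::'a ambient. snd v) \<in> borel_measurable borel"
    by (intro borel_measurable_continuous_onI continuous_intros)+
  have [measurable]: "(\<lambda>v::'a ambient. lorentz v v) \<in> borel_measurable borel"
    unfolding lorentz_def by measurable
  show ?thesis by (cases g) (simp_all add: radius.simps[abs_def])
qed

lemma model_space_borel [measurable]: "model_space g \<in> sets borel"
proof -
  have "model_space g = {x. radius g x = 1}" using radius_model model_if_radius by blast
  also have "\<dots> \<in> sets borel" by measurable
  finally show ?thesis .
qed

lemma cone_over_borel:
  fixes A :: "'n::finite ambient set"
  assumes [measurable]: "A \<in> sets borel" and A: "A \<subseteq> model_space g"
  shows "cone_over A \<in> sets borel"
proof -
  have "cone_over A =
      {v. 0 < radius g v \<and> radius g v \<le> 1} \<inter> ((\<lambda>v. v /\<^sub>R radius g v) -` A \<inter> space borel)"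
    using cone_over_eq[OF A] by simp
  also have "\<dots> \<in> sets borel" by measurable
  finally show ?thesis .
qed

definition cone_measure :: "geometry \<Rightarrow> 'n::finite ambient measure" where
  "cone_measure g = distr (restrict_space lborel {v. 0 < radius g v \<and> radius g v \<le> 1})
     (restrict_space borel (model_space g)) (\<lambda>v. v /\<^sub>R radius g v)"

lemma radial_measurable:
  "(\<lambda>v. v /\<^sub>R radius g v) \<in> measurable (restrict_space lborel {v. 0 < radius g v \<and> radius g v \<le> 1})
     (restrict_space borel (model_space g))"
  by (intro measurable_restrict_space3) (auto simp: radial_model)

lemma emeasure_cone_measure:
  fixes g and A :: "'n::finite ambient set"
  assumes "A \<in> sets (restrict_space borel (model_space g))"
  shows "emeasure (cone_measure g) A = emeasure lborel (cone_over A)"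
proof -
  have A: "A \<subseteq> model_space g" using assms sets.sets_into_space by fastforce
  have [measurable]: "{v::'n ambient. 0 < radius g v \<and> radius g v \<le> 1} \<in> sets borel" by measurable
  show ?thesis
    unfolding cone_measure_def cone_over_eq[OF A]
    using radial_measurable assms
    by (subst emeasure_distr)
       (auto simp: emeasure_restrict_space space_restrict_space Int_commute)
qed

lemma gvolume_eq:
  "gvolume g = scale_measure (of_nat (CARD('n) + 1)) (cone_measure g :: 'n::finite ambient measure)"
proof -
  let ?S = "scale_measure (of_nat (CARD('n) + 1)) (cone_measure g :: 'n::finite ambient measure)"
  let ?M = "model_space g :: 'n ambient set"
  have s: "sets ?S = sets (restrict_space borel ?M)"
    by (simp add: cone_measure_def)
  have sp: "space ?S = ?M"
    by (simp add: cone_measure_def space_restrict_space space_scale_measure)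
  have "?S = measure_of (space ?S) (sets ?S) (emeasure ?S)"
    by (rule measure_of_of_measure[symmetric])
  also have "\<dots> = gvolume g"
    unfolding gvolume_def sp s
  proof (rule measure_of_eq)
    show "sets (restrict_space borel ?M) \<subseteq> Pow ?M"
      using sets.space_closed[of ?S] by (simp only: s sp)
    fix A assume "A \<in> sigma_sets ?M (sets (restrict_space borel ?M))"
    then have "A \<in> sets (restrict_space borel ?M)"
      using sets.sigma_sets_eq[of ?S] by (simp only: s sp)
    then show "emeasure ?S A = of_nat (CARD('n) + 1) * emeasure lborel (cone_over A)"
      by (simp add: emeasure_cone_measure)
  qed
  finally show ?thesis ..
qed

lemma sets_gvolume [measurable_cong]: "sets (gvolume g) = sets (restrict_space borel (model_space g))"
  by (simp add: gvolume_eq cone_measure_def)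

lemma space_gvolume [simp]: "space (gvolume g) = model_space g"
  by (simp add: gvolume_eq cone_measure_def space_restrict_space space_scale_measure)

lemma emeasure_gvolume:
  fixes A :: "'n::finite ambient set"
  assumes "A \<in> sets borel" "A \<subseteq> model_space g"
  shows "emeasure (gvolume g) A = of_nat (CARD('n) + 1) * emeasure lborel (cone_over A)"
proof -
  have "A \<in> sets (restrict_space borel (model_space g))"
    using assms by (simp add: sets_restrict_space_iff)
  then show ?thesis
    by (simp add: gvolume_eq emeasure_cone_measure)
qed

lemma emeasure_gvolume_Euclidean:
  fixes B :: "(real ^ 'n::finite) set"
  assumes [measurable]: "B \<in> sets borel"
  shows "emeasure (gvolume Euclidean) (Pair 1 ` B) = emeasure lborel B"
proof -
  let ?n = "CARD('n)"
  let ?C = "cone_over (Pair 1 ` B) :: 'n ambient set"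
  have A: "Pair (1::real) ` B \<in> sets borel"
  proof -
    have "Pair (1::real) ` B = {1::real} \<times> B" by auto
    moreover have "{1::real} \<times> B \<in> sets (borel \<Otimes>\<^sub>M borel)"
      by (intro pair_measureI) auto
    ultimately show ?thesis by (simp only: borel_prod)
  qed
  have sub: "Pair 1 ` B \<subseteq> model_space Euclidean" by auto
  have C: "?C \<in> sets borel" by (rule cone_over_borel[OF A sub])
  have "(t, z) \<in> ?C \<longleftrightarrow> 0 < t \<and> t \<le> 1 \<and> z \<in> (\<lambda>y. t *\<^sub>R y) ` B" for t z
    unfolding cone_over_def by (auto simp: prod_eq_iff image_iff) (metis mult.right_neutral)
  then have sl: "Pair t -` ?C = (if 0 < t \<and> t \<le> 1 then (\<lambda>y. t *\<^sub>R y) ` B else {})" for t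
    by auto
  have "emeasure lborel ?C = (\<integral>\<^sup>+ t. emeasure lborel (Pair t -` ?C) \<partial>lborel)"
    unfolding lborel_prod[symmetric] using C
    by (intro lborel.emeasure_pair_measure_alt) (simp add: borel_prod[symmetric] lborel_prod)
  also have "\<dots> = (\<integral>\<^sup>+ t. emeasure lborel B * (ennreal (t ^ ?n) * indicator {0..1} t) \<partial>lborel)"
  proof (intro nn_integral_cong_AE AE_I2)
    show "emeasure lborel (Pair t -` ?C) =
        emeasure lborel B * (ennreal (t ^ ?n) * indicator {0..1} t)" for t :: real
    proof (cases "0 < t \<and> t \<le> 1")
      case True
      have "(\<lambda>y. t *\<^sub>R y) ` B = (\<lambda>y. y /\<^sub>R t) -` B \<inter> space borel"
        using True by (auto simp: image_iff intro!: bexI[of _ "_ /\<^sub>R t"])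
      also have "\<dots> \<in> sets borel" by measurable
      finally have [measurable]: "(\<lambda>y. t *\<^sub>R y) ` B \<in> sets borel" .
      have "emeasure lborel ((\<lambda>y. t *\<^sub>R y) ` B) = ennreal (t ^ ?n) * emeasure lborel B"
        using True
        by (subst lborel_affine[of t 0])
           (simp_all add: emeasure_density_const emeasure_distr inj_vimage_image_eq inj_on_def)
      then show ?thesis using True by (simp add: sl mult.commute)
    next
      case False
      then show ?thesis by (auto simp: sl indicator_def)
    qed
  qed
  also have "\<dots> = emeasure lborel B * (\<integral>\<^sup>+ t. ennreal (t ^ ?n) * indicator {0..1} t \<partial>lborel)"
    by (rule nn_integral_cmult) measurable
  also have "(\<integral>\<^sup>+ t. ennreal (t ^ ?n) * indicator {0..1} t \<partial>lborel) = ennreal (1 / (real ?n + 1))"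
  proof -
    have "((\<lambda>t. t ^ (?n + 1) / (real ?n + 1)) has_real_derivative t ^ ?n) (at t)" for t
      using DERIV_cdivide[OF DERIV_pow[of "?n + 1" t], of "real ?n + 1"] by (simp add: add.commute)
    then show ?thesis
      by (subst nn_integral_FTC_Icc[where F = "\<lambda>t. t ^ (?n + 1) / (real ?n + 1)"]) auto
  qed
  finally have "emeasure lborel ?C = emeasure lborel B * ennreal (1 / (real ?n + 1))" .
  then have "emeasure (gvolume Euclidean) (Pair 1 ` B) =
      emeasure lborel B * (of_nat (?n + 1) * ennreal (1 / (real ?n + 1)))"
    by (subst emeasure_gvolume[OF A sub]) (simp add: mult_ac)
  also have "of_nat (?n + 1) * ennreal (1 / (real ?n + 1)) = 1"
    unfolding ennreal_of_nat_eq_real_of_nat by (subst ennreal_mult[symmetric]) simp_all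
  finally show ?thesis by simp
qed


section \<open>The hyperplane measure\<close>

lemma exists_point_perp:
  fixes v :: "'n::finite ambient"
  assumes "normal_form g v > 0"
  shows "\<exists>w. radius g w > 0 \<and> w \<bullet> v = 0"
proof (cases "snd v = 0")
  case False
  let ?y = "- (fst v / (snd v \<bullet> snd v)) *\<^sub>R snd v"
  have pos: "snd v \<bullet> snd v > 0" using False by simp
  have yy: "?y \<bullet> ?y = (fst v)\<^sup>2 / (snd v \<bullet> snd v)"
    using pos by (simp add: power2_eq_square field_simps)
  have "radius g (1, ?y) > 0"
  proof (cases g)
    case Spherical then show ?thesis by (simp add: prod_eq_iff)
  next
    case Euclidean then show ?thesis by simp
  next
    case Hyperbolic
    with assms have "(fst v)\<^sup>2 < snd v \<bullet> snd v" by (simp add: lorentz_def power2_eq_square)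
    then have "?y \<bullet> ?y < 1" using pos unfolding yy by simp
    then show ?thesis using Hyperbolic by (simp add: lorentz_def)
  qed
  moreover have "(1, ?y) \<bullet> v = 0" using pos by (simp add: inner_prod_def)
  ultimately show ?thesis by blast
next
  case True
  with assms have g: "g = Spherical" by (cases g) (auto simp: lorentz_def)
  have "radius g (0, axis undefined 1 :: real^'n) > 0 \<and> (0, axis undefined 1 :: real^'n) \<bullet> v = 0"
    using True g by (simp add: inner_prod_def prod_eq_iff axis_eq_0_iff)
  then show ?thesis by blast
qed

lemma normal_form_pos:
  fixes v :: "'n::finite ambient"
  assumes "v \<noteq> 0" "x \<in> model_space g" "x \<bullet> v = 0"
  shows "normal_form g v > 0"
proof -
  have *: "fst x * fst v = - (snd x \<bullet> snd v)"
    using assms(3) by (simp add: inner_prod_def)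
  show ?thesis
  proof (cases g)
    case Spherical then show ?thesis using assms by simp
  next
    case Euclidean
    then have "snd v \<noteq> 0" using * assms by (auto simp: prod_eq_iff)
    then show ?thesis using Euclidean by simp
  next
    case Hyperbolic
    then have x: "fst x > 0" "(fst x)\<^sup>2 = 1 + snd x \<bullet> snd x"
      using assms(2) by (auto simp: lorentz_def power2_eq_square)
    have v: "snd v \<noteq> 0" using * assms(1) x by (auto simp: prod_eq_iff)
    have "(fst x)\<^sup>2 * (fst v)\<^sup>2 = (snd x \<bullet> snd v)\<^sup>2" using * by (metis power2_minus power_mult_distrib)
    also have "\<dots> \<le> (snd x \<bullet> snd x) * (snd v \<bullet> snd v)" by (rule Cauchy_Schwarz_ineq)
    also have "\<dots> < (fst x)\<^sup>2 * (snd v \<bullet> snd v)" using v x(2) by (intro mult_strict_right_mono) auto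
    finally have "(fst v)\<^sup>2 < snd v \<bullet> snd v" using x(1) by simp
    then show ?thesis using Hyperbolic by (simp add: lorentz_def power2_eq_square)
  qed
qed

lemma normal_form_nonzero: "normal_form g v > 0 \<Longrightarrow> v \<noteq> 0"
  by (cases g) (auto simp: lorentz_def)

lemma normal_form_scaleR: "normal_form g (c *\<^sub>R v) = c\<^sup>2 * normal_form g v"
  by (cases g) (auto simp: lorentz_scaleR power2_eq_square)

lemma perp_in_hyperplanes:
  fixes v :: "'n::finite ambient"
  assumes "normal_form g v > 0"
  shows "perp g v \<in> hyperplanes g"
proof -
  let ?E = "{x. v \<bullet> x = 0}"
  obtain w where w: "radius g w > 0" "w \<bullet> v = 0" using exists_point_perp[OF assms] by blast
  have "w /\<^sub>R radius g w \<in> ?E \<inter> model_space g"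
    using w radial_model[OF w(1)] by (simp add: inner_commute)
  moreover have "subspace ?E" "dim ?E = CARD('n)"
    using normal_form_nonzero[OF assms] by (auto simp: subspace_hyperplane dim_hyperplane)
  moreover have "perp g v = ?E \<inter> model_space g" by (auto simp: perp_def inner_commute)
  ultimately show ?thesis unfolding hyperplanes_def by blast
qed

theorem hyperplanes_eq: "hyperplanes g = perp g ` (normals g :: 'n::finite ambient set)"
proof (intro equalityI subsetI)
  fix H :: "'n ambient set" assume "H \<in> hyperplanes g"
  then obtain E where E: "H = E \<inter> model_space g" "subspace E" "dim E = CARD('n)"
    and ne: "E \<inter> model_space g \<noteq> {}" by (auto simp: hyperplanes_def)
  have "dim E = DIM('n ambient) - 1" using E(3) by simp
  from lowdim_eq_hyperplane[OF this]
  obtain v where v: "v \<noteq> 0" "span E = {x. v \<bullet> x = 0}" by blast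
  then have Ev: "E = {x. v \<bullet> x = 0}" using E(2) by (metis span_eq_iff)
  obtain x where x: "x \<in> E" "x \<in> model_space g" using ne by blast
  have pos: "normal_form g v > 0"
    using normal_form_pos[OF v(1) x(2)] x(1) Ev by (simp add: inner_commute)
  define u where "u = (1 / sqrt (normal_form g v)) *\<^sub>R v"
  have "normal_form g u = 1" using pos by (simp add: u_def normal_form_scaleR power_divide)
  moreover have "perp g u = H" using pos by (auto simp: u_def perp_def E Ev inner_commute)
  ultimately show "H \<in> perp g ` normals g" by (force simp: normals_def)
next
  fix H :: "'n ambient set" assume "H \<in> perp g ` normals g"
  then show "H \<in> hyperplanes g" by (auto simp: normals_def intro: perp_in_hyperplanes)
qed

lemma normals_borel [measurable]: "normals g \<in> sets borel"
proof -
  have "normal_form g \<in> borel_measurable (borel :: 'a::finite ambient measure)"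
    by (cases g; intro borel_measurable_continuous_onI)
       (auto simp: lorentz_def normal_form.simps[abs_def] intro!: continuous_intros)
  then show ?thesis unfolding normals_def by measurable
qed

lemma space_hyperplane_algebra [simp]: "space (hyperplane_algebra g) = hyperplanes g"
  unfolding hyperplane_algebra_def by (rule space_measure_of) (auto simp: hitting_def)

lemma sets_hyperplane_algebra:
  "sets (hyperplane_algebra g) =
     sigma_sets (hyperplanes g) {hitting g C | C. compact C \<and> C \<subseteq> model_space g}"
  unfolding hyperplane_algebra_def by (rule sets_measure_of) (auto simp: hitting_def)

lemma hitting_measurable [measurable]:
  "compact C \<Longrightarrow> C \<subseteq> model_space g \<Longrightarrow> hitting g C \<in> sets (hyperplane_algebra g)"
  unfolding sets_hyperplane_algebra by (intro sigma_sets.Basic) auto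

lemma closed_normals_hitting:
  fixes C :: "'n::finite ambient set"
  assumes "compact C" shows "closed {v. \<exists>x\<in>C. x \<bullet> v = 0}"
proof -
  have "closed {z :: 'n ambient \<times> 'n ambient. fst z \<bullet> snd z = 0}"
    by (intro closed_Collect_eq continuous_intros)
  then have "closed {v. \<exists>x. x \<in> C \<and> (x, v) \<in> {z. fst z \<bullet> snd z = 0}}"
    using assms by (intro closed_compact_projection) auto
  then show ?thesis by (simp add: Bex_def)
qed

lemma perp_measurable:
  "perp g \<in> measurable (restrict_space lborel (normals g)) (hyperplane_algebra g)"
proof (rule measurable_sigma_sets[OF sets_hyperplane_algebra])
  show "{hitting g C |C. compact C \<and> C \<subseteq> model_space g} \<subseteq> Pow (hyperplanes g)"
    by (auto simp: hitting_def)
  show "perp g \<in> space (restrict_space lborel (normals g)) \<rightarrow> hyperplanes g"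
    by (auto simp: space_restrict_space hyperplanes_eq)
  fix Y :: "'n::finite ambient set set"
  assume "Y \<in> {hitting g C |C. compact C \<and> C \<subseteq> model_space g}"
  then obtain C where C: "Y = hitting g C" "compact C" "C \<subseteq> model_space g" by blast
  have "perp g -` Y \<inter> space (restrict_space lborel (normals g)) =
      normals g \<inter> {v. \<exists>x\<in>C. x \<bullet> v = 0}"
    using C(3) by (auto simp: C(1) hitting_def space_restrict_space hyperplanes_eq perp_def)
  moreover have "{v. \<exists>x\<in>C. x \<bullet> v = 0} \<in> sets borel"
    using closed_normals_hitting[OF C(2)] by (rule borel_closed)
  ultimately show "perp g -` Y \<inter> space (restrict_space lborel (normals g))
      \<in> sets (restrict_space lborel (normals g))"
    by (simp add: sets_restrict_space_iff)
qed

lemma emeasure_unnormalized: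
  fixes \<A> :: "'n::finite ambient set set"
  assumes "\<A> \<in> sets (hyperplane_algebra g)"
  shows "emeasure (unnormalized_hyperplane_measure g) \<A> =
    emeasure lborel {v \<in> normals g. perp g v \<in> \<A>}"
proof -
  have "perp g -` \<A> \<inter> normals g = {v \<in> normals g. perp g v \<in> \<A>}" by auto
  then show ?thesis
    unfolding unnormalized_hyperplane_measure_def
    using perp_measurable assms
    by (subst emeasure_distr) (auto simp: emeasure_restrict_space space_restrict_space)
qed

lemma Hyperbolic_iff:
  "x \<in> model_space Hyperbolic \<longleftrightarrow> fst x \<ge> 1 \<and> (fst x)\<^sup>2 = 1 + snd x \<bullet> snd x"
proof -
  have "fst x \<ge> 1" if "fst x > 0" "(fst x)\<^sup>2 = 1 + snd x \<bullet> snd x"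
    using that power2_le_imp_le[of 1 "fst x"] by simp
  then show ?thesis by (auto simp: lorentz_def power2_eq_square)
qed

lemma gball_Euclidean: "gball Euclidean base_point r = {x. fst x = 1 \<and> norm (snd x) \<le> r}"
  by (auto simp: gball_def norm_prod_def base_point_def)

lemma gball_Hyperbolic:
  "gball Hyperbolic base_point 1 =
     {x. fst x \<ge> 1 \<and> (fst x)\<^sup>2 = 1 + snd x \<bullet> snd x \<and> fst x \<le> cosh 1}"
proof -
  have "arcosh (fst x) \<le> 1 \<longleftrightarrow> fst x \<le> cosh 1" if "fst x \<ge> 1" for x :: "'a ambient"
    using that arcosh_less_iff_real[of "cosh 1" "fst x"] cosh_real_ge_1[of 1]
    by (simp add: arcosh_cosh_real not_less[symmetric])
  then show ?thesis
    by (auto simp: gball_def Hyperbolic_iff simp del: model_space.simps)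
       (simp_all add: lorentz_def base_point_def)
qed

lemma compact_reference_ball:
  assumes "g \<noteq> Spherical"
  shows "compact (gball g (base_point :: 'n::finite ambient) 1)"
proof (cases g)
  case Euclidean
  have "gball g (base_point :: 'n ambient) 1 = {1} \<times> cball 0 1"
    using Euclidean by (auto simp: gball_Euclidean)
  then show ?thesis by (simp add: compact_Times)
next
  case Hyperbolic
  let ?B = "{x :: 'n ambient. fst x \<ge> 1 \<and> (fst x)\<^sup>2 = 1 + snd x \<bullet> snd x \<and> fst x \<le> cosh 1}"
  have "closed ?B"
    by (intro closed_Collect_conj closed_Collect_le closed_Collect_eq continuous_intros)
  moreover have "?B \<subseteq> {1..cosh 1} \<times> cball 0 (cosh 1)"
  proof
    fix x assume x: "x \<in> ?B"
    then have "(norm (snd x))\<^sup>2 \<le> (fst x)\<^sup>2" by (simp add: power2_norm_eq_inner)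
    moreover have "fst x \<ge> 0" using x by simp
    ultimately have "norm (snd x) \<le> fst x" by (rule power2_le_imp_le)
    moreover have "fst x \<in> {1..cosh 1}" using x by simp
    ultimately show "x \<in> {1..cosh 1} \<times> cball 0 (cosh 1)" by (simp add: mem_Times_iff)
  qed
  then have "bounded ?B" by (rule bounded_subset[rotated]) (intro bounded_Times; simp)
  ultimately have "compact ?B" by (simp add: compact_eq_bounded_closed)
  then show ?thesis using Hyperbolic by (simp add: gball_Hyperbolic)
qed (use assms in simp)

lemma reference_hyperplanes_sets: "reference_hyperplanes g \<in> sets (hyperplane_algebra g)"
proof (cases g)
  case Spherical
  then show ?thesis using sets.top[of "hyperplane_algebra g"] by simp
next
  case Euclidean
  have "hitting g (gball g base_point 1) \<in> sets (hyperplane_algebra g)"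
    by (intro hitting_measurable compact_reference_ball) (auto simp: Euclidean gball_def)
  then show ?thesis using Euclidean by simp
next
  case Hyperbolic
  have "hitting g (gball g base_point 1) \<in> sets (hyperplane_algebra g)"
    by (intro hitting_measurable compact_reference_ball) (auto simp: Hyperbolic gball_def)
  then show ?thesis using Hyperbolic by simp
qed

lemma bounded_reference_normals:
  "bounded {v \<in> normals g. perp g v \<in> (reference_hyperplanes g :: 'n::finite ambient set set)}"
    (is "bounded ?R")
proof -
  define c :: real where "c = cosh 1"
  have c: "c \<ge> 1" by (simp add: c_def cosh_real_ge_1)
  have "\<bar>fst v\<bar> \<le> c \<and> norm (snd v) \<le> c" if v: "v \<in> ?R" for v
  proof (cases g)
    case Spherical
    then have "v \<bullet> v \<le> 1" using v by (simp add: normals_def)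
    then have "norm v \<le> 1" unfolding norm_le_square by simp
    then show ?thesis using c norm_fst_le[of "fst v" "snd v"] norm_snd_le[of "snd v" "fst v"] by simp
  next
    case Euclidean
    then obtain x where x: "x \<bullet> v = 0" "fst x = 1" "norm (snd x) \<le> 1"
      using v by (auto simp: hitting_def perp_def gball_Euclidean)
    have "snd v \<bullet> snd v \<le> 1" using v Euclidean by (simp add: normals_def)
    then have n: "norm (snd v) \<le> 1" unfolding norm_le_square by simp
    have "\<bar>fst v\<bar> = \<bar>snd x \<bullet> snd v\<bar>" using x by (simp add: inner_prod_def)
    also have "\<dots> \<le> norm (snd x) * norm (snd v)" by (rule Cauchy_Schwarz_ineq2)
    also have "\<dots> \<le> 1 * 1" using x n by (intro mult_mono) auto
    finally show ?thesis using n c by simp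
  next
    case Hyperbolic
    then obtain x where x: "x \<bullet> v = 0" "fst x \<ge> 1" "(fst x)\<^sup>2 = 1 + snd x \<bullet> snd x" "fst x \<le> c"
      using v by (auto simp: hitting_def perp_def gball_Hyperbolic c_def)
    define a where "a = (fst v)\<^sup>2"
    define b where "b = snd v \<bullet> snd v"
    define d where "d = (fst x)\<^sup>2"
    have ab: "b \<le> a + 1" "a < b" using v Hyperbolic
      by (auto simp: normals_def lorentz_def a_def b_def power2_eq_square)
    have d: "d \<ge> 1" "d \<le> c\<^sup>2" using x(2,4) unfolding d_def by (simp_all add: power_mono)
    have *: "fst x * fst v = - (snd x \<bullet> snd v)" using x(1) by (simp add: inner_prod_def)
    have "d * a = (snd x \<bullet> snd v)\<^sup>2"
      unfolding d_def a_def using * by (metis power2_minus power_mult_distrib)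
    also have "\<dots> \<le> (snd x \<bullet> snd x) * b" unfolding b_def by (rule Cauchy_Schwarz_ineq)
    also have "\<dots> = (d - 1) * b" using x(3) by (simp add: d_def)
    finally have "b \<le> d * (b - a)" by (simp add: algebra_simps)
    also have "\<dots> \<le> d * 1" using d ab by (intro mult_left_mono) auto
    finally have b: "b \<le> c\<^sup>2" using d by simp
    then have "norm (snd v) \<le> c" using c unfolding norm_le_square b_def by simp
    moreover have "\<bar>fst v\<bar> \<le> c"
      using b ab c by (intro power2_le_imp_le[of "\<bar>fst v\<bar>" c]) (simp_all add: a_def)
    ultimately show ?thesis by simp
  qed
  then have "?R \<subseteq> cball 0 c \<times> cball 0 c" by (auto simp: mem_Times_iff)
  then show ?thesis by (rule bounded_subset[rotated]) (intro bounded_Times bounded_cball)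
qed

lemma emeasure_open_pos:
  fixes U :: "'a::euclidean_space set"
  assumes "open U" "U \<noteq> {}"
  shows "emeasure lborel U > 0"
proof -
  have "U \<notin> null_sets lebesgue"
    using open_not_negligible[OF assms] by (simp add: negligible_iff_null_sets)
  then show ?thesis
    using assms(1) by (auto simp: null_sets_def zero_less_iff_neq_zero)
qed

lemma reference_normals_pos:
  "emeasure lborel {v \<in> normals g. perp g v \<in> (reference_hyperplanes g :: 'n::finite ambient set set)} > 0"
    (is "emeasure lborel ?R > 0")
proof -
  let ?U = "{v :: 'n ambient. \<bar>fst v\<bar> < 1/4 \<and> 1/2 < norm (snd v) \<and> norm (snd v) < 3/4}"
  have "open ?U" by (intro open_Collect_conj open_Collect_less continuous_intros)
  moreover have "(0, (5/8) *\<^sub>R axis undefined 1 :: real ^ 'n) \<in> ?U" by simp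
  then have "?U \<noteq> {}" by blast
  ultimately have "emeasure lborel ?U > 0" by (rule emeasure_open_pos)
  also have "?U \<subseteq> ?R"
  proof
    fix v assume v: "v \<in> ?U"
    have n0: "snd v \<noteq> 0" using v by auto
    have "(1/2)\<^sup>2 < (norm (snd v))\<^sup>2" "(norm (snd v))\<^sup>2 < (3/4)\<^sup>2"
      using v by (auto intro!: power_strict_mono)
    then have sv: "1/4 < snd v \<bullet> snd v" "snd v \<bullet> snd v < 9/16"
      by (simp_all add: power2_norm_eq_inner power_divide)
    have "\<bar>fst v\<bar>\<^sup>2 < (1/4)\<^sup>2" using v by (intro power_strict_mono) auto
    then have fv: "(fst v)\<^sup>2 < 1/16" by (simp add: power2_eq_square)
    have nv: "v \<in> normals g"
    proof -
      have "0 \<le> fst v * fst v" "fst v * fst v < 1/16" using fv by (auto simp: power2_eq_square)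
      with sv have *: "0 < fst v * fst v + snd v \<bullet> snd v" "fst v * fst v + snd v \<bullet> snd v \<le> 1"
          "0 < snd v \<bullet> snd v" "snd v \<bullet> snd v \<le> 1"
          "fst v * fst v < snd v \<bullet> snd v" "snd v \<bullet> snd v \<le> 1 + fst v * fst v"
        by linarith+
      show ?thesis
        unfolding normals_def using * by (cases g) (simp_all add: inner_prod_def lorentz_def)
    qed
    obtain y where y: "y \<bullet> y \<le> 1/4" and yv: "(1, y) \<bullet> v = 0"
    proof
      let ?y = "- (fst v / (snd v \<bullet> snd v)) *\<^sub>R snd v"
      show "(1, ?y) \<bullet> v = 0" using n0 by (simp add: inner_prod_def)
      have "?y \<bullet> ?y = (fst v)\<^sup>2 / (snd v \<bullet> snd v)"
        using n0 by (simp add: power2_eq_square field_simps)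
      also have "0 < snd v \<bullet> snd v" "4 * (fst v)\<^sup>2 \<le> snd v \<bullet> snd v" using sv fv by linarith+
      then have "(fst v)\<^sup>2 / (snd v \<bullet> snd v) \<le> 1/4" by (simp add: pos_divide_le_eq)
      finally show "?y \<bullet> ?y \<le> 1/4" .
    qed
    have H: "perp g v \<in> hyperplanes g" using nv by (auto simp: hyperplanes_eq)
    show "v \<in> ?R"
    proof (cases g)
      case Spherical then show ?thesis using nv H by simp
    next
      case Euclidean
      have "norm y \<le> 1" unfolding norm_le_square using y by simp
      then have "(1, y) \<in> perp g v \<inter> gball g base_point 1"
        using yv Euclidean by (auto simp: perp_def gball_Euclidean)
      then show ?thesis using nv H Euclidean by (auto simp: hitting_def)
    next
      case Hyperbolic
      define s where "s = 1 / sqrt (1 - y \<bullet> y)"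
      have s2: "s\<^sup>2 * (1 - y \<bullet> y) = 1" using y by (simp add: s_def power_divide)
      have s0: "s > 0" using y by (simp add: s_def)
      have "s\<^sup>2 * (3/4) \<le> s\<^sup>2 * (1 - y \<bullet> y)" using y by (intro mult_left_mono) auto
      then have "s\<^sup>2 \<le> (5/4)\<^sup>2" using s2 by (simp add: power2_eq_square)
      then have "s \<le> 5/4" by (rule power2_le_imp_le) simp
      also have "5/4 \<le> cosh (1::real)"
      proof -
        have "cosh (1::real) = (exp 1 + exp (- 1)) / 2" by (simp add: cosh_field_def)
        moreover have "5/2 \<le> exp (1::real)" using exp_lower_Taylor_quadratic[of "1::real"] by simp
        moreover have "0 < exp (- 1::real)" by (rule exp_gt_zero)
        moreover have "5/4 \<le> (a + b) / 2" if "5/2 \<le> a" "0 < b" for a b :: real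
          using that by simp
        ultimately show ?thesis by metis
      qed
      finally have s: "s \<le> cosh 1" .
      have sq: "s\<^sup>2 = 1 + (s *\<^sub>R y) \<bullet> (s *\<^sub>R y)"
        using s2 by (simp add: power2_eq_square algebra_simps)
      have "s\<^sup>2 \<ge> 1\<^sup>2" using inner_ge_zero[of "s *\<^sub>R y"] unfolding sq by simp
      then have "s \<ge> 1" using s0 by (intro power2_le_imp_le[of 1 s]) auto
      then have "(s, s *\<^sub>R y) \<in> gball g base_point 1"
        using s sq Hyperbolic by (simp add: gball_Hyperbolic)
      moreover have "(s, s *\<^sub>R y) \<bullet> v = s * ((1, y) \<bullet> v)"
        by (simp add: inner_prod_def algebra_simps)
      then have "(s, s *\<^sub>R y) \<bullet> v = 0" by (simp add: yv)
      ultimately have "(s, s *\<^sub>R y) \<in> perp g v \<inter> gball g base_point 1"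
        by (simp add: perp_def gball_def)
      then show ?thesis using nv H Hyperbolic by (auto simp: hitting_def)
    qed
  qed
  then have "emeasure lborel ?U \<le> emeasure lborel ?R"
  proof (rule emeasure_mono)
    have "?R = perp g -` reference_hyperplanes g \<inter> space (restrict_space lborel (normals g))"
      by (auto simp: space_restrict_space)
    also have "\<dots> \<in> sets (restrict_space lborel (normals g))"
      by (rule measurable_sets[OF perp_measurable reference_hyperplanes_sets])
    finally show "?R \<in> sets lborel" by (simp add: sets_restrict_space_iff)
  qed
  finally show ?thesis .
qed

theorem hyperplane_measure_normalized:
  "emeasure (hyperplane_measure g) (reference_hyperplanes g :: 'n::finite ambient set set) = 1"
proof -
  let ?e = "emeasure lborel {v \<in> normals g. perp g v \<in> (reference_hyperplanes g :: 'n ambient set set)}"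
  have "?e < \<infinity>"
    by (rule emeasure_bounded_finite[OF bounded_reference_normals])
  moreover have "?e > 0" by (rule reference_normals_pos)
  ultimately show ?thesis
    by (simp add: hyperplane_measure_def Let_def emeasure_unnormalized reference_hyperplanes_sets
        ennreal_divide_self mult.commute[of "inverse _"] flip: divide_ennreal_def)
qed

lemma sets_hyperplane_measure: "sets (hyperplane_measure g) = sets (hyperplane_algebra g)"
  by (simp add: hyperplane_measure_def unnormalized_hyperplane_measure_def Let_def)

lemma space_hyperplane_measure [simp]: "space (hyperplane_measure g) = hyperplanes g"
  by (simp add: hyperplane_measure_def unnormalized_hyperplane_measure_def space_scale_measure Let_def)

lemma U1_eq_hitting:
  assumes "compact K" "K \<subseteq> model_space g"
  shows "U1 g K = emeasure (hyperplane_measure g) (hitting g K)"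
proof -
  have "U1 g K = (\<integral>\<^sup>+ H. indicator (hitting g K) H \<partial>hyperplane_measure g)"
    unfolding U1_def by (intro nn_integral_cong) (auto simp: chi_def hitting_def indicator_def)
  then show ?thesis using hitting_measurable[OF assms] by (simp add: sets_hyperplane_measure)
qed


section \<open>Lebesgue measure and linear maps\<close>

lemma lborel_translation_vimage:
  fixes A :: "'a::euclidean_space set"
  assumes "A \<in> sets borel"
  shows "emeasure lborel ((+) a -` A) = emeasure lborel A"
proof -
  have "emeasure (distr lborel borel ((+) a)) A = emeasure lborel ((+) a -` A)"
    using assms by (subst emeasure_distr) auto
  then show ?thesis by (simp add: lborel_distr_plus)
qed

lemma emeasure_linear_vimage:
  fixes T :: "'a::euclidean_space \<Rightarrow> 'a"
  assumes T: "linear T" "bij T"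
  shows "\<exists>c. \<forall>A \<in> sets borel. emeasure lborel (T -` A) = c * emeasure lborel A"
proof -
  define M where "M = distr lborel borel T"
  have cT: "continuous_on UNIV T" using T(1) linear_continuous_on linear_conv_bounded_linear by blast
  have mT [measurable]: "T \<in> borel_measurable borel" by (rule borel_measurable_continuous_onI[OF cT])
  have sM [measurable_cong]: "sets M = sets borel" and spM: "space M = UNIV" by (simp_all add: M_def)
  have eM: "emeasure M A = emeasure lborel (T -` A)" if "A \<in> sets borel" for A
    using that mT unfolding M_def by (subst emeasure_distr) auto
  have bi: "bounded_linear (inv T)"
    using T by (simp add: linear_conv_bounded_linear[symmetric] bij_is_inj inj_linear_imp_inv_linear)
  have fin: "emeasure M A < top" if "A \<in> sets borel" "bounded A" for A
  proof -
    have "T -` A = inv T ` A" using T(2) by (simp add: bij_vimage_eq_inv_image)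
    then have "bounded (T -` A)" using bounded_linear_image[OF that(2) bi] by simp
    then show ?thesis using eM[OF that(1)] emeasure_bounded_finite by auto
  qed
  have trans: "emeasure M ((+) a -` A) = emeasure M A" if [measurable]: "A \<in> sets borel" for a A
  proof -
    have [measurable]: "(+) a -` A \<in> sets borel"
      using measurable_sets[of "(+) a" borel borel A] by simp
    have TA: "T -` A \<in> sets borel" using measurable_sets[OF mT that] by simp
    have "T -` ((+) a -` A) = (+) (inv T a) -` (T -` A)"
      using T by (auto simp: linear_add surj_f_inv_f bij_is_surj)
    then show ?thesis using eM lborel_translation_vimage[OF TA] by simp
  qed
  interpret M: sigma_finite_measure M
  proof
    show "\<exists>A. countable A \<and> A \<subseteq> sets M \<and> \<Union> A = space M \<and> (\<forall>a\<in>A. emeasure M a \<noteq> \<infinity>)"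
    proof (intro exI conjI ballI)
      show "countable (range (\<lambda>n::nat. ball (0::'a) (real n)))" by auto
      show "range (\<lambda>n::nat. ball (0::'a) (real n)) \<subseteq> sets M" by (auto simp: sM)
      show "\<Union> (range (\<lambda>n::nat. ball (0::'a) (real n))) = space M"
        using reals_Archimedean2 by (auto simp: spM)
      show "emeasure M a \<noteq> \<infinity>" if "a \<in> range (\<lambda>n::nat. ball (0::'a) (real n))" for a
        using that fin by (auto simp: less_top)
    qed
  qed
  interpret P: pair_sigma_finite M "lborel :: 'a measure" ..
  define B where "B = ball (0::'a) 1"
  have [measurable]: "B \<in> sets borel" by (simp add: B_def)
  have symB: "- x \<in> B \<longleftrightarrow> x \<in> B" for x by (simp add: B_def)
  define b where "b = emeasure lborel B"
  have b: "b \<noteq> 0" "b \<noteq> top"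
    using emeasure_open_pos[of B] emeasure_bounded_finite[of B] by (auto simp: b_def B_def)
  define c where "c = emeasure M B / b"
  have main: "emeasure M A * b = emeasure M B * emeasure lborel A" if [measurable]: "A \<in> sets borel" for A
  proof -
    have inn: "(\<integral>\<^sup>+ y. indicator B (y - x) \<partial>lborel) = b" for x
    proof -
      have "{y. y - x \<in> B} = (+) (- x) -` B" by auto
      moreover have "{y. y - x \<in> B} \<in> sets borel" by measurable
      moreover have "(\<integral>\<^sup>+ y. indicator B (y - x) \<partial>lborel) = (\<integral>\<^sup>+ y. indicator {y. y - x \<in> B} y \<partial>lborel)"
        by (intro nn_integral_cong) (simp add: indicator_def)
      ultimately show ?thesis using lborel_translation_vimage[of B "- x"] by (simp add: b_def)
    qed
    have shift: "(\<integral>\<^sup>+ x. indicator A x * indicator B (y - x) \<partial>M) =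
        (\<integral>\<^sup>+ x. indicator A (x + y) * indicator B x \<partial>M)" for y
    proof -
      let ?E = "A \<inter> {x. y - x \<in> B}"
      have [measurable]: "?E \<in> sets borel" by measurable
      have "(\<integral>\<^sup>+ x. indicator A x * indicator B (y - x) \<partial>M) = (\<integral>\<^sup>+ x. indicator ?E x \<partial>M)"
        by (intro nn_integral_cong) (simp add: indicator_def)
      also have "\<dots> = emeasure M ((+) y -` ?E)" using trans[of ?E y] by (simp add: sM)
      also have "(+) y -` ?E = {x. x + y \<in> A \<and> x \<in> B}" using symB by (auto simp: add.commute)
      also have "emeasure M {x. x + y \<in> A \<and> x \<in> B} =
          (\<integral>\<^sup>+ x. indicator {x. x + y \<in> A \<and> x \<in> B} x \<partial>M)"
        by (subst nn_integral_indicator) (auto simp: sM)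
      also have "\<dots> = (\<integral>\<^sup>+ x. indicator A (x + y) * indicator B x \<partial>M)"
        by (intro nn_integral_cong) (simp add: indicator_def)
      finally show ?thesis .
    qed
    have inn2: "(\<integral>\<^sup>+ y. indicator A (x + y) \<partial>lborel) = emeasure lborel A" for x
    proof -
      have "(\<integral>\<^sup>+ y. indicator A (x + y) \<partial>lborel) = (\<integral>\<^sup>+ y. indicator ((+) x -` A) y \<partial>lborel)"
        by (intro nn_integral_cong) (simp add: indicator_def)
      also have "\<dots> = emeasure lborel ((+) x -` A)"
        using measurable_sets[of "(+) x" borel borel A] by simp
      finally show ?thesis by (simp add: lborel_translation_vimage)
    qed
    have "emeasure M A * b = (\<integral>\<^sup>+ x. indicator A x * b \<partial>M)"
      by (subst nn_integral_multc) (auto simp: sM)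
    also have "\<dots> = (\<integral>\<^sup>+ x. (\<integral>\<^sup>+ y. indicator A x * indicator B (y - x) \<partial>lborel) \<partial>M)"
      by (intro nn_integral_cong) (simp add: nn_integral_cmult inn)
    also have "\<dots> = (\<integral>\<^sup>+ y. (\<integral>\<^sup>+ x. indicator A x * indicator B (y - x) \<partial>M) \<partial>lborel)"
      by (rule P.Fubini'[symmetric]) measurable
    also have "\<dots> = (\<integral>\<^sup>+ y. (\<integral>\<^sup>+ x. indicator A (x + y) * indicator B x \<partial>M) \<partial>lborel)"
      by (simp add: shift)
    also have "\<dots> = (\<integral>\<^sup>+ x. (\<integral>\<^sup>+ y. indicator A (x + y) * indicator B x \<partial>lborel) \<partial>M)"
      by (rule P.Fubini') measurable
    also have "\<dots> = (\<integral>\<^sup>+ x. emeasure lborel A * indicator B x \<partial>M)"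
      by (intro nn_integral_cong) (simp add: nn_integral_multc inn2)
    also have "\<dots> = emeasure M B * emeasure lborel A"
      by (subst nn_integral_cmult) (auto simp: sM mult.commute)
    finally show ?thesis .
  qed
  have "emeasure lborel (T -` A) = c * emeasure lborel A" if A: "A \<in> sets borel" for A
  proof -
    have "emeasure M A = emeasure M A * b / b" using b by (simp add: ennreal_mult_divide_eq)
    also have "\<dots> = c * emeasure lborel A" unfolding main[OF A] c_def
      by (simp add: ennreal_divide_times ennreal_times_divide mult_ac)
    finally show ?thesis by (simp add: eM[OF A])
  qed
  then show ?thesis by blast
qed

definition lborel_preserving :: "('a::euclidean_space \<Rightarrow> 'a) \<Rightarrow> bool" where
  "lborel_preserving T \<longleftrightarrow> (\<forall>A \<in> sets borel. emeasure lborel (T -` A) = emeasure lborel A)"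

lemma linear_borel_vimage:
  fixes T :: "'a::euclidean_space \<Rightarrow> 'a"
  assumes "linear T" "A \<in> sets borel"
  shows "T -` A \<in> sets borel"
proof -
  have "continuous_on UNIV T" using assms(1) linear_continuous_on linear_conv_bounded_linear by blast
  then have "T \<in> borel_measurable borel" by (rule borel_measurable_continuous_onI)
  from measurable_sets[OF this assms(2)] show ?thesis by simp
qed

lemma lborel_preserving_if_preserves_set:
  fixes T :: "'a::euclidean_space \<Rightarrow> 'a"
  assumes "linear T" "bij T" "bounded B" "open B" "B \<noteq> {}" "T -` B = B"
  shows "lborel_preserving T"
proof -
  obtain c where c: "\<forall>A \<in> sets borel. emeasure lborel (T -` A) = c * emeasure lborel A"
    using emeasure_linear_vimage[OF assms(1,2)] by blast
  have B: "B \<in> sets borel" using assms(4) by simp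
  have b: "emeasure lborel B \<noteq> 0" "emeasure lborel B \<noteq> top"
    using emeasure_open_pos[OF assms(4,5)] emeasure_bounded_finite[OF assms(3)] by auto
  have "1 * emeasure lborel B = c * emeasure lborel B"
    using bspec[OF c B] unfolding assms(6) by simp
  then have "c = 1" using b by (metis ennreal_mult_divide_eq)
  then show ?thesis using c by (simp add: lborel_preserving_def)
qed

lemma lborel_preserving_involution:
  fixes T :: "'a::euclidean_space \<Rightarrow> 'a"
  assumes "linear T" "\<And>x. T (T x) = x"
  shows "lborel_preserving T"
proof (rule lborel_preserving_if_preserves_set[OF assms(1)])
  let ?B = "ball 0 1 \<inter> T -` ball (0::'a) 1"
  show "bij T" using assms(2) by (metis involuntory_imp_bij)
  have "continuous_on UNIV T" using assms(1) linear_continuous_on linear_conv_bounded_linear by blast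
  then show "open ?B" by (intro open_Int open_vimage) auto
  show "bounded ?B" by (rule bounded_subset[of "ball 0 1"]) auto
  have "0 \<in> ?B" using assms(1) by (simp add: linear_0)
  then show "?B \<noteq> {}" by blast
  show "T -` ?B = ?B" using assms(2) by auto
qed

lemma lborel_preserving_isometry:
  fixes T :: "'a::euclidean_space \<Rightarrow> 'a"
  assumes "linear T" "\<And>x. norm (T x) = norm x"
  shows "lborel_preserving T"
proof (rule lborel_preserving_if_preserves_set[OF assms(1)])
  have "inj T" using assms by (metis linear_injective_0 norm_eq_zero)
  then show "bij T" using assms(1) by (simp add: bij_def linear_injective_imp_surjective)
  show "T -` ball 0 1 = ball 0 1" using assms(2) by auto
qed auto

lemma lborel_preserving_compose:
  assumes "linear T" "lborel_preserving S" "lborel_preserving T"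
  shows "lborel_preserving (T \<circ> S)"
  using assms linear_borel_vimage[OF assms(1)]
  by (simp add: lborel_preserving_def vimage_comp[symmetric])


section \<open>Isometry invariance\<close>

definition isometry :: "geometry \<Rightarrow> ('n::finite ambient \<Rightarrow> 'n ambient) \<Rightarrow> bool" where
  "isometry g f \<longleftrightarrow> bij_betw f (model_space g) (model_space g) \<and>
     (\<forall>x \<in> model_space g. \<forall>y \<in> model_space g. gdist g (f x) (f y) = gdist g x y)"

text \<open>\<open>T\<close> is the action of an isometry on points, \<open>S\<close> its action on normal vectors.\<close>

definition sym_pair :: "geometry \<Rightarrow> ('n::finite ambient \<Rightarrow> 'n ambient) \<Rightarrow> ('n ambient \<Rightarrow> 'n ambient) \<Rightarrow> bool"
  where
  "sym_pair g T S \<longleftrightarrow> linear T \<and> linear S \<and> (\<forall>x v. T x \<bullet> S v = x \<bullet> v) \<and>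
     (\<forall>x. radius g (T x) = radius g x) \<and> (\<forall>v. normal_form g (S v) = normal_form g v) \<and>
     (\<forall>x \<in> model_space g. \<forall>y \<in> model_space g. gdist g (T x) (T y) = gdist g x y) \<and>
     lborel_preserving T \<and> lborel_preserving S"

lemma model_space_iff: "x \<in> model_space g \<longleftrightarrow> radius g x = 1"
  using radius_model model_if_radius by blast

lemma sym_pairD:
  assumes "sym_pair g T S"
  shows "linear T" "linear S" "T x \<bullet> S v = x \<bullet> v" "radius g (T x) = radius g x"
    "normal_form g (S v) = normal_form g v"
    "x \<in> model_space g \<Longrightarrow> y \<in> model_space g \<Longrightarrow> gdist g (T x) (T y) = gdist g x y"
    "lborel_preserving T" "lborel_preserving S"
  using assms unfolding sym_pair_def by blast+

lemma sym_pairI: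
  assumes "linear T" "linear S" "\<And>x v. T x \<bullet> S v = x \<bullet> v" "\<And>x. radius g (T x) = radius g x"
    "\<And>v. normal_form g (S v) = normal_form g v"
    "\<And>x y. x \<in> model_space g \<Longrightarrow> y \<in> model_space g \<Longrightarrow> gdist g (T x) (T y) = gdist g x y"
    "lborel_preserving T" "lborel_preserving S"
  shows "sym_pair g T S"
  using assms unfolding sym_pair_def by blast

lemma sym_pair_model: "sym_pair g T S \<Longrightarrow> T x \<in> model_space g \<longleftrightarrow> x \<in> model_space g"
  by (simp add: sym_pairD(4) model_space_iff)

lemma sym_pair_bij:
  assumes "sym_pair g T S" shows "bij T"
proof -
  have "x = 0" if "T x = 0" for x
    using sym_pairD(3)[OF assms, of x x] that by simp
  then have "inj T" using sym_pairD(1)[OF assms] linear_injective_0 by blast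
  then show ?thesis
    using sym_pairD(1)[OF assms] by (simp add: bij_def linear_injective_imp_surjective)
qed

lemma sym_pair_compose:
  assumes "sym_pair g T S" "sym_pair g T' S'"
  shows "sym_pair g (T \<circ> T') (S \<circ> S')"
  by (intro sym_pairI linear_compose lborel_preserving_compose)
     (simp_all add: sym_pairD[OF assms(1)] sym_pairD[OF assms(2)] sym_pair_model[OF assms(2)])

lemma lorentz_commute: "lorentz x y = lorentz y x"
  by (simp add: lorentz_def inner_commute mult.commute)

lemma lorentz_linear:
  "lorentz (x + y) z = lorentz x z + lorentz y z"
  "lorentz (x - y) z = lorentz x z - lorentz y z"
  "lorentz x (y + z) = lorentz x y + lorentz x z"
  "lorentz x (y - z) = lorentz x y - lorentz x z"
  "lorentz (a *\<^sub>R x) z = a * lorentz x z"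
  "lorentz x (a *\<^sub>R z) = a * lorentz x z"
  by (simp_all add: lorentz_def algebra_simps)

lemma lorentz_pos:
  assumes "fst x > 0" "fst y > 0" "lorentz x x > 0" "lorentz y y > 0"
  shows "lorentz x y > 0"
proof -
  have "norm (snd x) < fst x" "norm (snd y) < fst y"
    using assms by (auto simp: lorentz_def power2_norm_eq_inner[symmetric]
        simp flip: power2_eq_square intro: power2_less_imp_less)
  then have "norm (snd x) * norm (snd y) < fst x * fst y"
    by (intro mult_strict_mono') auto
  moreover have "snd x \<bullet> snd y \<le> norm (snd x) * norm (snd y)" by (rule norm_cauchy_schwarz)
  ultimately show ?thesis by (simp add: lorentz_def)
qed

lemma sym_pair_rotation:
  assumes "orthogonal_transformation A"
  defines "T \<equiv> \<lambda>x :: 'n::finite ambient. (fst x, A (snd x))"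
  shows "sym_pair g T T"
proof -
  have A: "linear A" "\<And>x y. A x \<bullet> A y = x \<bullet> y"
    using assms(1) by (auto simp: orthogonal_transformation_def)
  have lin: "linear T" unfolding T_def
    using A(1) by (intro linearI) (auto simp: linear_add linear_cmul)
  have i: "T x \<bullet> T y = x \<bullet> y" "lorentz (T x) (T y) = lorentz x y" "fst (T x) = fst x" for x y
    by (simp_all add: T_def inner_prod_def lorentz_def A)
  have n: "norm (T x) = norm x" for x by (simp add: norm_eq_sqrt_inner i)
  have nd: "norm (T x - T y) = norm (x - y)" for x y
    using n[of "x - y"] lin by (simp add: linear_diff)
  have "radius g (T x) = radius g x" "normal_form g (T x) = normal_form g x"
    "gdist g (T x) (T y) = gdist g x y" for x y
    by (cases g; simp add: i n nd; simp add: T_def A)+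
  then show ?thesis
    using lin i lborel_preserving_isometry[OF lin n] by (intro sym_pairI)
qed

lemma reflection_pair:
  fixes a b :: "'a::euclidean_space"
  assumes "a \<bullet> b = 1"
    and T_def: "T = (\<lambda>x. x - (2 * (x \<bullet> a)) *\<^sub>R b)" and S_def: "S = (\<lambda>v. v - (2 * (v \<bullet> b)) *\<^sub>R a)"
  shows "linear T" "linear S" "T (T x) = x" "T x \<bullet> S v = x \<bullet> v"
    "lborel_preserving T" "lborel_preserving S"
proof -
  have ab: "b \<bullet> a = 1" using assms(1) by (simp add: inner_commute)
  show lT: "linear T" and lS: "linear S"
    unfolding T_def S_def by (auto intro!: linearI simp: algebra_simps)
  show TT: "T (T x) = x" for x by (simp add: T_def ab algebra_simps)
  have SS: "S (S x) = x" for x by (simp add: S_def assms(1) algebra_simps)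
  show "T x \<bullet> S v = x \<bullet> v"
    by (simp add: T_def S_def assms(1) ab inner_diff_left inner_diff_right inner_commute algebra_simps)
  show "lborel_preserving T" by (rule lborel_preserving_involution[OF lT TT])
  show "lborel_preserving S" by (rule lborel_preserving_involution[OF lS SS])
qed

lemma exists_reflection:
  fixes p :: "'n::finite ambient"
  assumes p: "p \<in> model_space g" and ne: "p \<noteq> base_point"
  shows "\<exists>T S. sym_pair g T S \<and> (\<forall>x. T (T x) = x) \<and> T base_point = p"
proof (cases g)
  case Spherical
  define w :: "'n ambient" where "w = base_point - p"
  define a where "a = w /\<^sub>R norm w"
  have w: "w \<noteq> 0" using ne by (simp add: w_def)
  have aa: "a \<bullet> a = 1" using w by (simp add: a_def dot_square_norm power2_eq_square)
  define T where "T = (\<lambda>x. x - (2 * (x \<bullet> a)) *\<^sub>R a)"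
  note R = reflection_pair[OF aa T_def T_def]
  have i: "T x \<bullet> T y = x \<bullet> y" for x y using R(4) .
  have n: "norm (T x) = norm x" for x by (simp add: norm_eq_sqrt_inner i)
  have "w \<bullet> w = 2 * (base_point \<bullet> w)"
    using p Spherical by (simp add: w_def inner_diff_left inner_diff_right inner_commute) (simp add: base_point_def)
  then have nw: "norm w * norm w = 2 * fst w" by (simp add: dot_square_norm power2_eq_square)
  have "2 * (base_point \<bullet> a) = (2 * fst w) / norm w" by (simp add: a_def divide_inverse)
  also have "\<dots> = norm w" unfolding nw[symmetric] using w by simp
  finally have "(2 * (base_point \<bullet> a)) *\<^sub>R a = w" using w by (simp add: a_def)
  then have "T base_point = p" by (simp add: T_def w_def)
  moreover have "sym_pair g T T"
    using R i n Spherical by (intro sym_pairI) simp_all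
  ultimately show ?thesis using R(3) by blast
next
  case Euclidean
  define w where "w = snd p"
  have p1: "fst p = 1" using p Euclidean by simp
  have w: "w \<noteq> 0" using ne p1 by (auto simp: w_def base_point_def prod_eq_iff)
  define a :: "'n ambient" where "a = (- 1/2, (1 / (w \<bullet> w)) *\<^sub>R w)"
  define b :: "'n ambient" where "b = (0, w)"
  have ab: "a \<bullet> b = 1" using w by (simp add: a_def b_def inner_prod_def)
  define T where "T = (\<lambda>x. x - (2 * (x \<bullet> a)) *\<^sub>R b)"
  define S where "S = (\<lambda>v. v - (2 * (v \<bullet> b)) *\<^sub>R a)"
  note R = reflection_pair[OF ab T_def S_def]
  have f: "fst (T x) = fst x" for x by (simp add: T_def b_def)
  have refl: "norm (y - (2 * (y \<bullet> w) / (w \<bullet> w)) *\<^sub>R w) = norm y" for y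
    using w by (simp add: norm_eq_sqrt_inner inner_diff_left inner_diff_right inner_commute)
  have sS: "snd (S v) = snd v - (2 * (snd v \<bullet> w) / (w \<bullet> w)) *\<^sub>R w" for v
    by (simp add: S_def a_def b_def inner_prod_def)
  have nf: "normal_form g (S v) = normal_form g v" for v
    unfolding Euclidean normal_form.simps sS norm_eq[symmetric] by (rule refl)
  have d: "gdist g (T x) (T y) = gdist g x y"
    if "x \<in> model_space g" "y \<in> model_space g" for x y
  proof -
    define z where "z = x - y"
    have z: "fst z = 0" using that Euclidean by (simp add: z_def)
    have "T x - T y = T z" unfolding z_def by (rule linear_diff[OF R(1), symmetric])
    also have "T z = (0, snd z - (2 * (snd z \<bullet> w) / (w \<bullet> w)) *\<^sub>R w)"
      using z by (simp add: T_def a_def b_def inner_prod_def prod_eq_iff)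
    finally have "norm (T x - T y) = norm (snd z)" using refl[of "snd z"] by (simp add: norm_Pair)
    also have "\<dots> = norm z" using z by (simp add: norm_prod_def)
    finally show ?thesis using Euclidean by (simp add: z_def)
  qed
  have "T base_point = p"
    using p1 by (simp add: T_def a_def b_def base_point_def inner_prod_def prod_eq_iff w_def)
  moreover have "sym_pair g T S"
    using R f nf d Euclidean by (intro sym_pairI) simp_all
  ultimately show ?thesis using R(3) by blast
next
  case Hyperbolic
  define w :: "'n ambient" where "w = base_point - p"
  define m where "m = lorentz w w"
  have pH: "p \<in> model_space Hyperbolic" using p unfolding Hyperbolic .
  have p': "(fst p)\<^sup>2 = 1 + snd p \<bullet> snd p" "lorentz p p = 1" "fst p > 0"
    using pH Hyperbolic_iff[of p] by (blast, simp_all)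
  have e: "lorentz x base_point = fst x" "lorentz base_point x = fst x" for x :: "'n ambient"
    by (simp_all add: lorentz_def base_point_def)
  have e1: "fst (base_point :: 'n ambient) = 1" by (simp add: base_point_def)
  have m: "m = 2 - 2 * fst p"
    by (simp add: m_def w_def lorentz_linear e e1 p'(2))
  have "m \<noteq> 0"
  proof
    assume "m = 0"
    then have "fst p = 1" using m by simp
    moreover from this have "snd p = 0" using p'(1) by simp
    ultimately show False using ne by (simp add: base_point_def prod_eq_iff)
  qed
  define a :: "'n ambient" where "a = (1 / m) *\<^sub>R (fst w, - snd w)"
  have xa: "x \<bullet> a = lorentz x w / m" for x
    by (simp add: a_def inner_prod_def lorentz_def diff_divide_distrib)
  have ab: "a \<bullet> w = 1" using \<open>m \<noteq> 0\<close> by (simp add: inner_commute[of a] xa m_def)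
  define T where "T = (\<lambda>x. x - (2 * (x \<bullet> a)) *\<^sub>R w)"
  define S where "S = (\<lambda>v. v - (2 * (v \<bullet> w)) *\<^sub>R a)"
  note R = reflection_pair[OF ab T_def S_def]
  have i: "lorentz (T x) (T y) = lorentz x y" for x y
  proof -
    have "lorentz (T x) (T y) = lorentz x y - 2 * (lorentz y w / m) * lorentz x w
        - 2 * (lorentz x w / m) * (lorentz y w - 2 * (lorentz y w / m) * m)"
      unfolding T_def xa lorentz_linear m_def[symmetric] lorentz_commute[of w y] by simp
    also have "\<dots> = lorentz x y" using \<open>m \<noteq> 0\<close> by simp
    finally show ?thesis .
  qed
  have Te: "T base_point = p"
  proof -
    have "lorentz base_point w = 1 - fst p" by (simp add: e w_def e1)
    then have "2 * (base_point \<bullet> a) = 1" using m \<open>m \<noteq> 0\<close> by (simp add: xa del: inner_base_point)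
    then show ?thesis by (simp add: T_def w_def del: inner_base_point)
  qed
  have pos: "fst (T x) > 0" if "fst x > 0" "lorentz x x > 0" for x
  proof -
    have "fst (T x) = lorentz (T x) (T p)" using R(3)[of base_point] Te e by simp
    also have "\<dots> = lorentz x p" by (rule i)
    also have "0 < \<dots>" using lorentz_pos[OF that(1) p'(3) that(2)] p'(2) by simp
    finally show ?thesis .
  qed
  have rad: "radius g (T x) = radius g x" for x
  proof (cases "lorentz x x > 0")
    case True
    then have "fst (T x) > 0 \<longleftrightarrow> fst x > 0"
      using pos[of x] pos[of "T x"] unfolding R(3) i by blast
    then show ?thesis unfolding Hyperbolic radius.simps i by simp
  next
    case False
    then show ?thesis unfolding Hyperbolic radius.simps i by simp
  qed
  define J :: "'n ambient \<Rightarrow> 'n ambient" where "J = (\<lambda>v. (fst v, - snd v))"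
  have J: "lorentz (J x) (J y) = lorentz x y" for x y by (simp add: J_def lorentz_def)
  have JS: "J (S v) = T (J v)" for v
  proof -
    have "m * (J v \<bullet> a) = lorentz (J v) w" unfolding xa using \<open>m \<noteq> 0\<close> by simp
    then have "v \<bullet> w = m * (J v \<bullet> a)" by (simp add: J_def inner_prod_def[of v w] lorentz_def)
    then have "(2 * (v \<bullet> w)) *\<^sub>R a = (2 * (J v \<bullet> a)) *\<^sub>R (fst w, - snd w)"
      using \<open>m \<noteq> 0\<close> by (simp add: a_def)
    then show ?thesis by (simp add: S_def T_def J_def prod_eq_iff)
  qed
  have nf: "normal_form g (S v) = normal_form g v" for v
    using Hyperbolic J[of "S v" "S v"] J[of v v] by (simp add: JS i)
  have "sym_pair g T S"
    using R rad nf Hyperbolic by (intro sym_pairI) (simp_all add: i)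
  then show ?thesis using R(3) Te by blast
qed

lemma base_point_model [simp]: "base_point \<in> model_space g"
  by (cases g) (simp_all add: base_point_def lorentz_def inner_prod_def)

lemma lorentz_base_point [simp]: "lorentz x base_point = fst x" "lorentz base_point x = fst x"
  by (simp_all add: lorentz_def base_point_def)

lemma isometry_fixing_base_point:
  fixes h :: "'n::finite ambient \<Rightarrow> 'n ambient"
  assumes h: "\<And>x. x \<in> model_space g \<Longrightarrow> h x \<in> model_space g"
    and d: "\<And>x y. x \<in> model_space g \<Longrightarrow> y \<in> model_space g \<Longrightarrow> gdist g (h x) (h y) = gdist g x y"
    and e: "h base_point = base_point"
    and x: "x \<in> model_space g" and y: "y \<in> model_space g"
  shows "fst (h x) = fst x" "snd (h x) \<bullet> snd (h y) = snd x \<bullet> snd y"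
proof -
  consider "g = Spherical" | "g = Euclidean" | "g = Hyperbolic" by (cases g)
  then have "fst (h x) = fst x \<and> snd (h x) \<bullet> snd (h y) = snd x \<bullet> snd y"
  proof cases
    case 1
    have i: "h x \<bullet> h y = x \<bullet> y" if "x \<in> model_space g" "y \<in> model_space g" for x y
    proof -
      have le: "\<bar>a \<bullet> b\<bar> \<le> 1" if "a \<in> model_space g" "b \<in> model_space g" for a b :: "'n ambient"
        using Cauchy_Schwarz_ineq2[of a b] that unfolding 1 by (simp add: norm_eq_1[symmetric])
      have "arccos (h x \<bullet> h y) = arccos (x \<bullet> y)" using d[OF that] unfolding 1 gdist.simps .
      then show ?thesis
        using arccos_eq_iff[of "h x \<bullet> h y" "x \<bullet> y"] le[OF that] le[OF h[OF that(1)] h[OF that(2)]] by blast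
    qed
    have f: "fst (h x) = fst x" if "x \<in> model_space g" for x
      using i[OF that base_point_model] by (simp add: e)
    show ?thesis using i[OF x y] f[OF x] f[OF y] by (simp add: inner_prod_def)
  next
    case 2
    have f: "fst (h x) = 1" "fst x = 1" if "x \<in> model_space g" for x
      using that h[OF that] 2 by auto
    have n: "norm (snd (h x) - snd (h y)) = norm (snd x - snd y)"
      if "x \<in> model_space g" "y \<in> model_space g" for x y
      using d[OF that] f[OF that(1)] f[OF that(2)] unfolding 2 by (simp add: norm_prod_def)
    have n0: "norm (snd (h x)) = norm (snd x)" if "x \<in> model_space g" for x
      using n[OF that base_point_model] unfolding e by (simp add: base_point_def)
    show ?thesis
      using n[OF x y] n0[OF x] n0[OF y] f[OF x] by (simp add: dot_norm_neg)
  next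
    case 3
    have i: "lorentz (h x) (h y) = lorentz x y" if "x \<in> model_space g" "y \<in> model_space g" for x y
    proof -
      have "lorentz a b \<ge> 1" if a: "a \<in> model_space g" and b: "b \<in> model_space g" for a b :: "'n ambient"
      proof -
        have "fst a \<ge> 1" "(norm (snd a))\<^sup>2 = (fst a)\<^sup>2 - 1" "fst b \<ge> 1" "(norm (snd b))\<^sup>2 = (fst b)\<^sup>2 - 1"
          using a b unfolding 3 Hyperbolic_iff power2_norm_eq_inner by linarith+
        note * = this
        have "(norm (snd a) * norm (snd b))\<^sup>2 = ((fst a)\<^sup>2 - 1) * ((fst b)\<^sup>2 - 1)"
          by (simp only: power_mult_distrib *)
        also have "\<dots> = (fst a * fst b - 1)\<^sup>2 - (fst a - fst b)\<^sup>2"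
          by (simp add: power2_eq_square algebra_simps)
        also have "\<dots> \<le> (fst a * fst b - 1)\<^sup>2" by simp
        finally have "norm (snd a) * norm (snd b) \<le> fst a * fst b - 1"
          by (rule power2_le_imp_le) (use mult_mono[OF *(1,3)] *(1,3) in simp)
        then show ?thesis using norm_cauchy_schwarz[of "snd a" "snd b"] by (simp add: lorentz_def)
      qed
      note ge = this
      have "arcosh (lorentz (h x) (h y)) = arcosh (lorentz x y)" using d[OF that] unfolding 3 gdist.simps .
      then show ?thesis
        using ge[OF that] ge[OF h[OF that(1)] h[OF that(2)]] cosh_arcosh_real by metis
    qed
    have f: "fst (h x) = fst x" if "x \<in> model_space g" for x
      using i[OF that base_point_model] by (simp add: e)
    show ?thesis using i[OF x y] f[OF x] f[OF y] by (simp add: lorentz_def)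
  qed
  then show "fst (h x) = fst x" "snd (h x) \<bullet> snd (h y) = snd x \<bullet> snd y" by auto
qed

lemma isometry_fixing_base_point_linear:
  fixes h :: "'n::finite ambient \<Rightarrow> 'n ambient"
  assumes h: "\<And>x. x \<in> model_space g \<Longrightarrow> h x \<in> model_space g"
    and d: "\<And>x y. x \<in> model_space g \<Longrightarrow> y \<in> model_space g \<Longrightarrow> gdist g (h x) (h y) = gdist g x y"
    and e: "h base_point = base_point"
  shows "\<exists>A. orthogonal_transformation A \<and> (\<forall>x \<in> model_space g. h x = (fst x, A (snd x)))"
proof -
  have I: "fst (h x) = fst x" "snd (h x) \<bullet> snd (h y) = snd x \<bullet> snd y"
    if "x \<in> model_space g" "y \<in> model_space g" for x y
    using isometry_fixing_base_point[of g h x y] h d e that by blast+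
  define s :: "real ^ 'n \<Rightarrow> 'n ambient" where
    "s u = ((case g of Spherical \<Rightarrow> 0 | Euclidean \<Rightarrow> 1 | Hyperbolic \<Rightarrow> sqrt 2), u)" for u
  have s: "s u \<in> model_space g" if "norm u = 1" for u
    using that by (cases g) (auto simp: s_def lorentz_def norm_eq_1)
  define f where "f u = snd (h (s u))" for u
  have f: "f u \<bullet> f v = u \<bullet> v" if "norm u = 1" "norm v = 1" for u v
    using I(2)[OF s[OF that(1)] s[OF that(2)]] by (simp add: f_def s_def)
  have f1: "norm (f u) = 1" if "norm u = 1" for u
    using f[OF that that] that by (simp add: norm_eq_1)
  have "dist (f u) (f v) = dist u v" if "norm u = 1" "norm v = 1" for u v
    using f[OF that] f1 that by (simp add: dist_norm norm_eq inner_diff_left inner_diff_right inner_commute norm_eq_1)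
  from isometry_sphere_extend[of f, OF f1 this]
  obtain A where A: "orthogonal_transformation A" and Af: "\<And>u. norm u = 1 \<Longrightarrow> A u = f u" by blast
  have "h x = (fst x, A (snd x))" if x: "x \<in> model_space g" for x
  proof -
    have "snd (h x) \<bullet> A u = A (snd x) \<bullet> A u" for u
    proof -
      have *: "snd (h x) \<bullet> A u = A (snd x) \<bullet> A u" if u: "norm u = 1" for u
      proof -
        have "snd (h x) \<bullet> A u = snd x \<bullet> snd (s u)"
          using I(2)[OF x s[OF u]] by (simp add: Af[OF u] f_def)
        also have "\<dots> = A (snd x) \<bullet> A u" using A by (simp add: s_def orthogonal_transformation_def)
        finally show ?thesis .
      qed
      have lA: "linear A" using A by (simp add: orthogonal_transformation_def)
      show ?thesis
      proof (cases "u = 0")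
        case True
        then show ?thesis using lA by (simp add: linear_0)
      next
        case False
        have "A u = norm u *\<^sub>R A (u /\<^sub>R norm u)" using False by (simp add: linear_cmul[OF lA])
        then show ?thesis using *[of "u /\<^sub>R norm u"] False by simp
      qed
    qed
    moreover have "surj A" by (rule orthogonal_transformation_surj[OF A])
    ultimately have "\<forall>z. snd (h x) \<bullet> z = A (snd x) \<bullet> z" by (metis surjD)
    then have "snd (h x) = A (snd x)" by (simp only: vector_eq_rdot)
    then show ?thesis using I(1)[OF x x] by (simp add: prod_eq_iff)
  qed
  then show ?thesis using A by blast
qed

lemma isometry_sym_pair:
  fixes f :: "'n::finite ambient \<Rightarrow> 'n ambient"
  assumes "isometry g f"
  shows "\<exists>T S. sym_pair g T S \<and> (\<forall>x \<in> model_space g. f x = T x)"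
proof -
  have fM: "f x \<in> model_space g" if "x \<in> model_space g" for x
    using assms that unfolding isometry_def by (blast dest: bij_betwE)
  have fd: "gdist g (f x) (f y) = gdist g x y" if "x \<in> model_space g" "y \<in> model_space g" for x y
    using assms that unfolding isometry_def by blast
  show ?thesis
  proof (cases "f base_point = base_point")
    case True
    from isometry_fixing_base_point_linear[OF fM fd True]
    show ?thesis using sym_pair_rotation[of _ g] by blast
  next
    case False
    obtain T S where R: "sym_pair g T S" "\<And>x. T (T x) = x" "T base_point = f base_point"
      using exists_reflection[OF fM[OF base_point_model] False] by blast
    have "(T \<circ> f) x \<in> model_space g" if "x \<in> model_space g" for x
      using fM[OF that] sym_pair_model[OF R(1)] by simp
    moreover have "gdist g ((T \<circ> f) x) ((T \<circ> f) y) = gdist g x y"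
      if "x \<in> model_space g" "y \<in> model_space g" for x y
      using fd[OF that] sym_pairD(6)[OF R(1) fM[OF that(1)] fM[OF that(2)]] by simp
    moreover have "(T \<circ> f) base_point = base_point" using R(2)[of base_point] R(3) by simp
    ultimately obtain A where A: "orthogonal_transformation A"
        "\<And>x. x \<in> model_space g \<Longrightarrow> (T \<circ> f) x = (fst x, A (snd x))"
      using isometry_fixing_base_point_linear[of g "T \<circ> f"] by blast
    let ?O = "\<lambda>x. (fst x, A (snd x))"
    have "sym_pair g (T \<circ> ?O) (S \<circ> ?O)"
      by (rule sym_pair_compose[OF R(1) sym_pair_rotation[OF A(1)]])
    moreover have "f x = (T \<circ> ?O) x" if "x \<in> model_space g" for x
      using A(2)[OF that] R(2)[of "f x"] by simp
    ultimately show ?thesis by blast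
  qed
qed

theorem gvolume_invariant:
  fixes f :: "'n::finite ambient \<Rightarrow> 'n ambient"
  assumes "isometry g f"
  shows "distr (gvolume g) (gvolume g) f = gvolume g"
proof -
  obtain T S where TS: "sym_pair g T S" and fT: "\<And>x. x \<in> model_space g \<Longrightarrow> f x = T x"
    using isometry_sym_pair[OF assms] by blast
  have vim: "f -` A \<inter> model_space g = T -` A" if "A \<subseteq> model_space g" for A
  proof (intro set_eqI iffI)
    fix x assume "x \<in> T -` A"
    then have "x \<in> model_space g" "T x \<in> A" using that sym_pair_model[OF TS, of x] by blast+
    then show "x \<in> f -` A \<inter> model_space g" by (simp add: fT)
  next
    fix x assume "x \<in> f -` A \<inter> model_space g"
    then show "x \<in> T -` A" using fT[of x] by simp
  qed
  have sb: "A \<in> sets (gvolume g) \<longleftrightarrow> A \<in> sets borel \<and> A \<subseteq> model_space g" for A :: "'n ambient set"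
    unfolding sets_gvolume by (subst sets_restrict_space_iff) auto
  have Tb: "T -` A \<in> sets borel \<and> T -` A \<subseteq> model_space g"
    if "A \<in> sets borel" "A \<subseteq> model_space g" for A
    using linear_borel_vimage[OF sym_pairD(1)[OF TS] that(1)] that(2) sym_pair_model[OF TS]
    by blast
  have f: "f \<in> measurable (gvolume g) (gvolume g)"
  proof (rule measurableI)
    show "f x \<in> space (gvolume g)" if "x \<in> space (gvolume g)" for x
      using that fT sym_pair_model[OF TS] by simp
    show "f -` A \<inter> space (gvolume g) \<in> sets (gvolume g)" if "A \<in> sets (gvolume g)" for A
      using that Tb[of A] by (auto simp: sb vim)
  qed
  show ?thesis
  proof (rule measure_eqI)
    fix A assume "A \<in> sets (distr (gvolume g) (gvolume g) f)"
    then have A: "A \<in> sets (gvolume g)" "A \<in> sets borel" "A \<subseteq> model_space g"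
      by (auto simp: sb)
    have cone: "cone_over (T -` A) = T -` cone_over A"
    proof (rule set_eqI)
      fix v
      show "v \<in> cone_over (T -` A) \<longleftrightarrow> v \<in> T -` cone_over A"
        unfolding cone_over_eq[OF A(3)] cone_over_eq[OF conjunct2[OF Tb[OF A(2,3)]]]
        by (simp add: sym_pairD(4)[OF TS] linear_cmul[OF sym_pairD(1)[OF TS]])
    qed
    have "emeasure (distr (gvolume g) (gvolume g) f) A = emeasure (gvolume g) (T -` A)"
      using A by (simp add: emeasure_distr[OF f] vim)
    also have "\<dots> = of_nat (CARD('n) + 1) * emeasure lborel (T -` cone_over A)"
      using Tb[OF A(2,3)] by (simp only: emeasure_gvolume cone)
    also have "emeasure lborel (T -` cone_over A) = emeasure lborel (cone_over A)"
      using sym_pairD(7)[OF TS] cone_over_borel[OF A(2,3)] unfolding lborel_preserving_def by blast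
    finally show "emeasure (distr (gvolume g) (gvolume g) f) A = emeasure (gvolume g) A"
      by (simp only: emeasure_gvolume[OF A(2,3)])
  qed simp
qed

theorem hyperplane_measure_invariant:
  fixes f :: "'n::finite ambient \<Rightarrow> 'n ambient"
  assumes "isometry g f"
  shows "distr (hyperplane_measure g) (hyperplane_measure g) ((`) f) = hyperplane_measure g"
proof -
  obtain T S where TS: "sym_pair g T S" and fT: "\<And>x. x \<in> model_space g \<Longrightarrow> f x = T x"
    using isometry_sym_pair[OF assms] by blast
  have bT: "bij T" by (rule sym_pair_bij[OF TS])
  have Sn: "S v \<in> normals g \<longleftrightarrow> v \<in> normals g" for v
    by (simp add: normals_def sym_pairD(5)[OF TS])
  have img: "f ` perp g v = perp g (S v)" for v
  proof (intro equalityI subsetI)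
    fix y assume "y \<in> f ` perp g v"
    then show "y \<in> perp g (S v)"
      by (auto simp: perp_def fT sym_pair_model[OF TS] sym_pairD(3)[OF TS])
  next
    fix y assume y: "y \<in> perp g (S v)"
    obtain x where x: "y = T x" using bT by (metis bij_pointE)
    then have "x \<in> perp g v" using y by (simp add: perp_def sym_pair_model[OF TS] sym_pairD(3)[OF TS])
    moreover from this have "y = f x" by (simp add: x perp_def fT)
    ultimately show "y \<in> f ` perp g v" by blast
  qed
  have fH: "f ` H \<in> hyperplanes g" if "H \<in> hyperplanes g" for H
  proof -
    obtain v where "v \<in> normals g" "H = perp g v" using \<open>H \<in> hyperplanes g\<close> unfolding hyperplanes_eq by blast
    then show ?thesis unfolding hyperplanes_eq using img[of v] Sn[of v] by blast
  qed
  have m: "(`) f \<in> measurable (hyperplane_algebra g) (hyperplane_algebra g)"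
  proof (rule measurable_sigma_sets[OF sets_hyperplane_algebra])
    show "{hitting g C |C. compact C \<and> C \<subseteq> model_space g} \<subseteq> Pow (hyperplanes g)"
      by (auto simp: hitting_def)
    show "(`) f \<in> space (hyperplane_algebra g) \<rightarrow> hyperplanes g" using fH by simp
    fix Y :: "'n ambient set set" assume "Y \<in> {hitting g C |C. compact C \<and> C \<subseteq> model_space g}"
    then obtain C where C: "Y = hitting g C" "compact C" "C \<subseteq> model_space g" by blast
    have "linear (inv T)" by (rule inj_linear_imp_inv_linear[OF sym_pairD(1)[OF TS] bij_is_inj[OF bT]])
    then have "compact (inv T ` C)" using C(2)
      by (intro compact_continuous_image linear_continuous_on) (simp_all add: linear_conv_bounded_linear)
    then have cT: "compact (T -` C)" using bT by (simp add: bij_vimage_eq_inv_image)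
    have sub: "T -` C \<subseteq> model_space g" using C(3) sym_pair_model[OF TS] by blast
    have "f ` H \<inter> C \<noteq> {} \<longleftrightarrow> H \<inter> T -` C \<noteq> {}" if "H \<in> hyperplanes g" for H
    proof -
      have "H \<subseteq> model_space g" using that by (auto simp: hyperplanes_def)
      then show ?thesis using fT by force
    qed
    then have "(`) f -` Y \<inter> space (hyperplane_algebra g) = hitting g (T -` C)"
      using fH by (auto simp: C(1) hitting_def)
    then show "(`) f -` Y \<inter> space (hyperplane_algebra g) \<in> sets (hyperplane_algebra g)"
      using hitting_measurable[OF cT sub] by simp
  qed
  show ?thesis
  proof (rule measure_eqI)
    let ?\<mu> = "hyperplane_measure g :: 'n ambient set measure"
    let ?\<nu> = "unnormalized_hyperplane_measure g :: 'n ambient set measure"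
    fix \<A> assume "\<A> \<in> sets (distr ?\<mu> ?\<mu> ((`) f))"
    then have A: "\<A> \<in> sets (hyperplane_algebra g)" by (simp add: sets_hyperplane_measure)
    let ?B = "(`) f -` \<A> \<inter> hyperplanes g"
    have B: "?B \<in> sets (hyperplane_algebra g)" using measurable_sets[OF m A] by simp
    have m': "(`) f \<in> measurable ?\<mu> ?\<mu>"
      using m measurable_cong_sets[OF sets_hyperplane_measure sets_hyperplane_measure] by blast
    have bor: "{v \<in> normals g. perp g v \<in> \<A>} \<in> sets borel"
    proof -
      have "{v \<in> normals g. perp g v \<in> \<A>} = perp g -` \<A> \<inter> space (restrict_space lborel (normals g))"
        by (auto simp: space_restrict_space)
      also have "\<dots> \<in> sets (restrict_space lborel (normals g))"
        by (rule measurable_sets[OF perp_measurable A])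
      finally show ?thesis by (simp add: sets_restrict_space_iff)
    qed
    have "emeasure ?\<nu> ?B = emeasure lborel {v \<in> normals g. perp g v \<in> ?B}"
      by (rule emeasure_unnormalized[OF B])
    also have "{v \<in> normals g. perp g v \<in> ?B} = S -` {v \<in> normals g. perp g v \<in> \<A>}"
      by (auto simp: img Sn hyperplanes_eq)
    also have "emeasure lborel \<dots> = emeasure lborel {v \<in> normals g. perp g v \<in> \<A>}"
      using sym_pairD(8)[OF TS] bor unfolding lborel_preserving_def by blast
    also have "\<dots> = emeasure ?\<nu> \<A>" by (rule emeasure_unnormalized[OF A, symmetric])
    finally have "emeasure ?\<nu> ?B = emeasure ?\<nu> \<A>" .
    then have "emeasure ?\<mu> ?B = emeasure ?\<mu> \<A>" by (simp add: hyperplane_measure_def Let_def)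
    then show "emeasure (distr ?\<mu> ?\<mu> ((`) f)) \<A> = emeasure ?\<mu> \<A>"
      using A by (simp add: emeasure_distr[OF m'] sets_hyperplane_measure)
  qed simp
qed

end

theory Submission imports Defs begin

text \<open>
  The idea is polarization (two-point symmetrization).  A hyperplane misses the convex hull of
  random points \<open>X\<^sub>1, \<dots>, X\<^sub>N\<close> of \<open>K\<close> if and only if all points lie strictly on one of its sides.  If \<open>p\<close> is
  the fraction of the volume of \<open>K\<close> on one side, this has probability \<open>p\<^sup>N + (1 - p)\<^sup>N\<close>.  Hence the expected value of \<open>U\<^sub>1\<close>
  is, up to a factor that depends only on the geometry, the integral of \<open>1 - p\<^sup>N - (1 - p)\<^sup>N\<close> over all hyperplanes
  (\<open>expected_U1_eq_cut_functional\<close>).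

  Let \<open>\<sigma>\<close> be a reflection and let \<open>K'\<close> be the polarization of \<open>K\<close>: wherever exactly one of two mirror points
  belongs to \<open>K\<close>, the one on the preferred side of the mirror is taken.  For a half-space and its mirror image,
  the sum of the volumes that they cut off is the same for \<open>K\<close> and \<open>K'\<close>, but for \<open>K'\<close> the two volumes lie further
  apart.  The function \<open>1 - p\<^sup>N - (1 - p)\<^sup>N\<close> is concave, so polarization does not increase the integral
  (\<open>cut_functional_polarize_le\<close>).

  It remains to approach the ball \<open>B\<close> of the same volume by polarizations.  If the preferred side contains the centre
  of \<open>B\<close>, polarization increases the volume of \<open>K \<inter> B\<close> at least by that of the part of \<open>B - K\<close> which \<open>\<sigma>\<close> maps into
  \<open>K - B\<close> (\<open>vol_gain\<close>).  For any two points \<open>x \<noteq> y\<close> there is a reflection that exchanges them (\<open>exists_bisector\<close>).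
  Quantitatively, an average over reflections shows that the gain can be made at least \<open>c\<close> times the product of the
  volumes of \<open>B - K\<close> and \<open>K - B\<close>, with \<open>c\<close> the same for all sets in a bounded region
  (\<open>exists_overlapping_reflection\<close>).  As the gains cannot add up indefinitely, sets with a functional not above that of
  \<open>K\<close> come arbitrarily close to \<open>B\<close> in measure (\<open>polarize_towards_sublevel\<close>), and Fatou's lemma passes to the limit
  (\<open>cut_functional_sublevel_le\<close>).

  Most formulas depend on the geometry only through its curvature, so the three cases are treated together.  On the
  sphere, isometries bring \<open>K\<close> and \<open>B\<close> into the open hemisphere around the base point, where no two points are antipodal.
\<close>

section \<open>Volumes of Lipschitz images\<close>

lemma Lipschitz_image_cube_covered:
  fixes f :: "'a::euclidean_space \<Rightarrow> 'a"
  assumes lip: "\<And>x y. x \<in> S \<Longrightarrow> y \<in> S \<Longrightarrow> norm (f x - f y) \<le> L * norm (x - y)" and L: "0 \<le> L"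
    and side: "\<And>i. i \<in> Basis \<Longrightarrow> v \<bullet> i - u \<bullet> i = l" and l: "0 \<le> l"
  shows "\<exists>W \<in> sets borel. f ` (S \<inter> cbox u v) \<subseteq> W \<and>
    emeasure lborel W \<le> ennreal ((2 * L * DIM('a)) ^ DIM('a)) * emeasure lborel (cbox u v)"
proof (cases "S \<inter> cbox u v = {}")
  case True
  then show ?thesis by (intro bexI[of _ "{}"]) auto
next
  case False
  then obtain z where z: "z \<in> S" "z \<in> cbox u v" by auto
  define r where "r = L * (l * DIM('a))"
  have r: "r \<ge> 0" using L l by (simp add: r_def)
  \<comment> \<open>the l1 norm bounds distances in a cube of side l by l times the dimension\<close>
  let ?W = "cbox (f z - r *\<^sub>R One) (f z + r *\<^sub>R One)"
  have "f x \<in> ?W" if x: "x \<in> S" "x \<in> cbox u v" for x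
  proof -
    have "norm (x - z) \<le> (\<Sum>i\<in>Basis. \<bar>(x - z) \<bullet> i\<bar>)" by (rule norm_le_l1)
    also have "\<dots> \<le> (\<Sum>i\<in>(Basis::'a set). l)"
    proof (rule sum_mono)
      fix i :: 'a assume i: "i \<in> Basis"
      have "u \<bullet> i \<le> x \<bullet> i" "x \<bullet> i \<le> v \<bullet> i" "u \<bullet> i \<le> z \<bullet> i" "z \<bullet> i \<le> v \<bullet> i"
        using x z i by (auto simp: mem_box)
      then show "\<bar>(x - z) \<bullet> i\<bar> \<le> l" using side[OF i] by (simp add: inner_diff_left abs_le_iff)
    qed
    also have "\<dots> = l * DIM('a)" by simp
    finally have "L * norm (x - z) \<le> r" unfolding r_def using L by (rule mult_left_mono)
    then have n: "norm (f x - f z) \<le> r" using lip[OF x(1) z(1)] by simp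
    have "\<bar>(f x - f z) \<bullet> i\<bar> \<le> r" if "i \<in> Basis" for i
      using Basis_le_norm[OF that, of "f x - f z"] n by simp
    then have "\<bar>f x \<bullet> i - f z \<bullet> i\<bar> \<le> r" if "i \<in> Basis" for i
      using that by (simp add: inner_diff_left)
    then show ?thesis
      unfolding mem_box by (force simp: inner_diff_left inner_add_left abs_le_iff)
  qed
  then have im: "f ` (S \<inter> cbox u v) \<subseteq> ?W" by blast
  have "emeasure lborel ?W = ennreal ((2 * L * DIM('a)) ^ DIM('a)) * emeasure lborel (cbox u v)"
  proof -
    have "emeasure lborel ?W = ennreal (\<Prod>b\<in>(Basis::'a set). 2 * r)"
      using r by (subst emeasure_lborel_cbox) (auto simp: inner_diff_left inner_add_left intro!: prod.cong)
    also have "\<dots> = ennreal ((2 * L * DIM('a)) ^ DIM('a) * l ^ DIM('a))"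
      by (simp add: r_def power_mult_distrib algebra_simps)
    also have "\<dots> = ennreal ((2 * L * DIM('a)) ^ DIM('a)) * ennreal (l ^ DIM('a))"
      using L l by (intro ennreal_mult) auto
    also have "ennreal (l ^ DIM('a)) = emeasure lborel (cbox u v)"
      using side l by (subst emeasure_lborel_cbox) (auto simp: inner_diff_left, smt (verit) side)
    finally show ?thesis .
  qed
  then show ?thesis using im by (intro bexI[of _ ?W] conjI) (simp_all only: order_refl, simp)
qed

text \<open>
  Cover \<open>S\<close> by cubes with disjoint interiors whose total volume barely exceeds that of \<open>S\<close>.
  The image of each cube is covered by a cube at most \<open>2 L DIM('a)\<close> times as large.  The constant is not
  sharp; only its independence of \<open>S\<close> and \<open>T\<close> matters.
\<close>
lemma emeasure_Lipschitz_image_le: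
  fixes f :: "'a::euclidean_space \<Rightarrow> 'a"
  assumes lip: "\<And>x y. x \<in> S \<Longrightarrow> y \<in> S \<Longrightarrow> norm (f x - f y) \<le> L * norm (x - y)" and L: "0 \<le> L"
    and S: "S \<in> sets borel" "bounded S" and T: "T \<in> sets borel" "T \<subseteq> f ` S"
  shows "emeasure lborel T \<le> ennreal ((2 * L * DIM('a)) ^ DIM('a)) * emeasure lborel S"
    (is "_ \<le> ?C * _")
proof -
  have finS: "emeasure lborel S \<noteq> \<infinity>" using emeasure_bounded_finite[OF S(2)] by simp
  have Sl: "S \<in> lmeasurable"
    by (rule bounded_set_imp_lmeasurable[OF S(2)]) (simp add: S(1) sets_completionI_sets)
  have eS: "emeasure lborel S = ennreal (measure lebesgue S)"
    using S(1) emeasure_eq_measure2[OF Sl] by simp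
  obtain c where c: "S \<subseteq> cbox (- c *\<^sub>R One) (c *\<^sub>R One)" "c > 0"
  proof -
    obtain B where B: "\<And>x. x \<in> S \<Longrightarrow> norm x \<le> B" using S(2) bounded_iff by blast
    have "x \<in> cbox (- (\<bar>B\<bar> + 1) *\<^sub>R One) ((\<bar>B\<bar> + 1) *\<^sub>R One)" if "x \<in> S" for x
    proof -
      have "\<bar>x \<bullet> i\<bar> \<le> \<bar>B\<bar> + 1" if "i \<in> Basis" for i
        using Basis_le_norm[OF that, of x] B[OF \<open>x \<in> S\<close>] by simp
      then show ?thesis unfolding mem_box by (force simp: abs_le_iff)
    qed
    then show ?thesis by (intro that[of "\<bar>B\<bar> + 1"]) auto
  qed
  have box: "box (- c *\<^sub>R One) (c *\<^sub>R One :: 'a) \<noteq> {}" using c(2) by (simp add: box_ne_empty)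
  have approx: "emeasure lborel T \<le> ?C * (emeasure lborel S + ennreal e)" if e: "e > 0" for e
  proof -
    obtain \<D> where D: "countable \<D>"
      "\<And>K. K \<in> \<D> \<Longrightarrow> K \<subseteq> cbox (- c *\<^sub>R One) (c *\<^sub>R One) \<and> K \<noteq> {} \<and> (\<exists>u v. K = cbox u v)"
      "pairwise (\<lambda>A B. interior A \<inter> interior B = {}) \<D>"
      "\<And>u v. cbox u v \<in> \<D> \<Longrightarrow> \<exists>n. \<forall>i \<in> Basis. v\<bullet>i - u\<bullet>i = ((c *\<^sub>R One)\<bullet>i - (- c *\<^sub>R One)\<bullet>i)/2^n"
      "S \<subseteq> \<Union>\<D>" "\<Union>\<D> \<in> lmeasurable" "measure lebesgue (\<Union>\<D>) \<le> measure lebesgue S + e"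
      using measurable_outer_intervals_bounded[OF Sl c(1) e] by metis
    have ex: "\<exists>W \<in> sets borel. f ` (S \<inter> K) \<subseteq> W \<and> emeasure lborel W \<le> ?C * emeasure lborel (interior K)"
      if K: "K \<in> \<D>" for K
    proof -
      obtain u v where uv: "K = cbox u v" using D(2)[OF K] by blast
      obtain n where n: "\<And>i. i \<in> Basis \<Longrightarrow> v\<bullet>i - u\<bullet>i = ((c *\<^sub>R One)\<bullet>i - (- c *\<^sub>R One)\<bullet>i)/2^n"
        using D(4)[of u v] K uv by blast
      have "\<exists>W \<in> sets borel. f ` (S \<inter> cbox u v) \<subseteq> W \<and> emeasure lborel W \<le> ?C * emeasure lborel (cbox u v)"
        using c(2) by (intro Lipschitz_image_cube_covered[where l = "2 * c / 2 ^ n"] lip L)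
          (auto simp: n)
      moreover have "emeasure lborel (cbox u v) = emeasure lborel (box u v)"
        by (simp add: emeasure_lborel_cbox_eq emeasure_lborel_box_eq)
      ultimately show ?thesis unfolding uv by simp
    qed
    then obtain W where W: "\<And>K. K \<in> \<D> \<Longrightarrow> W K \<in> sets borel" "\<And>K. K \<in> \<D> \<Longrightarrow> f ` (S \<inter> K) \<subseteq> W K"
      "\<And>K. K \<in> \<D> \<Longrightarrow> emeasure lborel (W K) \<le> ?C * emeasure lborel (interior K)" by metis
    \<comment> \<open>the cubes are indexed by natural numbers, with empty sets at the unused indices\<close>
    define I where "I = to_nat_on \<D> ` \<D>"
    define Z where "Z n = (if n \<in> I then W (from_nat_into \<D> n) else {})" for n
    define J where "J n = (if n \<in> I then interior (from_nat_into \<D> n) else {})" for n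
    have inI: "from_nat_into \<D> n \<in> \<D>" "to_nat_on \<D> (from_nat_into \<D> n) = n" if "n \<in> I" for n
      using that D(1) by (auto simp: I_def)
    have Zb: "range Z \<subseteq> sets lborel" using W(1) inI by (auto simp: Z_def)
    have Jb: "range J \<subseteq> sets lborel" by (auto simp: J_def)
    have disj: "disjoint_family J"
      unfolding disjoint_family_on_def
    proof (intro ballI impI)
      fix m n :: nat assume "m \<noteq> n"
      show "J m \<inter> J n = {}"
      proof (cases "m \<in> I \<and> n \<in> I")
        case True
        then have "from_nat_into \<D> m \<noteq> from_nat_into \<D> n" using inI \<open>m \<noteq> n\<close> by metis
        then show ?thesis using True D(3) inI by (auto simp: J_def pairwise_def)
      qed (auto simp: J_def)
    qed
    have "T \<subseteq> (\<Union>n. Z n)"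
    proof
      fix t assume "t \<in> T"
      then obtain x where x: "x \<in> S" "t = f x" using T(2) by auto
      then obtain K where K: "K \<in> \<D>" "x \<in> K" using D(5) by auto
      have "t \<in> W K" using W(2)[OF K(1)] x K by auto
      then have "t \<in> Z (to_nat_on \<D> K)" using K(1) D(1) by (simp add: Z_def I_def)
      then show "t \<in> (\<Union>n. Z n)" by blast
    qed
    then have "emeasure lborel T \<le> emeasure lborel (\<Union>n. Z n)"
      using Zb by (intro emeasure_mono) auto
    also have "\<dots> \<le> (\<Sum>n. emeasure lborel (Z n))" by (rule emeasure_subadditive_countably[OF Zb])
    also have "\<dots> \<le> (\<Sum>n. ?C * emeasure lborel (J n))"
      by (intro suminf_le) (auto simp: Z_def J_def W(3) inI)
    also have "\<dots> = ?C * (\<Sum>n. emeasure lborel (J n))" by simp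
    also have "(\<Sum>n. emeasure lborel (J n)) = emeasure lborel (\<Union>n. J n)"
      by (rule suminf_emeasure[OF Jb disj])
    also have "\<dots> = emeasure lebesgue (\<Union>n. J n)" using Jb by simp
    also have "\<dots> \<le> emeasure lebesgue (\<Union>\<D>)"
    proof (rule emeasure_mono)
      have "J n \<subseteq> \<Union>\<D>" for n using interior_subset inI(1)[of n] by (auto simp: J_def)
      then show "(\<Union>n. J n) \<subseteq> \<Union>\<D>" by blast
      show "\<Union>\<D> \<in> sets lebesgue" using D(6) by (rule fmeasurableD)
    qed
    also have "\<dots> = ennreal (measure lebesgue (\<Union>\<D>))"
      using D(6) by (simp add: emeasure_eq_measure2)
    also have "\<dots> \<le> ennreal (measure lebesgue S + e)" using D(7) by (rule ennreal_leI)
    also have "\<dots> = emeasure lborel S + ennreal e" using e by (simp add: eS)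
    finally show ?thesis by (simp add: mult_left_mono)
  qed
  have "((\<lambda>e. ?C * (emeasure lborel S + ennreal e)) \<longlongrightarrow> ?C * (emeasure lborel S + ennreal 0)) (at_right 0)"
    by (intro ennreal_tendsto_cmult tendsto_add tendsto_ennrealI tendsto_const tendsto_ident_at) auto
  then have "emeasure lborel T \<le> ?C * (emeasure lborel S + ennreal 0)"
    by (rule tendsto_lowerbound) (auto simp: eventually_at_right_less intro!: eventually_at_rightI[of 0 1] approx)
  then show ?thesis by simp
qed

section \<open>Reflections of the model spaces\<close>

text \<open>
  One parameter, the sectional curvature, lets all three geometries be treated by the same formulas:
  the model space consists of solutions of \<open>model_form g x x = 1\<close>, and \<open>normal_form g v\<close> is the
  pairing of \<open>v\<close> with its conormal.
\<close>
fun curvature :: "geometry \<Rightarrow> real" where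
  "curvature Spherical = 1"
| "curvature Euclidean = 0"
| "curvature Hyperbolic = - 1"

text \<open>
  The direction in which the reflection in the hyperplane with normal vector \<open>v\<close> moves points:
  \<open>v\<close> lives in the dual space, its conormal in the space that contains the model.
\<close>
definition conormal :: "geometry \<Rightarrow> 'n::finite ambient \<Rightarrow> 'n ambient" where
  "conormal g v = (curvature g * fst v, snd v)"

definition model_form :: "geometry \<Rightarrow> 'n::finite ambient \<Rightarrow> 'n ambient \<Rightarrow> real" where
  "model_form g x y = fst x * fst y + curvature g * (snd x \<bullet> snd y)"

definition reflect :: "geometry \<Rightarrow> 'n::finite ambient \<Rightarrow> 'n ambient \<Rightarrow> 'n ambient" where
  "reflect g v x = x - (2 * (x \<bullet> v)) *\<^sub>R (conormal g v /\<^sub>R normal_form g v)"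

text \<open>
  The contragredient action of the reflection on normal vectors.
\<close>
definition coreflect :: "geometry \<Rightarrow> 'n::finite ambient \<Rightarrow> 'n ambient \<Rightarrow> 'n ambient" where
  "coreflect g v w = w - (2 * (w \<bullet> (conormal g v /\<^sub>R normal_form g v))) *\<^sub>R v"

lemma normal_form_eq_inner: "normal_form g v = v \<bullet> conormal g v"
  by (cases g) (auto simp: conormal_def inner_prod_def lorentz_def)

lemma linear_conormal: "linear (conormal g)"
  by (intro linearI) (auto simp: conormal_def algebra_simps)

lemma norm_conormal_le: "norm (conormal g v) \<le> norm v"
  by (cases g) (auto simp: conormal_def norm_prod_def)

lemma model_form_conormal: "model_form g x (conormal g v) = curvature g * (x \<bullet> v)"
  by (simp add: model_form_def conormal_def inner_prod_def algebra_simps)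

lemma model_form_commute: "model_form g x y = model_form g y x"
  by (simp add: model_form_def inner_commute algebra_simps)

lemma model_form_diff_left: "model_form g (x - y) z = model_form g x z - model_form g y z"
  and model_form_scale_left: "model_form g (a *\<^sub>R x) z = a * model_form g x z"
  by (simp_all add: model_form_def algebra_simps)

lemma model_form_diff_right: "model_form g z (x - y) = model_form g z x - model_form g z y"
  and model_form_scale_right: "model_form g z (a *\<^sub>R x) = a * model_form g z x"
  by (simp_all add: model_form_def algebra_simps)

lemma model_form_self: "x \<in> model_space g \<Longrightarrow> model_form g x x = 1"
  by (cases g) (auto simp: model_form_def inner_prod_def lorentz_def base_point_def)

lemma model_form_Spherical: "model_form Spherical x y = x \<bullet> y"
  and model_form_Euclidean: "model_form Euclidean x y = fst x * fst y"
  and model_form_Hyperbolic: "model_form Hyperbolic x y = lorentz x y"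
  by (simp_all add: model_form_def inner_prod_def lorentz_def)

context
  fixes g and v :: "'n::finite ambient"
  assumes v: "normal_form g v > 0"
begin

lemma reflection_vector: "v \<bullet> (conormal g v /\<^sub>R normal_form g v) = 1"
  using v by (simp add: normal_form_eq_inner)

lemmas reflect_pair = reflection_pair[OF reflection_vector, of "reflect g v" "coreflect g v"]

lemma linear_reflect: "linear (reflect g v)" and linear_coreflect: "linear (coreflect g v)"
  and reflect_reflect [simp]: "reflect g v (reflect g v x) = x"
  and inner_reflect_coreflect: "reflect g v x \<bullet> coreflect g v w = x \<bullet> w"
  using reflect_pair by (auto simp: reflect_def[abs_def] coreflect_def[abs_def])

lemma inner_coreflect: "x \<bullet> coreflect g v w = reflect g v x \<bullet> w"
  using inner_reflect_coreflect[of "reflect g v x" w] by simp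

lemma reflect_inner_normal: "reflect g v x \<bullet> v = - (x \<bullet> v)"
  using v by (simp add: reflect_def inner_diff_left inner_commute[of "conormal g v"] normal_form_eq_inner)

lemma inner_diff_reflect:
  "x \<bullet> w - reflect g v x \<bullet> w = 2 * (x \<bullet> v) * (conormal g v \<bullet> w) / normal_form g v"
  by (simp add: reflect_def inner_diff_left divide_inverse)

lemma reflect_fix: "x \<bullet> v = 0 \<Longrightarrow> reflect g v x = x"
  by (simp add: reflect_def)

lemma reflect_scale:
  assumes "c \<noteq> 0"
  shows "reflect g (c *\<^sub>R v) x = reflect g v x"
  using assms v linear_cmul[OF linear_conormal, of g c v]
  by (simp add: reflect_def normal_form_scaleR power2_eq_square)

lemma model_form_reflect: "model_form g (reflect g v x) (reflect g v y) = model_form g x y"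
proof -
  define k where "k = normal_form g v"
  have k: "k > 0" "conormal g v \<bullet> v = k" using v by (simp_all add: k_def normal_form_eq_inner inner_commute)
  have "model_form g (conormal g v) y = curvature g * (y \<bullet> v)" for y
    by (metis model_form_commute model_form_conormal)
  then show ?thesis using k
    by (simp add: reflect_def k_def[symmetric] model_form_diff_left model_form_diff_right
        model_form_scale_left model_form_scale_right model_form_conormal inner_diff_left)
       (simp add: field_simps)
qed

lemma fst_reflect_Euclidean: "g = Euclidean \<Longrightarrow> fst (reflect g v x) = fst x"
  unfolding reflect_def by (simp add: conormal_def)

text \<open>
  In the hyperbolic case preservation of the form leaves the possibility that the two sheets of the
  hyperboloid are exchanged.  This is excluded because a timelike \<open>x\<close> and its image have Lorentz product
  \<open>lorentz x x + 2 (x \<bullet> v)\<^sup>2 / normal_form g v > 0\<close>, so that they point to the same side.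
\<close>
lemma radius_reflect: "radius g (reflect g v x) = radius g x"
proof (cases g)
  case Spherical
  then show ?thesis using model_form_reflect[of x x] by (simp add: model_form_Spherical norm_eq_sqrt_inner)
next
  case Euclidean
  then show ?thesis using fst_reflect_Euclidean[of x] by simp
next
  case Hyperbolic
  have i: "lorentz (reflect g v x) (reflect g v y) = lorentz x y" for x y
    using model_form_reflect Hyperbolic by (simp add: model_form_Hyperbolic)
  have pos: "fst (reflect g v x) > 0" if x: "fst x > 0" "lorentz x x > 0" for x
  proof (rule ccontr)
    assume "\<not> ?thesis"
    then consider "fst (reflect g v x) = 0" | "fst (- reflect g v x) > 0" by force
    then show False
    proof cases
      case 1
      then have "lorentz (reflect g v x) (reflect g v x) \<le> 0" by (simp add: lorentz_def)
      then show False using i x by simp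
    next
      case 2
      have "lorentz (- reflect g v x) (- reflect g v x) > 0"
        using i[of x x] x by (simp add: lorentz_def)
      from lorentz_pos[OF x(1) 2 x(2) this]
      have neg: "lorentz x (reflect g v x) < 0" by (simp add: lorentz_def)
      have "lorentz x (reflect g v x) = lorentz x x + 2 * (x \<bullet> v)\<^sup>2 / normal_form g v"
        using model_form_conormal[of Hyperbolic x v]
        by (simp add: Hyperbolic reflect_def lorentz_linear model_form_Hyperbolic power2_eq_square divide_inverse)
      then show False using neg x v by (smt (verit) divide_nonneg_pos zero_le_power2)
    qed
  qed
  have "fst (reflect g v x) > 0 \<longleftrightarrow> fst x > 0" if "lorentz x x > 0"
    using pos[of x] pos[of "reflect g v x"] that by (auto simp: i)
  then show ?thesis unfolding Hyperbolic radius.simps i[unfolded Hyperbolic]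
    by (auto simp: Hyperbolic)
qed

lemma gdist_reflect:
  assumes "x \<in> model_space g" "y \<in> model_space g"
  shows "gdist g (reflect g v x) (reflect g v y) = gdist g x y"
proof (cases g)
  case Euclidean
  define z where "z = x - y"
  have z: "fst z = 0" using assms Euclidean by (simp add: z_def)
  have "reflect g v x - reflect g v y = reflect g v z"
    unfolding z_def by (rule linear_diff[OF linear_reflect, symmetric])
  also have "norm \<dots> = norm z"
  proof -
    have "snd v \<bullet> snd v > 0" using v Euclidean by simp
    then show ?thesis using z Euclidean
      by (simp add: norm_eq_sqrt_inner reflect_def conormal_def inner_prod_def inner_diff_left
          inner_diff_right inner_commute)
  qed
  finally show ?thesis using Euclidean by (simp add: z_def)
qed (use model_form_reflect[of x y] in \<open>simp_all add: model_form_Spherical model_form_Hyperbolic\<close>)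

lemma sym_pair_reflect: "sym_pair g (reflect g v) (coreflect g v)"
proof (rule sym_pairI)
  have nf: "coreflect g v w \<bullet> conormal g (coreflect g v w) = w \<bullet> conormal g w" for w
  proof -
    define k where "k = normal_form g v"
    have k: "k > 0" "v \<bullet> conormal g v = k" using v by (simp_all add: k_def normal_form_eq_inner)
    have s: "v \<bullet> conormal g w = w \<bullet> conormal g v"
      by (simp add: conormal_def inner_prod_def inner_commute)
    show ?thesis using k
      by (simp add: coreflect_def k_def[symmetric] linear_diff[OF linear_conormal]
          linear_cmul[OF linear_conormal] inner_diff_left inner_diff_right s)
         (simp add: field_simps)
  qed
  show "normal_form g (coreflect g v w) = normal_form g w" for w
    using nf by (simp add: normal_form_eq_inner)
  show "lborel_preserving (reflect g v)" "lborel_preserving (coreflect g v)"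
    using reflect_pair by (auto simp: reflect_def[abs_def] coreflect_def[abs_def])
qed (simp_all add: linear_reflect linear_coreflect inner_reflect_coreflect radius_reflect gdist_reflect)

lemma reflect_model [simp]: "reflect g v x \<in> model_space g \<longleftrightarrow> x \<in> model_space g"
  by (rule sym_pair_model[OF sym_pair_reflect])

end

text \<open>
  A monotone function of the distance to the base point, chosen to be polynomial in the coordinates.
\<close>
fun polar_height :: "geometry \<Rightarrow> 'n::finite ambient \<Rightarrow> real" where
  "polar_height Spherical x = - fst x"
| "polar_height Euclidean x = snd x \<bullet> snd x"
| "polar_height Hyperbolic x = fst x"

text \<open>
  The condition \<open>fst v \<ge> 0\<close> puts the base point on the side \<open>0 \<le> x \<bullet> v\<close>; of two mirror points, the one on
  that side is then the closer one to the base point.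
\<close>
lemma polar_height_le_reflect:
  assumes v: "normal_form g v > 0" and x: "x \<in> model_space g" "x \<bullet> v \<ge> 0" and fv: "fst v \<ge> 0"
  shows "polar_height g x \<le> polar_height g (reflect g v x)"
proof (cases g)
  case Euclidean
  define k where "k = normal_form g v"
  have k: "k > 0" "snd v \<bullet> snd v = k" using v by (simp_all add: k_def Euclidean)
  have f: "fst x = 1" using x Euclidean by simp
  have "polar_height g (reflect g v x) = snd x \<bullet> snd x + 4 * (x \<bullet> v) * fst v / k"
  proof -
    define s where "s = snd x \<bullet> snd v"
    have sc: "snd v \<bullet> snd x = s" by (simp add: s_def inner_commute)
    have xv: "x \<bullet> v = fst v + s" using f by (simp add: inner_prod_def s_def)
    show ?thesis unfolding Euclidean polar_height.simps
      by (simp add: reflect_def conormal_def k_def[symmetric, unfolded Euclidean] inner_diff_left inner_diff_right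
          sc s_def[symmetric] k(2) xv)
         (use k(1) in \<open>simp add: field_simps\<close>)
  qed
  moreover have "0 \<le> 4 * (x \<bullet> v) * fst v / k" using k x fv by simp
  ultimately show ?thesis using Euclidean by simp
next
  case Spherical
  have "0 \<le> 2 * (x \<bullet> v) * (fst v / normal_form g v)" using v x fv by simp
  then show ?thesis by (simp add: Spherical reflect_def conormal_def divide_inverse ac_simps)
next
  case Hyperbolic
  have "0 \<le> 2 * (x \<bullet> v) * (fst v / normal_form g v)" using v x fv by simp
  then show ?thesis by (simp add: Hyperbolic reflect_def conormal_def divide_inverse ac_simps)
qed

text \<open>
  The part of the model space that the central projection \<open>x \<mapsto> snd x / fst x\<close> maps into a ball.  It lies on
  one side of the equator, where bisecting hyperplanes are described by one formula in all three geometries.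
\<close>
definition chart_ball :: "geometry \<Rightarrow> real \<Rightarrow> 'n::finite ambient set" where
  "chart_ball g q = {x \<in> model_space g. 0 < fst x \<and> norm (snd x) \<le> q * fst x}"

text \<open>
  The reflection in the perpendicular bisector of \<open>x\<close> and \<open>y\<close> exchanges them.  Up to normalization its
  normal vector is \<open>(v\<^sub>0, snd x - snd y)\<close>, where \<open>v\<^sub>0\<close> is determined by the condition that \<open>x + y\<close> lies
  in the hyperplane; the model equations then give the conormal \<open>x - y\<close>.  The estimate of \<open>v\<^sub>0\<close> keeps all
  these normal vectors in a fixed ball, which in the hyperbolic case requires \<open>q < 1\<close>.
\<close>
lemma exists_bisector:
  fixes x y :: "'n::finite ambient"
  assumes x: "x \<in> chart_ball g q" and y: "y \<in> chart_ball g q" and ne: "x \<noteq> y"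
    and k: "0 < k" "k \<le> 1" "k \<le> 1 + curvature g * q\<^sup>2"
  shows "\<exists>v. normal_form g v = 1 \<and> reflect g v y = x \<and> (norm v)\<^sup>2 \<le> (1 + q\<^sup>2) / k"
proof -
  define d where "d = snd x - snd y"
  define s where "s = fst x + fst y"
  define v0 where "v0 = - (d \<bullet> (snd x + snd y)) / s"
  define b where "b = (v0, d)"
  have s: "s > 0" using x y by (simp add: chart_ball_def s_def)
  have q: "q \<ge> 0"
  proof -
    have "0 \<le> norm (snd x)" by simp
    also have "\<dots> \<le> q * fst x" using x by (simp add: chart_ball_def)
    finally have "0 \<le> q * fst x" .
    then show ?thesis using x by (auto simp: chart_ball_def zero_le_mult_iff)
  qed
  have form: "fst z * fst z + curvature g * (snd z \<bullet> snd z) = 1" if "z \<in> chart_ball g q" for z :: "'n ambient"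
    using model_form_self[of z g] that by (simp add: chart_ball_def model_form_def)
  have dd: "d \<bullet> (snd x + snd y) = snd x \<bullet> snd x - snd y \<bullet> snd y"
    by (simp add: d_def inner_diff_left inner_diff_right inner_add_right inner_commute)
  have con: "conormal g b = x - y"
  proof -
    have "curvature g * (snd x \<bullet> snd x - snd y \<bullet> snd y) = - ((fst x - fst y) * s)"
      using form[OF x] form[OF y] by (simp add: s_def algebra_simps)
    moreover have "curvature g * v0 = - (curvature g * (snd x \<bullet> snd x - snd y \<bullet> snd y)) / s"
      unfolding v0_def dd by (simp add: algebra_simps diff_divide_distrib)
    ultimately have "curvature g * v0 = fst x - fst y" using s by simp
    then show ?thesis by (simp add: conormal_def b_def d_def prod_eq_iff)
  qed
  have mid: "b \<bullet> (x + y) = 0"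
    using s by (simp add: b_def inner_prod_def v0_def s_def[symmetric])
  have d0: "d \<noteq> 0"
  proof
    assume "d = 0"
    then have "v0 = 0" by (simp add: v0_def)
    then have "conormal g b = 0" using \<open>d = 0\<close> by (simp add: b_def conormal_def zero_prod_def)
    then show False using con ne by simp
  qed
  have v0: "v0\<^sup>2 \<le> q\<^sup>2 * (norm d)\<^sup>2"
  proof -
    have "\<bar>d \<bullet> (snd x + snd y)\<bar> \<le> norm d * norm (snd x + snd y)" by (rule Cauchy_Schwarz_ineq2)
    also have "\<dots> \<le> norm d * (q * s)"
      using x y norm_triangle_ineq[of "snd x" "snd y"]
      by (intro mult_left_mono) (simp_all add: chart_ball_def s_def algebra_simps)
    finally have "\<bar>v0\<bar> * s \<le> (q * norm d) * s"
      unfolding v0_def using s by (simp only: abs_divide abs_minus_cancel abs_of_pos) (simp add: ac_simps)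
    then have "\<bar>v0\<bar> \<le> q * norm d" using s by simp
    then have "\<bar>v0\<bar>\<^sup>2 \<le> (q * norm d)\<^sup>2" by (intro power_mono) auto
    then show ?thesis by (simp add: power_mult_distrib)
  qed
  have nf: "normal_form g b = curvature g * v0\<^sup>2 + (norm d)\<^sup>2"
    by (simp add: normal_form_eq_inner conormal_def b_def inner_prod_def dot_square_norm power2_eq_square)
  have nfk: "k * (norm d)\<^sup>2 \<le> normal_form g b"
  proof (cases "g = Hyperbolic")
    case True
    have "k * (norm d)\<^sup>2 \<le> (1 - q\<^sup>2) * (norm d)\<^sup>2" using k True by (intro mult_right_mono) auto
    then show ?thesis using v0 True unfolding nf by (simp add: algebra_simps)
  next
    case False
    then have "curvature g \<ge> 0" by (cases g) auto
    moreover have "k * (norm d)\<^sup>2 \<le> 1 * (norm d)\<^sup>2" using k by (intro mult_right_mono) auto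
    ultimately show ?thesis unfolding nf by (simp add: add_increasing)
  qed
  moreover have "0 < k * (norm d)\<^sup>2" using k d0 by simp
  ultimately have pos: "normal_form g b > 0" by linarith
  define v where "v = (1 / sqrt (normal_form g b)) *\<^sub>R b"
  have "normal_form g v = 1" using pos by (simp add: v_def normal_form_scaleR power_divide)
  moreover have "reflect g v y = x"
  proof -
    have "b \<bullet> y + b \<bullet> y = - normal_form g b"
      using mid by (simp add: normal_form_eq_inner con inner_add_right inner_diff_right)
    then have "2 * (y \<bullet> b) = - normal_form g b" by (simp add: inner_commute)
    then have "reflect g b y = x" using pos by (simp add: reflect_def con)
    moreover have "reflect g v y = reflect g b y"
      unfolding v_def using pos by (intro reflect_scale[OF pos]) simp
    ultimately show ?thesis by simp
  qed
  moreover have "(norm v)\<^sup>2 \<le> (1 + q\<^sup>2) / k"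
  proof -
    have "(norm b)\<^sup>2 = v0\<^sup>2 + (norm d)\<^sup>2" by (simp add: b_def norm_prod_def)
    also have "\<dots> \<le> (1 + q\<^sup>2) * (norm d)\<^sup>2" using v0 by (simp add: algebra_simps)
    also have "\<dots> = (1 + q\<^sup>2) / k * (k * (norm d)\<^sup>2)" using k by simp
    also have "\<dots> \<le> (1 + q\<^sup>2) / k * normal_form g b" using nfk k by (intro mult_left_mono) auto
    finally have "(norm b)\<^sup>2 / normal_form g b \<le> (1 + q\<^sup>2) / k" using pos by (simp add: pos_divide_le_eq)
    then show ?thesis using pos by (simp add: v_def power_mult_distrib power_divide)
  qed
  ultimately show ?thesis by blast
qed

section \<open>Polarization and volume\<close>

lemma sets_gvolume_iff: "A \<in> sets (gvolume g) \<longleftrightarrow> A \<in> sets borel \<and> A \<subseteq> model_space g"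
  unfolding sets_gvolume by (subst sets_restrict_space_iff) auto

lemma measurable_gvolume_borel:
  "f \<in> borel_measurable borel \<Longrightarrow> f \<in> borel_measurable (gvolume g)"
  by (simp add: measurable_cong_sets[OF sets_gvolume refl] measurable_restrict_space1)

lemma sym_pair_vimage_sets:
  assumes "sym_pair g T S" "A \<in> sets (gvolume g)"
  shows "T -` A \<in> sets (gvolume g)"
proof -
  have "T -` A \<subseteq> model_space g"
    using assms sym_pair_model[OF assms(1)] unfolding sets_gvolume_iff by blast
  then show ?thesis
    using linear_borel_vimage[OF sym_pairD(1)[OF assms(1)], of A] assms(2) by (simp add: sets_gvolume_iff)
qed

text \<open>
  Taking cones commutes with \<open>T\<close>, and \<open>T\<close> preserves Lebesgue measure.
\<close>
lemma emeasure_gvolume_sym_pair: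
  fixes T :: "'n::finite ambient \<Rightarrow> 'n ambient"
  assumes TS: "sym_pair g T S" and A: "A \<in> sets (gvolume g)"
  shows "emeasure (gvolume g) (T -` A) = emeasure (gvolume g) A"
proof -
  have A': "A \<in> sets borel" "A \<subseteq> model_space g" using A by (auto simp: sets_gvolume_iff)
  have TA: "T -` A \<in> sets borel" "T -` A \<subseteq> model_space g"
    using sym_pair_vimage_sets[OF TS A] by (auto simp: sets_gvolume_iff)
  have "cone_over (T -` A) = T -` cone_over A"
    unfolding cone_over_eq[OF A'(2)] cone_over_eq[OF TA(2)]
    by (intro set_eqI) (simp add: sym_pairD(4)[OF TS] linear_cmul[OF sym_pairD(1)[OF TS]])
  then show ?thesis
    using sym_pairD(7)[OF TS] cone_over_borel[OF A'] A' TA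
    by (simp add: emeasure_gvolume lborel_preserving_def)
qed

lemma emeasure_gvolume_bounded:
  fixes A :: "'n::finite ambient set"
  assumes "A \<in> sets (gvolume g)" "bounded A"
  shows "emeasure (gvolume g) A < \<infinity>"
proof -
  have A: "A \<in> sets borel" "A \<subseteq> model_space g" using assms by (auto simp: sets_gvolume_iff)
  obtain B where B: "\<And>x. x \<in> A \<Longrightarrow> norm x \<le> B" using assms(2) by (auto simp: bounded_iff)
  have "norm v \<le> B" if "v \<in> cone_over A" for v
  proof -
    have "\<exists>t x. v = t *\<^sub>R x \<and> 0 < t \<and> t \<le> 1 \<and> x \<in> A"
      using that by (simp add: cone_over_def)
    then obtain t x where tx: "v = t *\<^sub>R x" "0 < t" "t \<le> 1" "x \<in> A" by metis
    then have "norm v \<le> norm x" by (simp add: mult_left_le_one_le)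
    then show ?thesis using B[OF tx(4)] by simp
  qed
  then have "bounded (cone_over A)" unfolding bounded_iff by blast
  then have "emeasure lborel (cone_over A) < \<infinity>" by (rule emeasure_bounded_finite)
  then show ?thesis using A by (simp add: emeasure_gvolume ennreal_mult_less_top ennreal_of_nat_eq_real_of_nat)
qed

lemma sigma_finite_gvolume: "sigma_finite_measure (gvolume g :: 'n::finite ambient measure)"
proof
  let ?A = "\<lambda>n::nat. model_space g \<inter> ball (0 :: 'n ambient) (real n)"
  have s: "?A n \<in> sets (gvolume g)" for n by (simp add: sets_gvolume_iff)
  show "\<exists>A. countable A \<and> A \<subseteq> sets (gvolume g) \<and> \<Union> A = space (gvolume g :: 'n ambient measure) \<and>
      (\<forall>a\<in>A. emeasure (gvolume g) a \<noteq> \<infinity>)"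
  proof (intro exI conjI ballI)
    show "countable (range ?A)" by simp
    show "range ?A \<subseteq> sets (gvolume g)" using s by auto
    show "\<Union> (range ?A) = space (gvolume g)" using reals_Archimedean2 by auto
    fix a assume "a \<in> range ?A"
    then obtain n where "a = ?A n" by auto
    moreover have "bounded (?A n)" by (rule bounded_subset[OF bounded_ball]) (rule Int_lower2)
    ultimately show "emeasure (gvolume g) a \<noteq> \<infinity>"
      using emeasure_gvolume_bounded[OF s, of n] by (metis less_irrefl)
  qed
qed

text \<open>
  Two-point symmetrization: in each pair of mirror images of which exactly one lies in \<open>K\<close>, the point
  on the side \<open>0 \<le> x \<bullet> v\<close> is kept.
\<close>
definition polarize :: "geometry \<Rightarrow> 'n::finite ambient \<Rightarrow> 'n ambient set \<Rightarrow> 'n ambient set" where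
  "polarize g v K = {x \<in> model_space g.
     if 0 \<le> x \<bullet> v then x \<in> K \<or> reflect g v x \<in> K else x \<in> K \<and> reflect g v x \<in> K}"

definition halfspace :: "geometry \<Rightarrow> 'n::finite ambient \<Rightarrow> 'n ambient set" where
  "halfspace g w = {x \<in> model_space g. 0 < x \<bullet> w}"

lemma halfspace_sets [measurable]: "halfspace g w \<in> sets (gvolume g)"
proof -
  have "{x. 0 < x \<bullet> w} \<in> sets borel"
    by (intro borel_open open_Collect_less continuous_intros)
  then have "model_space g \<inter> {x. 0 < x \<bullet> w} \<in> sets borel" by simp
  moreover have "halfspace g w = model_space g \<inter> {x. 0 < x \<bullet> w}" by (auto simp: halfspace_def)
  ultimately show ?thesis by (auto simp: sets_gvolume_iff)
qed

locale polarization =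
  fixes g and v :: "'n::finite ambient" and K :: "'n ambient set"
  assumes v: "normal_form g v > 0" and K: "K \<in> sets (gvolume g)"
begin

abbreviation "\<sigma> \<equiv> reflect g v"
abbreviation "K' \<equiv> polarize g v K"
abbreviation "vol \<equiv> emeasure (gvolume g :: 'n ambient measure)"

lemma reflect_vimage_sets: "A \<in> sets (gvolume g) \<Longrightarrow> \<sigma> -` A \<in> sets (gvolume g)"
  by (rule sym_pair_vimage_sets[OF sym_pair_reflect[OF v]])

lemma vol_reflect_vimage: "A \<in> sets (gvolume g) \<Longrightarrow> vol (\<sigma> -` A) = vol A"
  by (rule emeasure_gvolume_sym_pair[OF sym_pair_reflect[OF v]])

lemma subset_model: "A \<in> sets (gvolume g) \<Longrightarrow> A \<subseteq> model_space g"
  by (simp add: sets_gvolume_iff)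

lemma polarize_sets: "K' \<in> sets (gvolume g)"
proof -
  let ?H = "{x \<in> model_space g. 0 \<le> x \<bullet> v}"
  have "?H = model_space g - halfspace g (- v)" by (auto simp: halfspace_def)
  then have "?H \<in> sets (gvolume g)" using sets.top[of "gvolume g"] by auto
  moreover have "K' = (?H \<inter> (K \<union> \<sigma> -` K)) \<union> (K \<inter> \<sigma> -` K)"
  proof (intro set_eqI)
    fix x
    have "x \<in> K \<Longrightarrow> x \<in> model_space g" "\<sigma> x \<in> K \<Longrightarrow> x \<in> model_space g"
      using subset_model[OF K] reflect_model[OF v] by blast+
    then show "x \<in> K' \<longleftrightarrow> x \<in> (?H \<inter> (K \<union> \<sigma> -` K)) \<union> (K \<inter> \<sigma> -` K)"
      by (auto simp: polarize_def)
  qed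
  ultimately show ?thesis using K reflect_vimage_sets[OF K] by auto
qed

text \<open>
  This is what makes all volume computations for polarization work: \<open>K'\<close> arises from \<open>K\<close> by replacing the
  lost points \<open>K - K'\<close> by their mirror images.
\<close>
lemma gained_eq: "K' - K = \<sigma> -` (K - K')"
proof (rule set_eqI)
  fix x
  have "\<sigma> x \<in> model_space g" if "\<sigma> x \<in> K" using subset_model[OF K] that by blast
  moreover have "x \<in> model_space g" if "x \<in> K" using subset_model[OF K] that by blast
  moreover have "\<sigma> x = x" if "x \<bullet> v = 0" using reflect_fix[OF v that] .
  ultimately show "x \<in> K' - K \<longleftrightarrow> x \<in> \<sigma> -` (K - K')"
    by (cases "x \<bullet> v" "0::real" rule: linorder_cases)
       (auto simp: polarize_def reflect_inner_normal[OF v] reflect_reflect[OF v] reflect_model[OF v])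
qed

lemma vol_gained:
  assumes P: "P \<in> sets (gvolume g)"
  shows "vol ((K' - K) \<inter> P) = vol ((K - K') \<inter> \<sigma> -` P)"
proof -
  have "(K' - K) \<inter> P = \<sigma> -` ((K - K') \<inter> \<sigma> -` P)"
    unfolding gained_eq by (rule set_eqI) (simp add: reflect_reflect[OF v])
  then show ?thesis
    using vol_reflect_vimage[of "(K - K') \<inter> \<sigma> -` P"] K polarize_sets reflect_vimage_sets[OF P] by simp
qed

lemma vol_split:
  assumes P: "P \<in> sets (gvolume g)"
  shows "vol (K' \<inter> P) = vol (K \<inter> K' \<inter> P) + vol ((K' - K) \<inter> P)"
    and "vol (K \<inter> P) = vol (K \<inter> K' \<inter> P) + vol ((K - K') \<inter> P)"
proof -
  have *: "K \<inter> K' \<inter> P \<in> sets (gvolume g)" "(K' - K) \<inter> P \<in> sets (gvolume g)"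
    "(K - K') \<inter> P \<in> sets (gvolume g)" using K polarize_sets P by auto
  have "K' \<inter> P = (K \<inter> K' \<inter> P) \<union> ((K' - K) \<inter> P)" "K \<inter> P = (K \<inter> K' \<inter> P) \<union> ((K - K') \<inter> P)"
    by blast+
  moreover have "vol ((K \<inter> K' \<inter> P) \<union> ((K' - K) \<inter> P)) = vol (K \<inter> K' \<inter> P) + vol ((K' - K) \<inter> P)"
    "vol ((K \<inter> K' \<inter> P) \<union> ((K - K') \<inter> P)) = vol (K \<inter> K' \<inter> P) + vol ((K - K') \<inter> P)"
    by (rule plus_emeasure[symmetric, OF *(1,2)], blast) (rule plus_emeasure[symmetric, OF *(1,3)], blast)
  ultimately show "vol (K' \<inter> P) = vol (K \<inter> K' \<inter> P) + vol ((K' - K) \<inter> P)"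
    "vol (K \<inter> P) = vol (K \<inter> K' \<inter> P) + vol ((K - K') \<inter> P)" by (simp_all only:)
qed

text \<open>
  A point and its mirror image contribute equally to the sum of the volumes inside \<open>P\<close> and inside the
  mirror image of \<open>P\<close>.
\<close>
lemma vol_polarize_Int_sum:
  assumes P: "P \<in> sets (gvolume g)"
  shows "vol (K' \<inter> P) + vol (K' \<inter> \<sigma> -` P) = vol (K \<inter> P) + vol (K \<inter> \<sigma> -` P)"
proof -
  have R: "\<sigma> -` P \<in> sets (gvolume g)" by (rule reflect_vimage_sets[OF P])
  have "\<sigma> -` \<sigma> -` P = P" by (rule set_eqI) (simp add: reflect_reflect[OF v])
  then show ?thesis
    unfolding vol_split[OF P] vol_split[OF R] vol_gained[OF P] vol_gained[OF R] by (simp add: ac_simps)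
qed

lemma vol_polarize: "vol K' = vol K"
proof -
  let ?M = "model_space g :: 'n ambient set"
  have M: "?M \<in> sets (gvolume g)" by (simp add: sets_gvolume_iff)
  have "\<sigma> -` ?M = ?M" by (rule set_eqI) (simp add: reflect_model[OF v])
  moreover have "K' \<inter> ?M = K'" "K \<inter> ?M = K" "(K - K') \<inter> ?M = K - K'"
    using subset_model[OF K] by (auto simp: polarize_def)
  ultimately show ?thesis
    using vol_split[OF M] vol_gained[OF M] by simp
qed

lemma vol_Int_le_polarize:
  assumes P: "P \<in> sets (gvolume g)" and inc: "\<And>x. x \<in> P \<Longrightarrow> x \<bullet> v < 0 \<Longrightarrow> \<sigma> x \<in> P"
  shows "vol (K \<inter> P) \<le> vol (K' \<inter> P)"
proof -
  have "(K - K') \<inter> P \<subseteq> (K - K') \<inter> \<sigma> -` P"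
  proof
    fix x assume x: "x \<in> (K - K') \<inter> P"
    moreover have "x \<in> model_space g" using x subset_model[OF K] by blast
    ultimately have "x \<bullet> v < 0" by (auto simp: polarize_def split: if_splits)
    then show "x \<in> (K - K') \<inter> \<sigma> -` P" using x inc by simp
  qed
  then have "vol ((K - K') \<inter> P) \<le> vol ((K - K') \<inter> \<sigma> -` P)"
    using K polarize_sets reflect_vimage_sets[OF P] by (intro emeasure_mono) auto
  then show ?thesis unfolding vol_split[OF P] vol_gained[OF P] by (intro add_left_mono)
qed

lemma polarize_reflect_vimage: "polarize g v (\<sigma> -` K) = K'"
  by (rule set_eqI) (auto simp: polarize_def reflect_reflect[OF v])

text \<open>
  Let \<open>B\<close> contain the mirror images of its points on the negative side; balls around a point of the
  positive side have this property.  Then every point lost from \<open>B\<close> is replaced by a point of \<open>B\<close>, and the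
  points of \<open>B - K\<close> with mirror image in \<open>K - B\<close> are a net gain.
\<close>
lemma vol_gain:
  assumes B: "B \<in> sets (gvolume g)" and inc: "\<And>x. x \<in> B \<Longrightarrow> x \<bullet> v < 0 \<Longrightarrow> \<sigma> x \<in> B"
  shows "vol (K \<inter> B) + vol ((B - K) \<inter> \<sigma> -` (K - B)) \<le> vol (K' \<inter> B)"
proof -
  let ?E = "(B - K) \<inter> \<sigma> -` (K - B)"
  let ?L = "\<sigma> -` ((K - K') \<inter> B)"
  have E: "?E \<in> sets (gvolume g)" using B K reflect_vimage_sets[of "K - B"] by auto
  have L: "?L \<in> sets (gvolume g)" using B K polarize_sets by (intro reflect_vimage_sets) auto
  have "x \<bullet> v \<ge> 0" if "x \<in> B" "\<sigma> x \<notin> B" for x using inc[of x] that by force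
  moreover have "x \<in> model_space g" if "x \<in> B" for x using that subset_model[OF B] by blast
  ultimately have "?E \<subseteq> (K' - K) \<inter> B" by (intro subsetI) (simp add: polarize_def)
  moreover have "?L \<subseteq> (K' - K) \<inter> B"
  proof -
    have "?L \<subseteq> K' - K" unfolding gained_eq by auto
    moreover have "?L \<subseteq> B"
    proof
      fix x assume x: "x \<in> ?L"
      moreover have "\<sigma> x \<in> model_space g" using x subset_model[OF B] by blast
      ultimately have "\<sigma> x \<bullet> v < 0" by (auto simp: polarize_def split: if_splits)
      then have "\<sigma> (\<sigma> x) \<in> B" using x inc[of "\<sigma> x"] by simp
      then show "x \<in> B" by (simp add: reflect_reflect[OF v])
    qed
    ultimately show ?thesis by blast
  qed
  ultimately have "vol (?E \<union> ?L) \<le> vol ((K' - K) \<inter> B)"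
    using K polarize_sets B by (intro emeasure_mono) auto
  moreover have "vol (?E \<union> ?L) = vol ?E + vol ?L"
    using E L by (intro plus_emeasure[symmetric]) auto
  moreover have "vol ?L = vol ((K - K') \<inter> B)"
    using K polarize_sets B by (intro vol_reflect_vimage) auto
  ultimately have "vol ?E + vol ((K - K') \<inter> B) \<le> vol ((K' - K) \<inter> B)" by (simp only:)
  then have "vol (K \<inter> K' \<inter> B) + (vol ((K - K') \<inter> B) + vol ?E) \<le> vol (K' \<inter> B)"
    unfolding vol_split(1)[OF B] by (intro add_left_mono) (subst add.commute)
  then show ?thesis unfolding vol_split(2)[OF B] by (subst add.assoc)
qed

end

section \<open>Polarization and separating hyperplanes\<close>

text \<open>
  If a half-space has probability \<open>t\<close>, this is the probability that \<open>N > 0\<close> independent points lie neither all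
  inside nor all outside of it.
\<close>
definition split_prob :: "nat \<Rightarrow> real \<Rightarrow> real" where
  "split_prob N t = 1 - t ^ N - (1 - t) ^ N"

definition side_prob :: "geometry \<Rightarrow> 'n::finite ambient set \<Rightarrow> 'n ambient \<Rightarrow> real" where
  "side_prob g K w = measure (gvolume g) (K \<inter> halfspace g w) / measure (gvolume g) K"

text \<open>
  For the sets to which it is applied, this is the expected value of \<open>U\<^sub>1\<close> of the convex hull of \<open>N > 0\<close> random
  points of \<open>K\<close>, up to the normalization of the hyperplane measure: a hyperplane meets the convex hull unless all
  points lie strictly on one side.
\<close>
definition cut_functional :: "geometry \<Rightarrow> nat \<Rightarrow> 'n::finite ambient set \<Rightarrow> ennreal" where
  "cut_functional g N K = (\<integral>\<^sup>+ w \<in> normals g. ennreal (split_prob N (side_prob g K w)) \<partial>lborel)"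

text \<open>
  Convexity of the power function: the sum increases if two numbers are spread apart with their sum fixed.
  Both increments \<open>c ^ N - a ^ N\<close> and \<open>b ^ N - d ^ N\<close> are \<open>c - a = b - d\<close> times a sum of products of powers,
  and the products are larger for the first.
\<close>
lemma power_sum_mono_spread:
  fixes a b c d :: real
  assumes "a + b = c + d" "a \<le> c" "b \<le> c" "0 \<le> d"
  shows "a ^ N + b ^ N \<le> c ^ N + d ^ N"
proof -
  have "d \<le> a" "d \<le> b" using assms by linarith+
  have "b ^ N - d ^ N = (b - d) * (\<Sum>i<N. d ^ (N - Suc i) * b ^ i)" by (rule power_diff_sumr2)
  also have "\<dots> \<le> (b - d) * (\<Sum>i<N. a ^ (N - Suc i) * c ^ i)"
    using assms \<open>d \<le> a\<close> \<open>d \<le> b\<close>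
    by (intro mult_left_mono sum_mono mult_mono power_mono) auto
  also have "\<dots> = (c - a) * (\<Sum>i<N. a ^ (N - Suc i) * c ^ i)" using assms(1) by (intro arg_cong2[where f = "(*)"]) auto
  also have "\<dots> = c ^ N - a ^ N" by (rule power_diff_sumr2[symmetric])
  finally show ?thesis by simp
qed

lemma split_prob_sum_mono_spread:
  assumes "a + b = c + d" "a \<le> c" "b \<le> c" "0 \<le> d" "c \<le> 1"
  shows "split_prob N c + split_prob N d \<le> split_prob N a + split_prob N b"
proof -
  have "a ^ N + b ^ N \<le> c ^ N + d ^ N" by (rule power_sum_mono_spread) (use assms in auto)
  moreover have "(1 - a) ^ N + (1 - b) ^ N \<le> (1 - d) ^ N + (1 - c) ^ N"
    by (rule power_sum_mono_spread) (use assms in auto)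
  ultimately show ?thesis by (simp add: split_prob_def)
qed

lemma split_prob_nonneg:
  assumes "0 \<le> t" "t \<le> 1" "N > 0" shows "0 \<le> split_prob N t"
proof -
  obtain m where m: "N = Suc m" using assms(3) by (cases N) auto
  have "t ^ N \<le> t" "(1 - t) ^ N \<le> 1 - t"
    using assms power_le_one[of t m] power_le_one[of "1 - t" m] by (auto simp: m mult_left_le)
  then show ?thesis by (simp add: split_prob_def)
qed

lemma side_prob_bounds:
  fixes K :: "'n::finite ambient set"
  assumes "K \<in> sets (gvolume g)" "emeasure (gvolume g) K < \<infinity>"
  shows "0 \<le> side_prob g K w" "side_prob g K w \<le> 1"
proof -
  have "measure (gvolume g) (K \<inter> halfspace g w) \<le> measure (gvolume g) K"
    using assms by (intro measure_mono_fmeasurable) (auto simp: fmeasurable_def)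
  then show "side_prob g K w \<le> 1" 
    using measure_nonneg[of "gvolume g" K] by (auto simp: side_prob_def divide_le_eq_1 less_le)
  show "0 \<le> side_prob g K w" by (simp add: side_prob_def)
qed

lemma measurable_side_prob [measurable]:
  fixes K :: "'n::finite ambient set"
  assumes K: "K \<in> sets (gvolume g)"
  shows "side_prob g K \<in> borel_measurable borel"
proof -
  interpret sigma_finite_measure "gvolume g :: 'n ambient measure" by (rule sigma_finite_gvolume)
  let ?Q = "{z \<in> space (borel \<Otimes>\<^sub>M gvolume g). snd z \<in> K \<and> 0 < snd z \<bullet> (fst z :: 'n ambient)}"
  have [measurable]: "(\<lambda>x. x) \<in> gvolume g \<rightarrow>\<^sub>M (borel :: 'n ambient measure)"
    by (rule measurable_gvolume_borel) simp
  have [measurable]: "snd \<in> borel \<Otimes>\<^sub>M gvolume g \<rightarrow>\<^sub>M (borel :: 'n ambient measure)"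
    by (rule measurable_compose[OF measurable_snd]) measurable
  have [measurable]: "fst \<in> borel \<Otimes>\<^sub>M (gvolume g :: 'n ambient measure) \<rightarrow>\<^sub>M (borel :: 'n ambient measure)"
    by simp
  have [measurable]: "Measurable.pred (borel \<Otimes>\<^sub>M gvolume g) (\<lambda>z :: 'n ambient \<times> 'n ambient. snd z \<in> K)"
    using K by measurable
  have "?Q \<in> sets (borel \<Otimes>\<^sub>M gvolume g)" by measurable
  then have "(\<lambda>w. emeasure (gvolume g) (Pair w -` ?Q)) \<in> borel_measurable borel"
    by (rule measurable_emeasure_Pair)
  moreover have "Pair w -` ?Q = K \<inter> halfspace g w" for w
    using K by (auto simp: space_pair_measure halfspace_def sets_gvolume_iff)
  ultimately have "(\<lambda>w. emeasure (gvolume g) (K \<inter> halfspace g w)) \<in> borel_measurable borel" by simp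
  then show ?thesis unfolding side_prob_def[abs_def] measure_def by measurable
qed

lemma measurable_split_prob [measurable]: "split_prob N \<in> borel_measurable borel"
  unfolding split_prob_def[abs_def] by measurable

text \<open>
  The action of an isometry on normal vectors preserves their normal form and Lebesgue measure.
\<close>
lemma nn_integral_normals_sym_pair:
  fixes T S :: "'n::finite ambient \<Rightarrow> 'n ambient"
  assumes TS: "sym_pair g T S" and [measurable]: "G \<in> borel_measurable borel"
  shows "(\<integral>\<^sup>+ w \<in> normals g. G (S w) \<partial>lborel) = (\<integral>\<^sup>+ w \<in> normals g. G w \<partial>lborel)"
proof -
  have [measurable]: "S \<in> borel_measurable borel"
    using sym_pairD(2)[OF TS] linear_continuous_on linear_conv_bounded_linear
    by (intro borel_measurable_continuous_onI) blast
  have d: "distr lborel borel S = lborel"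
  proof (rule measure_eqI)
    fix A assume "A \<in> sets (distr lborel borel S)"
    then show "emeasure (distr lborel borel S) A = emeasure lborel A"
      using sym_pairD(8)[OF TS] by (simp add: emeasure_distr lborel_preserving_def)
  qed simp
  have "(\<integral>\<^sup>+ w \<in> normals g. G w \<partial>lborel) = (\<integral>\<^sup>+ w \<in> normals g. G w \<partial>distr lborel borel S)"
    by (simp only: d)
  also have "\<dots> = (\<integral>\<^sup>+ w. G (S w) * indicator (normals g) (S w) \<partial>lborel)"
    by (rule nn_integral_distr) measurable
  also have "\<dots> = (\<integral>\<^sup>+ w \<in> normals g. G (S w) \<partial>lborel)"
    by (intro nn_integral_cong) (simp add: indicator_def normals_def sym_pairD(5)[OF TS])
  finally show ?thesis ..
qed

lemma sym_pair_vimage_halfspace: "sym_pair g T S \<Longrightarrow> T -` halfspace g (S w) = halfspace g w"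
  by (rule set_eqI) (simp add: halfspace_def sym_pair_model sym_pairD(3))

lemma side_prob_sym_pair:
  assumes TS: "sym_pair g T S" and K: "K \<in> sets (gvolume g)"
  shows "side_prob g (T -` K) w = side_prob g K (S w)"
proof -
  have "T -` K \<inter> halfspace g w = T -` (K \<inter> halfspace g (S w))"
    by (simp add: sym_pair_vimage_halfspace[OF TS])
  then have "emeasure (gvolume g) (T -` K \<inter> halfspace g w) = emeasure (gvolume g) (K \<inter> halfspace g (S w))"
    using K by (simp only:) (intro emeasure_gvolume_sym_pair[OF TS] sets.Int halfspace_sets)
  then show ?thesis
    using emeasure_gvolume_sym_pair[OF TS K] by (simp add: side_prob_def measure_def)
qed

theorem cut_functional_sym_pair:
  assumes TS: "sym_pair g T S" and K: "K \<in> sets (gvolume g)"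
  shows "cut_functional g N (T -` K) = cut_functional g N K"
  unfolding cut_functional_def side_prob_sym_pair[OF TS K]
  by (rule nn_integral_normals_sym_pair[OF TS]) (use K in measurable)

context polarization
begin

lemma reflect_vimage_halfspace: "\<sigma> -` halfspace g w = halfspace g (coreflect g v w)"
  by (rule set_eqI) (simp add: halfspace_def reflect_model[OF v] inner_coreflect[OF v])

text \<open>
  The reflection exchanges the half-spaces with normal vectors \<open>w\<close> and \<open>w'\<close>.  If the conormal of \<open>v\<close> points
  into the half-space of \<open>w\<close>, then reflecting from the negative to the positive side of \<open>v\<close> never leaves that
  half-space.  Hence polarization moves mass from the half-space of \<open>w'\<close> to that of \<open>w\<close>, and the new volumes
  are further apart than the old ones, whichever of these was the larger.  The bound for \<open>w'\<close> holds because \<open>K\<close>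
  and its mirror image have the same polarization.
\<close>
lemma side_prob_spread:
  assumes fin: "vol K < \<infinity>" and w: "conormal g v \<bullet> w \<ge> 0"
  defines "w' \<equiv> coreflect g v w"
  shows "side_prob g K w + side_prob g K w' = side_prob g K' w + side_prob g K' w'"
    and "side_prob g K w \<le> side_prob g K' w" and "side_prob g K w' \<le> side_prob g K' w"
proof -
  have fin': "vol K' < \<infinity>" using fin vol_polarize by simp
  have f: "emeasure (gvolume g) (A \<inter> B) = ennreal (measure (gvolume g) (A \<inter> B))"
    if "A \<in> sets (gvolume g)" "vol A < \<infinity>" for A B :: "'n ambient set"
    using that by (intro emeasure_eq_ennreal_measure) (metis Int_lower1 emeasure_mono infinity_ennreal_def leD top_greatest top.not_eq_extremum)
  have m: "measure (gvolume g) K' = measure (gvolume g) K" using vol_polarize by (simp add: measure_def)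
  note f1 = f[OF K fin] and f2 = f[OF polarize_sets fin']
  have "vol (K' \<inter> halfspace g w) + vol (K' \<inter> halfspace g w') = vol (K \<inter> halfspace g w) + vol (K \<inter> halfspace g w')"
    using vol_polarize_Int_sum[OF halfspace_sets] by (simp add: reflect_vimage_halfspace w'_def)
  then show "side_prob g K w + side_prob g K w' = side_prob g K' w + side_prob g K' w'"
    unfolding f1 f2 by (simp add: side_prob_def m add_divide_distrib[symmetric] ennreal_plus[symmetric] del: ennreal_plus)
  have inc: "\<sigma> x \<in> halfspace g w" if "x \<in> halfspace g w" "x \<bullet> v < 0" for x
  proof -
    have "2 * (x \<bullet> v) \<le> 0" using that(2) by simp
    then have "2 * (x \<bullet> v) * (conormal g v \<bullet> w) / normal_form g v \<le> 0"
      by (intro divide_nonpos_pos[OF mult_nonpos_nonneg[OF _ w] v])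
    then have "x \<bullet> w \<le> \<sigma> x \<bullet> w" using inner_diff_reflect[OF v, of x w] by simp
    then show ?thesis using that by (simp add: halfspace_def reflect_model[OF v])
  qed
  have "vol (K \<inter> halfspace g w) \<le> vol (K' \<inter> halfspace g w)"
    by (rule vol_Int_le_polarize[OF halfspace_sets inc])
  then show "side_prob g K w \<le> side_prob g K' w"
    unfolding f1 f2 by (simp add: side_prob_def m divide_right_mono)
  \<comment> \<open>the mirror image of K has the same polarization\<close>
  interpret R: polarization g v "\<sigma> -` K"
    by unfold_locales (use v K reflect_vimage_sets in auto)
  have "vol (\<sigma> -` K \<inter> halfspace g w) \<le> vol (K' \<inter> halfspace g w)"
    using R.vol_Int_le_polarize[OF halfspace_sets inc] by (simp add: polarize_reflect_vimage)
  moreover have "\<sigma> -` (K \<inter> halfspace g w') = \<sigma> -` K \<inter> halfspace g w"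
  proof -
    have "\<sigma> -` halfspace g w' = halfspace g w" unfolding w'_def
      by (rule sym_pair_vimage_halfspace[OF sym_pair_reflect[OF v]])
    then show ?thesis by simp
  qed
  then have "vol (\<sigma> -` K \<inter> halfspace g w) = vol (K \<inter> halfspace g w')"
    using vol_reflect_vimage[of "K \<inter> halfspace g w'"] K by simp
  ultimately show "side_prob g K w' \<le> side_prob g K' w"
    unfolding f1 f2 by (simp add: side_prob_def m divide_right_mono)
qed

lemma split_prob_polarize:
  fixes N :: nat
  assumes fin: "vol K < \<infinity>"
  defines "f \<equiv> \<lambda>L w. split_prob N (side_prob g L w)"
  shows "f K' w + f K' (coreflect g v w) \<le> f K w + f K (coreflect g v w)"
proof -
  have fin': "vol K' < \<infinity>" using fin vol_polarize by simp
  note b = side_prob_bounds[OF polarize_sets fin']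
  show ?thesis
  proof (cases "conormal g v \<bullet> w \<ge> 0")
    case True
    then show ?thesis unfolding f_def
      using side_prob_spread[OF fin True] b by (intro split_prob_sum_mono_spread) auto
  next
    case False
    \<comment> \<open>the mirror image of w satisfies the sign condition\<close>
    have "coreflect g v w \<bullet> conormal g v = - (w \<bullet> conormal g v)"
      using v by (simp add: coreflect_def inner_diff_left normal_form_eq_inner)
    then have neg: "conormal g v \<bullet> coreflect g v w \<ge> 0" using False by (simp add: inner_commute)
    have "coreflect g v (coreflect g v w) = w"
    proof -
      have "x \<bullet> coreflect g v (coreflect g v w) = x \<bullet> w" for x
        by (simp add: inner_coreflect[OF v] reflect_reflect[OF v])
      then show ?thesis by (metis vector_eq_ldot)
    qed
    then have "f K' (coreflect g v w) + f K' w \<le> f K (coreflect g v w) + f K w" unfolding f_def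
      using side_prob_spread[OF fin neg] b by (intro split_prob_sum_mono_spread) auto
    then show ?thesis by simp
  qed
qed

text \<open>
  Pair each hyperplane with its mirror image: the integrand decreases for each pair by concavity of
  \<open>split_prob N\<close>.
\<close>
theorem cut_functional_polarize_le:
  assumes fin: "vol K < \<infinity>" and "N > 0"
  shows "cut_functional g N K' \<le> cut_functional g N K"
proof -
  have fin': "vol K' < \<infinity>" using fin vol_polarize by simp
  let ?f = "\<lambda>L w. ennreal (split_prob N (side_prob g L w))"
  let ?S = "coreflect g v"
  note [measurable] = measurable_side_prob[OF K] measurable_side_prob[OF polarize_sets]
  have [measurable]: "?S \<in> borel_measurable borel"
    using linear_coreflect[OF v] linear_continuous_on linear_conv_bounded_linear
    by (intro borel_measurable_continuous_onI) blast
  have double: "2 * cut_functional g N L = (\<integral>\<^sup>+ w \<in> normals g. (?f L w + ?f L (?S w)) \<partial>lborel)"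
    if [measurable]: "L \<in> sets (gvolume g)" for L
  proof -
    have "(\<integral>\<^sup>+ w \<in> normals g. (?f L w + ?f L (?S w)) \<partial>lborel) =
        (\<integral>\<^sup>+ w \<in> normals g. ?f L w \<partial>lborel) + (\<integral>\<^sup>+ w \<in> normals g. ?f L (?S w) \<partial>lborel)"
      by (subst nn_integral_add[symmetric]) (auto simp: distrib_right)
    also have "(\<integral>\<^sup>+ w \<in> normals g. ?f L (?S w) \<partial>lborel) = (\<integral>\<^sup>+ w \<in> normals g. ?f L w \<partial>lborel)"
      by (rule nn_integral_normals_sym_pair[OF sym_pair_reflect[OF v]]) measurable
    finally show ?thesis by (simp add: cut_functional_def mult_2)
  qed
  have "2 * cut_functional g N K' \<le> 2 * cut_functional g N K"
    unfolding double[OF K] double[OF polarize_sets]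
  proof (intro nn_integral_mono mult_right_mono)
    fix w
    show "?f K' w + ?f K' (?S w) \<le> ?f K w + ?f K (?S w)"
      using split_prob_polarize[OF fin, of N w] side_prob_bounds[OF K fin] side_prob_bounds[OF polarize_sets fin'] \<open>N > 0\<close>
      by (simp add: ennreal_plus[symmetric] split_prob_nonneg ennreal_leI del: ennreal_plus)
  qed simp
  then show ?thesis by (simp add: ennreal_mult_le_mult_iff)
qed

end

section \<open>Reflections that exchange mass\<close>

text \<open>
  For fixed \<open>y\<close> this quadratic map sends \<open>v\<close> to the mirror image of \<open>y\<close>, scaled by \<open>normal_form g v\<close>.  The scaling
  removes the denominator of the reflection and makes the map Lipschitz on bounded sets.
\<close>
definition cone_map :: "geometry \<Rightarrow> 'n::finite ambient \<Rightarrow> 'n ambient \<Rightarrow> 'n ambient" where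
  "cone_map g y v = normal_form g v *\<^sub>R y - (2 * (y \<bullet> v)) *\<^sub>R conormal g v"

lemma cone_map_eq_reflect:
  "normal_form g v > 0 \<Longrightarrow> cone_map g y v = normal_form g v *\<^sub>R reflect g v y"
  by (simp add: cone_map_def reflect_def algebra_simps)

lemma cone_map_Lipschitz:
  fixes y :: "'n::finite ambient"
  assumes u: "norm u \<le> r" and v: "norm v \<le> r"
  shows "norm (cone_map g y u - cone_map g y v) \<le> 6 * norm y * r * norm (u - v)"
proof -
  let ?Q = "conormal g :: 'n ambient \<Rightarrow> 'n ambient"
  have r: "r \<ge> 0" using u norm_ge_zero order_trans by blast
  have Q: "?Q (u - v) = ?Q u - ?Q v" by (rule linear_diff[OF linear_conormal])
  have Qn: "norm (?Q u) \<le> r" "norm (?Q (u - v)) \<le> norm (u - v)"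
    using norm_conormal_le order_trans u by blast+
  have "normal_form g u - normal_form g v = (u - v) \<bullet> ?Q u + v \<bullet> ?Q (u - v)"
    by (simp add: normal_form_eq_inner Q inner_diff_left inner_diff_right)
  also have "\<bar>\<dots>\<bar> \<le> norm (u - v) * norm (?Q u) + norm v * norm (?Q (u - v))"
    by (intro order_trans[OF abs_triangle_ineq] add_mono Cauchy_Schwarz_ineq2)
  also have "\<dots> \<le> norm (u - v) * r + r * norm (u - v)"
    using Qn v r by (intro add_mono mult_mono) auto
  finally have nf: "\<bar>normal_form g u - normal_form g v\<bar> \<le> 2 * r * norm (u - v)" by simp
  \<comment> \<open>both terms of the map are products, so the difference is expanded by the product rule\<close>
  have "cone_map g y u - cone_map g y v = (normal_form g u - normal_form g v) *\<^sub>R y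
      - 2 *\<^sub>R ((y \<bullet> (u - v)) *\<^sub>R ?Q u + (y \<bullet> v) *\<^sub>R ?Q (u - v))"
    by (simp add: cone_map_def Q inner_diff_right algebra_simps)
  also have "norm \<dots> \<le> norm ((normal_form g u - normal_form g v) *\<^sub>R y)
      + norm (2 *\<^sub>R ((y \<bullet> (u - v)) *\<^sub>R ?Q u + (y \<bullet> v) *\<^sub>R ?Q (u - v)))"
    by (rule norm_triangle_ineq4)
  also have "norm (2 *\<^sub>R ((y \<bullet> (u - v)) *\<^sub>R ?Q u + (y \<bullet> v) *\<^sub>R ?Q (u - v)))
      \<le> 2 * (\<bar>y \<bullet> (u - v)\<bar> * norm (?Q u) + \<bar>y \<bullet> v\<bar> * norm (?Q (u - v)))"
    using norm_triangle_ineq[of "(y \<bullet> (u - v)) *\<^sub>R ?Q u" "(y \<bullet> v) *\<^sub>R ?Q (u - v)"] by simp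
  also have "\<dots> \<le> 2 * ((norm y * norm (u - v)) * r + (norm y * r) * norm (u - v))"
  proof -
    have "\<bar>y \<bullet> v\<bar> \<le> norm y * r"
      using Cauchy_Schwarz_ineq2[of y v] mult_left_mono[OF v norm_ge_zero[of y]] by linarith
    then show ?thesis
      using Qn r Cauchy_Schwarz_ineq2[of y "u - v"] by (intro mult_left_mono add_mono mult_mono) auto
  qed
  also have "norm ((normal_form g u - normal_form g v) *\<^sub>R y) \<le> (2 * r * norm (u - v)) * norm y"
    using nf by (simp add: mult_right_mono)
  finally show ?thesis by (simp add: algebra_simps)
qed

lemma chart_ball_norm_le:
  fixes y :: "'n::finite ambient"
  assumes y: "y \<in> chart_ball g q" and k: "0 < k" "k \<le> 1" "k \<le> 1 + curvature g * q\<^sup>2"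
  shows "(norm y)\<^sup>2 \<le> (1 + q\<^sup>2) / k"
proof -
  have f: "(fst y)\<^sup>2 + curvature g * (norm (snd y))\<^sup>2 = 1"
    using model_form_self[of y g] y
    by (simp add: chart_ball_def model_form_def power2_norm_eq_inner power2_eq_square[of "fst y"])
  have "norm (snd y) \<le> q * fst y" using y by (simp add: chart_ball_def)
  then have "(norm (snd y))\<^sup>2 \<le> (q * fst y)\<^sup>2" by (intro power_mono) auto
  then have s: "(norm (snd y))\<^sup>2 \<le> q\<^sup>2 * (fst y)\<^sup>2" by (simp add: power_mult_distrib)
  have "k * (fst y)\<^sup>2 \<le> 1"
  proof (cases "g = Hyperbolic")
    case True
    have "k * (fst y)\<^sup>2 \<le> (1 - q\<^sup>2) * (fst y)\<^sup>2" using k True by (intro mult_right_mono) auto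
    then show ?thesis using s f True by (simp add: algebra_simps)
  next
    case False
    then have "curvature g * (norm (snd y))\<^sup>2 \<ge> 0" by (cases g) auto
    then have "(fst y)\<^sup>2 \<le> 1" using f by linarith
    then show ?thesis using k mult_le_one[of k "(fst y)\<^sup>2"] by simp
  qed
  then have f1: "(fst y)\<^sup>2 \<le> 1 / k" using k by (simp add: field_simps)
  have "(norm y)\<^sup>2 = (fst y)\<^sup>2 + (norm (snd y))\<^sup>2" by (simp add: norm_prod_def)
  also have "\<dots> \<le> (1 + q\<^sup>2) * (fst y)\<^sup>2" using s by (simp add: algebra_simps)
  also have "\<dots> \<le> (1 + q\<^sup>2) * (1 / k)" using f1 by (intro mult_left_mono) auto
  finally show ?thesis by simp
qed

lemma borel_measurable_normal_form [measurable]: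
  "normal_form g \<in> borel_measurable (borel :: 'n::finite ambient measure)"
proof -
  have "continuous_on UNIV (\<lambda>v :: 'n ambient. v \<bullet> conormal g v)"
    unfolding conormal_def by (intro continuous_intros)
  then show ?thesis
    unfolding normal_form_eq_inner[abs_def] by (rule borel_measurable_continuous_onI)
qed

lemma borel_measurable_conormal [measurable]:
  "conormal g \<in> borel_measurable (borel :: 'n::finite ambient measure)"
  unfolding conormal_def[abs_def] by (intro borel_measurable_continuous_onI continuous_intros)

lemma borel_measurable_reflect:
  assumes [measurable]: "f \<in> M \<rightarrow>\<^sub>M (borel :: 'n::finite ambient measure)" "h \<in> M \<rightarrow>\<^sub>M borel"
  shows "(\<lambda>x. reflect g (f x) (h x)) \<in> M \<rightarrow>\<^sub>M borel"
  unfolding reflect_def by measurable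

definition bounded_normals :: "geometry \<Rightarrow> real \<Rightarrow> 'n::finite ambient set" where
  "bounded_normals g r = {v \<in> normals g. norm v \<le> r}"

lemma bounded_normals_borel [measurable]: "(bounded_normals g r :: 'n::finite ambient set) \<in> sets borel"
proof -
  have "(bounded_normals g r :: 'n ambient set) = normals g \<inter> cball 0 r" by (auto simp: bounded_normals_def)
  then show ?thesis by simp
qed

text \<open>
  If \<open>A\<close> has positive volume, then a positive measure of hyperplanes reflects \<open>y\<close> into \<open>A\<close>, uniformly in \<open>y\<close>: the
  Lipschitz map \<open>cone_map g y\<close> maps the normal vectors of these hyperplanes onto the cone over \<open>A\<close>, since each
  point of \<open>A\<close> is reached by the reflection in a bisector.
\<close>
lemma emeasure_cone_le_reflecting_normals:
  fixes y :: "'n::finite ambient"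
  assumes k: "0 < k" "k \<le> 1" "k \<le> 1 + curvature g * q\<^sup>2"
    and A: "A \<in> sets borel" "A \<subseteq> chart_ball g q" and y: "y \<in> chart_ball g q" "y \<notin> A"
  defines "r \<equiv> sqrt ((1 + q\<^sup>2) / k)"
  shows "emeasure lborel (cone_over A) \<le>
    ennreal ((12 * (1 + q\<^sup>2) / k * DIM('n ambient)) ^ DIM('n ambient)) *
    emeasure lborel {v \<in> bounded_normals g r. reflect g v y \<in> A}"
proof -
  let ?S = "{v \<in> bounded_normals g r. reflect g v y \<in> A}"
  let ?L = "6 * r * r"
  have r: "r \<ge> 0" "r * r = (1 + q\<^sup>2) / k" using k by (simp_all add: r_def)
  have yr: "norm y \<le> r" unfolding r_def using chart_ball_norm_le[OF y(1) k] by (rule real_le_rsqrt)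
  have lip: "norm (cone_map g y u - cone_map g y v) \<le> ?L * norm (u - v)" if "u \<in> ?S" "v \<in> ?S" for u v
  proof -
    have "norm (cone_map g y u - cone_map g y v) \<le> 6 * norm y * r * norm (u - v)"
      using that by (intro cone_map_Lipschitz) (simp_all add: bounded_normals_def)
    also have "\<dots> \<le> ?L * norm (u - v)" using yr r by (intro mult_right_mono) auto
    finally show ?thesis .
  qed
  have "?S = bounded_normals g r \<inter> ((\<lambda>v. reflect g v y) -` A \<inter> space borel)" by auto
  also have "\<dots> \<in> sets borel"
    using A(1) by (intro sets.Int measurable_sets[OF borel_measurable_reflect]) simp_all
  finally have S: "?S \<in> sets borel" .
  have Sb: "bounded ?S" by (rule bounded_subset[OF bounded_cball[of 0 r]]) (auto simp: bounded_normals_def)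
  have AM: "A \<subseteq> model_space g" using A(2) by (auto simp: chart_ball_def)
  have cov: "cone_over A \<subseteq> cone_map g y ` ?S"
  proof
    fix w assume "w \<in> cone_over A"
    then have "\<exists>t x. w = t *\<^sub>R x \<and> 0 < t \<and> t \<le> 1 \<and> x \<in> A" by (simp add: cone_over_def)
    then obtain t x where tx: "w = t *\<^sub>R x" "0 < t" "t \<le> 1" "x \<in> A" by metis
    have "x \<in> chart_ball g q" "x \<noteq> y" using tx(4) A(2) y(2) by blast+
    then obtain v where v: "normal_form g v = 1" "reflect g v y = x" "(norm v)\<^sup>2 \<le> (1 + q\<^sup>2) / k"
      using exists_bisector[OF _ y(1) _ k] by blast
    define u where "u = sqrt t *\<^sub>R v"
    have nu: "normal_form g u = t" using v(1) tx(2) by (simp add: u_def normal_form_scaleR)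
    have ru: "reflect g u y = x"
      unfolding u_def v(2)[symmetric] using v(1) tx(2) by (intro reflect_scale) auto
    have "norm v \<le> r" unfolding r_def using v(3) by (rule real_le_rsqrt)
    moreover have "norm u \<le> norm v" using tx(2,3) by (simp add: u_def mult_left_le_one_le)
    ultimately have "u \<in> ?S" using nu ru tx by (simp add: bounded_normals_def normals_def)
    moreover have "cone_map g y u = w"
      using cone_map_eq_reflect[of g u y] nu ru tx by simp
    ultimately show "w \<in> cone_map g y ` ?S" by blast
  qed
  have "emeasure lborel (cone_over A) \<le>
      ennreal ((2 * ?L * DIM('n ambient)) ^ DIM('n ambient)) * emeasure lborel ?S"
    by (rule emeasure_Lipschitz_image_le[OF lip _ S Sb cone_over_borel[OF A(1) AM] cov]) (use r in auto)
  moreover have "2 * ?L = 12 * (1 + q\<^sup>2) / k" using r(2) by simp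
  ultimately show ?thesis by simp
qed

text \<open>
  Integrate the preceding estimate over \<open>y \<in> D\<close> and exchange the order of integration.
\<close>
lemma average_overlap:
  fixes A D :: "'n::finite ambient set"
  assumes k: "0 < k" "k \<le> 1" "k \<le> 1 + curvature g * q\<^sup>2"
    and A: "A \<in> sets (gvolume g)" "A \<subseteq> chart_ball g q" and D: "D \<in> sets (gvolume g)" "D \<subseteq> chart_ball g q"
    and AD: "A \<inter> D = {}"
  defines "r \<equiv> sqrt ((1 + q\<^sup>2) / k)"
  defines "C \<equiv> ennreal ((12 * (1 + q\<^sup>2) / k * DIM('n ambient)) ^ DIM('n ambient))"
  shows "emeasure lborel (cone_over A) * emeasure (gvolume g) D \<le>
    C * (\<integral>\<^sup>+ v \<in> bounded_normals g r. emeasure (gvolume g) (D \<inter> reflect g v -` A) \<partial>lborel)"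
proof -
  let ?\<mu> = "gvolume g :: 'n ambient measure"
  interpret G: sigma_finite_measure ?\<mu> by (rule sigma_finite_gvolume)
  interpret P: pair_sigma_finite ?\<mu> "lborel :: 'n ambient measure" ..
  have A': "A \<in> sets borel" "A \<subseteq> model_space g" using A(1) by (auto simp: sets_gvolume_iff)
  note [measurable] = A'(1) D(1)
  let ?V = "bounded_normals g r :: 'n ambient set"
  let ?f = "\<lambda>y v. indicator D y * indicator ?V v * indicator A (reflect g v y) :: ennreal"
  have [measurable]: "fst \<in> ?\<mu> \<Otimes>\<^sub>M lborel \<rightarrow>\<^sub>M (borel :: 'n ambient measure)"
    by (rule measurable_compose[OF measurable_fst measurable_gvolume_borel]) simp
  have [measurable]: "(\<lambda>z. reflect g (snd z) (fst z)) \<in> ?\<mu> \<Otimes>\<^sub>M lborel \<rightarrow>\<^sub>M borel"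
    by (rule borel_measurable_reflect) measurable
  have [measurable]: "(\<lambda>z. indicator D (fst z) :: ennreal) \<in> borel_measurable (?\<mu> \<Otimes>\<^sub>M (lborel :: 'n ambient measure))"
    by (rule measurable_compose[OF measurable_fst borel_measurable_indicator[OF D(1)]])
  have meas: "(\<lambda>(y, v). ?f y v) \<in> borel_measurable (?\<mu> \<Otimes>\<^sub>M lborel)"
    unfolding case_prod_beta by measurable
  have inner: "(\<integral>\<^sup>+ v. ?f y v \<partial>lborel) = emeasure lborel {v \<in> ?V. reflect g v y \<in> A}" if "y \<in> D" for y
  proof -
    have "{v \<in> ?V. reflect g v y \<in> A} = ?V \<inter> ((\<lambda>v. reflect g v y) -` A \<inter> space borel)" by auto
    also have "\<dots> \<in> sets borel"
      by (intro sets.Int measurable_sets[OF borel_measurable_reflect]) (simp_all add: A')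
    finally have [measurable]: "{v \<in> ?V. reflect g v y \<in> A} \<in> sets borel" .
    have "(\<integral>\<^sup>+ v. ?f y v \<partial>lborel) = (\<integral>\<^sup>+ v. indicator {v \<in> ?V. reflect g v y \<in> A} v \<partial>lborel)"
      using that by (intro nn_integral_cong) (simp add: indicator_def)
    then show ?thesis by simp
  qed
  have "emeasure lborel (cone_over A) * emeasure ?\<mu> D = (\<integral>\<^sup>+ y. emeasure lborel (cone_over A) * indicator D y \<partial>?\<mu>)"
    by (rule nn_integral_cmult_indicator[symmetric]) (rule D(1))
  also have "\<dots> \<le> (\<integral>\<^sup>+ y. C * (\<integral>\<^sup>+ v. ?f y v \<partial>lborel) \<partial>?\<mu>)"
  proof (rule nn_integral_mono)
    fix y
    show "emeasure lborel (cone_over A) * indicator D y \<le> C * (\<integral>\<^sup>+ v. ?f y v \<partial>lborel)"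
    proof (cases "y \<in> D")
      case True
      then have "y \<in> chart_ball g q" "y \<notin> A" using D AD by blast+
      from emeasure_cone_le_reflecting_normals[OF k A'(1) A(2) this]
      show ?thesis using True inner[OF True] by (simp add: C_def r_def)
    qed simp
  qed
  also have "\<dots> = C * (\<integral>\<^sup>+ y. (\<integral>\<^sup>+ v. ?f y v \<partial>lborel) \<partial>?\<mu>)"
    using meas by (intro nn_integral_cmult lborel.borel_measurable_nn_integral) (simp add: case_prod_beta')
  also have "(\<integral>\<^sup>+ y. (\<integral>\<^sup>+ v. ?f y v \<partial>lborel) \<partial>?\<mu>) = (\<integral>\<^sup>+ v. (\<integral>\<^sup>+ y. ?f y v \<partial>?\<mu>) \<partial>lborel)"
    by (rule P.Fubini'[symmetric, OF meas])
  also have "\<dots> = (\<integral>\<^sup>+ v \<in> ?V. emeasure ?\<mu> (D \<inter> reflect g v -` A) \<partial>lborel)"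
  proof (rule nn_integral_cong)
    fix v :: "'n ambient"
    show "(\<integral>\<^sup>+ y. ?f y v \<partial>?\<mu>) = emeasure ?\<mu> (D \<inter> reflect g v -` A) * indicator ?V v"
    proof (cases "v \<in> ?V")
      case True
      then have v: "normal_form g v > 0" by (simp add: bounded_normals_def normals_def)
      have "D \<inter> reflect g v -` A \<in> sets ?\<mu>"
        using sym_pair_vimage_sets[OF sym_pair_reflect[OF v] A(1)] D(1) by simp
      moreover have "(\<integral>\<^sup>+ y. ?f y v \<partial>?\<mu>) = (\<integral>\<^sup>+ y. indicator (D \<inter> reflect g v -` A) y \<partial>?\<mu>)"
        using True by (intro nn_integral_cong) (simp add: indicator_def)
      ultimately show ?thesis using True by simp
    qed simp
  qed
  finally show ?thesis .
qed

text \<open>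
  Some reflection achieves at least the average overlap.  As \<open>v\<close> and \<open>- v\<close> define the same reflection, the base
  point can be assumed to lie on the side \<open>0 \<le> x \<bullet> v\<close>.
\<close>
lemma exists_overlapping_reflection:
  fixes g :: geometry
  assumes k: "0 < k" "k \<le> 1" "k \<le> 1 + curvature g * q\<^sup>2"
  shows "\<exists>c>0. \<forall>A \<in> sets (gvolume g :: 'n::finite ambient measure). \<forall>D \<in> sets (gvolume g).
    A \<subseteq> chart_ball g q \<and> D \<subseteq> chart_ball g q \<and> A \<inter> D = {} \<and>
    measure (gvolume g) A > 0 \<and> measure (gvolume g) D > 0 \<longrightarrow>
    (\<exists>v. normal_form g v > 0 \<and> fst v \<ge> 0 \<and>
      c * measure (gvolume g) A * measure (gvolume g) D \<le> measure (gvolume g) (D \<inter> reflect g v -` A))"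
proof -
  define r where "r = sqrt ((1 + q\<^sup>2) / k)"
  define C where "C = (12 * (1 + q\<^sup>2) / k * DIM('n ambient)) ^ DIM('n ambient)"
  define n where "n = real (CARD('n) + 1)"
  let ?V = "bounded_normals g r :: 'n ambient set"
  define V where "V = measure lborel ?V"
  have eV: "emeasure lborel ?V = ennreal V"
  proof -
    have "bounded ?V" by (rule bounded_subset[OF bounded_cball[of 0 r]]) (auto simp: bounded_normals_def)
    then have "emeasure lborel ?V < \<infinity>" by (rule emeasure_bounded_finite)
    then show ?thesis unfolding V_def by (intro emeasure_eq_ennreal_measure) simp
  qed
  have C0: "C \<ge> 0" using k by (simp add: C_def)
  \<comment> \<open>the summand 1 avoids division by zero; all that matters is n C V c < 1\<close>
  define c where "c = 1 / (2 * (n * C * V + 1))"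
  have nCV: "n * C * V \<ge> 0" using C0 by (simp add: n_def V_def)
  have "0 < 1 / (2 * (x + 1))" "x * (1 / (2 * (x + 1))) < 1" if "x \<ge> 0" for x :: real
    using that by (simp_all add: pos_divide_less_eq)
  from this[OF nCV] have c: "c > 0" "n * C * V * c < 1" by (simp_all only: c_def)
  have "\<exists>v. normal_form g v > 0 \<and> fst v \<ge> 0 \<and>
        c * measure (gvolume g) A * measure (gvolume g) D \<le> measure (gvolume g) (D \<inter> reflect g v -` A)"
    if A: "A \<in> sets (gvolume g)" "A \<subseteq> chart_ball g q" and D: "D \<in> sets (gvolume g)" "D \<subseteq> chart_ball g q"
      and AD: "A \<inter> D = {}" and pos: "measure (gvolume g) A > 0" "measure (gvolume g) D > 0"
    for A D :: "'n ambient set"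
  proof -
    define a where "a = measure (gvolume g) A"
    define d where "d = measure (gvolume g) D"
    have ea: "emeasure (gvolume g) A = ennreal a" and ed: "emeasure (gvolume g) D = ennreal d"
      using pos by (simp_all add: a_def d_def measure_def enn2real_positive_iff less_top)
    have A': "A \<in> sets borel" "A \<subseteq> model_space g" using A(1) by (auto simp: sets_gvolume_iff)
    have na: "ennreal a = ennreal n * emeasure lborel (cone_over A)"
      using emeasure_gvolume[OF A'] by (simp add: ea n_def ennreal_of_nat_eq_real_of_nat del: of_nat_add of_nat_Suc)
    have fin: "emeasure (gvolume g) (D \<inter> E) = ennreal (measure (gvolume g) (D \<inter> E))" for E
    proof (rule emeasure_eq_ennreal_measure)
      have "emeasure (gvolume g) (D \<inter> E) \<le> emeasure (gvolume g) D" using D(1) by (intro emeasure_mono) auto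
      then show "emeasure (gvolume g) (D \<inter> E) \<noteq> top" by (auto simp: ed top_unique)
    qed
    have "\<exists>v \<in> ?V. c * a * d \<le> measure (gvolume g) (D \<inter> reflect g v -` A)"
    proof (rule ccontr)
      assume "\<not> ?thesis"
      then have small: "measure (gvolume g) (D \<inter> reflect g v -` A) \<le> c * a * d" if "v \<in> ?V" for v
        using that by force
      have cad: "c * a * d > 0" using c pos by (simp add: a_def d_def)
      have "ennreal a * ennreal d = ennreal n * (emeasure lborel (cone_over A) * ennreal d)"
        by (simp add: na mult.assoc)
      also have "\<dots> \<le> ennreal n * (ennreal C * (\<integral>\<^sup>+ v \<in> ?V. emeasure (gvolume g) (D \<inter> reflect g v -` A) \<partial>lborel))"
        using average_overlap[OF k A D AD] by (intro mult_left_mono) (simp_all add: ed r_def C_def)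
      also have "(\<integral>\<^sup>+ v \<in> ?V. emeasure (gvolume g) (D \<inter> reflect g v -` A) \<partial>lborel) \<le>
          (\<integral>\<^sup>+ v \<in> ?V. ennreal (c * a * d) \<partial>lborel)"
        by (intro nn_integral_mono) (auto simp: fin indicator_def intro!: ennreal_leI small)
      also have "\<dots> = ennreal (c * a * d) * ennreal V" by (simp add: nn_integral_cmult_indicator eV)
      finally have "ennreal a * ennreal d \<le> ennreal n * (ennreal C * (ennreal (c * a * d) * ennreal V))"
        by (simp add: mult_left_mono)
      then have "ennreal (a * d) \<le> ennreal (n * (C * (c * a * d * V)))"
        using C0 cad pos by (simp add: ennreal_mult[symmetric] a_def d_def V_def n_def del: of_nat_add of_nat_Suc)
      then have "a * d \<le> n * (C * (c * a * d * V))"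
        using C0 cad by (subst (asm) ennreal_le_iff) (auto simp: n_def V_def)
      also have "\<dots> = (n * C * V * c) * (a * d)" by simp
      also have "\<dots> < 1 * (a * d)" using c pos by (intro mult_strict_right_mono) (auto simp: a_def d_def)
      finally show False by simp
    qed
    then obtain v where v: "v \<in> ?V" "c * a * d \<le> measure (gvolume g) (D \<inter> reflect g v -` A)" by blast
    have nv: "normal_form g v > 0" using v(1) by (simp add: bounded_normals_def normals_def)
    have "reflect g (- v) x = reflect g v x" for x
      using reflect_scale[OF nv, of "- 1" x] by simp
    then have "reflect g (- v) = reflect g v" by blast
    moreover have "normal_form g (- v) > 0" using nv normal_form_scaleR[of g "- 1" v] by simp
    ultimately show ?thesis
      using v(2) nv unfolding a_def d_def
      by (cases "fst v \<ge> 0") (metis, metis fst_uminus linorder_linear neg_0_le_iff_le)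
  qed
  then show ?thesis using c(1) by (intro exI[of _ c] conjI ballI impI) (assumption, elim conjE)
qed

section \<open>Polarizing towards a ball\<close>

text \<open>
  For suitable \<open>s\<close> these are the geodesic balls around the base point.
\<close>
definition sublevel :: "geometry \<Rightarrow> real \<Rightarrow> 'n::finite ambient set" where
  "sublevel g s = {x \<in> model_space g. polar_height g x \<le> s}"

lemma sublevel_sets [measurable]: "sublevel g s \<in> sets (gvolume g :: 'n::finite ambient measure)"
proof -
  have "closed {x :: 'n ambient. polar_height g x \<le> s}"
    by (cases g; simp; intro closed_Collect_le continuous_intros)
  moreover have "(sublevel g s :: 'n ambient set) = model_space g \<inter> {x. polar_height g x \<le> s}"
    by (auto simp: sublevel_def)
  ultimately show ?thesis by (simp add: sets_gvolume_iff)
qed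

lemma sublevel_mono: "s \<le> t \<Longrightarrow> sublevel g s \<subseteq> sublevel g t"
  by (force simp: sublevel_def)

text \<open>
  The number \<open>k\<close> bounds \<open>1 + curvature g * q\<^sup>2\<close> away from zero; this restricts \<open>q\<close> only in the hyperbolic
  case, where the chart is the open unit ball.
\<close>
lemma sublevel_subset_chart_ball:
  assumes "g = Spherical \<Longrightarrow> s < 0"
  obtains q k where "0 < k" "k \<le> 1" "k \<le> 1 + curvature g * q\<^sup>2"
    "(sublevel g s :: 'n::finite ambient set) \<subseteq> chart_ball g q"
proof (cases g)
  case Spherical
  then have s: "s < 0" using assms by simp
  have "x \<in> chart_ball g (1 / - s)" if "x \<in> sublevel g s" for x :: "'n ambient"
  proof -
    have x: "x \<in> model_space g" "- s \<le> fst x" using that Spherical by (auto simp: sublevel_def)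
    have "norm (snd x) \<le> norm x" using norm_snd_le[of "snd x" "fst x"] by simp
    also have "norm x = 1" using x Spherical by (simp add: norm_eq_1)
    also have "1 \<le> 1 / - s * fst x" using x s by (simp add: field_simps)
    finally show ?thesis using x s by (simp add: chart_ball_def)
  qed
  then have "(sublevel g s :: 'n ambient set) \<subseteq> chart_ball g (1 / - s)" by blast
  then show ?thesis by (rule that[of 1, rotated -1]) (simp_all add: Spherical)
next
  case Euclidean
  have "x \<in> chart_ball g (sqrt s)" if "x \<in> sublevel g s" for x :: "'n ambient"
  proof -
    have x: "x \<in> model_space g" "(norm (snd x))\<^sup>2 \<le> s"
      using that Euclidean by (auto simp: sublevel_def power2_norm_eq_inner)
    then have "fst x = 1" "norm (snd x) \<le> sqrt s" using Euclidean by (auto intro: real_le_rsqrt)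
    then show ?thesis using x by (simp add: chart_ball_def)
  qed
  then have "(sublevel g s :: 'n ambient set) \<subseteq> chart_ball g (sqrt s)" by blast
  then show ?thesis by (rule that[of 1, rotated -1]) (simp_all add: Euclidean)
next
  case Hyperbolic
  define t where "t = max s 1"
  have t: "t \<ge> 1" "s \<le> t" by (simp_all add: t_def)
  define q where "q = sqrt (1 - 1 / t\<^sup>2)"
  have "t\<^sup>2 \<ge> 1" using t by (simp add: one_le_power)
  then have t2: "0 < 1 / t\<^sup>2" "1 / t\<^sup>2 \<le> 1" using t(1) by (auto simp: divide_le_eq_1)
  then have q: "q\<^sup>2 = 1 - 1 / t\<^sup>2" "q \<ge> 0" by (simp_all add: q_def)
  have "x \<in> chart_ball g q" if x: "x \<in> sublevel g s" for x :: "'n ambient"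
  proof -
    have M: "x \<in> model_space Hyperbolic" using x Hyperbolic by (simp add: sublevel_def)
    then have h: "fst x \<ge> 1" "(fst x)\<^sup>2 = 1 + snd x \<bullet> snd x" by (auto simp: Hyperbolic_iff simp del: model_space.simps)
    have "fst x \<le> t" using x t Hyperbolic by (auto simp: sublevel_def)
    then have "(fst x)\<^sup>2 \<le> t\<^sup>2" using h by (intro power_mono) auto
    then have "(fst x)\<^sup>2 / t\<^sup>2 \<le> 1" using t by (simp add: divide_le_eq_1)
    then have "(norm (snd x))\<^sup>2 \<le> q\<^sup>2 * (fst x)\<^sup>2"
      using h(2) by (simp add: q(1) power2_norm_eq_inner algebra_simps)
    then have "(norm (snd x))\<^sup>2 \<le> (q * fst x)\<^sup>2" by (simp add: power_mult_distrib)
    then have "norm (snd x) \<le> q * fst x" by (rule power2_le_imp_le) (use q h in auto)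
    then show ?thesis using M h Hyperbolic by (simp add: chart_ball_def)
  qed
  then have "(sublevel g s :: 'n ambient set) \<subseteq> chart_ball g q" by blast
  then show ?thesis by (rule that[OF t2, rotated -1]) (simp add: Hyperbolic q)
qed

lemma bounded_chart_ball:
  assumes "0 < k" "k \<le> 1" "k \<le> 1 + curvature g * q\<^sup>2"
  shows "bounded (chart_ball g q :: 'n::finite ambient set)"
  unfolding bounded_iff
  by (rule exI[of _ "sqrt ((1 + q\<^sup>2) / k)"]) (use chart_ball_norm_le[OF _ assms] real_le_rsqrt in blast)

lemma fmeasurable_if_subset_sublevel:
  fixes A :: "'n::finite ambient set"
  assumes s: "g = Spherical \<Longrightarrow> s < 0" and A: "A \<in> sets (gvolume g)" "A \<subseteq> sublevel g s"
  shows "A \<in> fmeasurable (gvolume g)"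
proof -
  obtain q k where "0 < k" "k \<le> 1" "k \<le> 1 + curvature g * q\<^sup>2"
    "(sublevel g s :: 'n ambient set) \<subseteq> chart_ball g q"
    using sublevel_subset_chart_ball[OF s] by blast
  then have "bounded A" using bounded_subset[OF bounded_chart_ball] A(2) by blast
  then show ?thesis using emeasure_gvolume_bounded[OF A(1)] A(1) by (simp add: fmeasurable_def)
qed

lemma reflect_sublevel:
  assumes v: "normal_form g v > 0" "fst v \<ge> 0" and x: "x \<in> sublevel g b" "x \<bullet> v \<le> 0"
  shows "reflect g v x \<in> sublevel g b"
proof -
  have "reflect g v x \<in> model_space g" using x v by (simp add: sublevel_def)
  then have "polar_height g (reflect g v x) \<le> polar_height g (reflect g v (reflect g v x))"
    using v x by (intro polar_height_le_reflect) (simp_all add: reflect_inner_normal)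
  then show ?thesis using x v by (simp add: sublevel_def)
qed

lemma polarize_sublevel:
  assumes v: "normal_form g v > 0" "fst v \<ge> 0" and L: "L \<subseteq> sublevel g s"
  shows "polarize g v L \<subseteq> sublevel g s"
proof
  fix x assume "x \<in> polarize g v L"
  then consider "x \<in> L" | "x \<in> model_space g" "0 \<le> x \<bullet> v" "reflect g v x \<in> L"
    by (auto simp: polarize_def split: if_splits)
  then show "x \<in> sublevel g s"
  proof cases
    case 2
    then have "polar_height g x \<le> polar_height g (reflect g v x)" "reflect g v x \<in> sublevel g s"
      using v L by (auto intro!: polar_height_le_reflect)
    then show ?thesis using 2 by (simp add: sublevel_def)
  qed (use L in auto)
qed

lemma measure_Diff_fmeasurable:
  assumes "A \<in> fmeasurable M" "B \<in> fmeasurable M"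
  shows "measure M (A - B) = measure M A - measure M (A \<inter> B)"
proof -
  have "measure M (A - A \<inter> B) = measure M A - measure M (A \<inter> B)"
    using assms by (intro measurable_measure_Diff) (auto dest: fmeasurableD)
  moreover have "A - A \<inter> B = A - B" by blast
  ultimately show ?thesis by simp
qed

text \<open>
  Consider all sets \<open>L\<close> in the large ball that have the volume of \<open>K\<close> and a cut functional no larger than that of \<open>K\<close>,
  and let \<open>S\<close> be the supremum of the volumes of \<open>L \<inter> B\<close>, where \<open>B\<close> is the ball with the volume of \<open>K\<close>.  If \<open>S\<close> were
  less than the volume of \<open>B\<close> by \<open>d\<close>, then \<open>L - B\<close> and \<open>B - L\<close> would have volume at least \<open>d\<close> for all \<open>L\<close>, and
  polarizing a nearly optimal \<open>L\<close> would increase the volume of \<open>L \<inter> B\<close> by at least \<open>c d\<^sup>2\<close>, beyond \<open>S\<close>.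
\<close>
lemma polarize_towards_sublevel:
  fixes K :: "'n::finite ambient set"
  assumes s: "g = Spherical \<Longrightarrow> s < 0" and bs: "b \<le> s" and N: "N > 0"
    and K: "K \<in> sets (gvolume g)" "K \<subseteq> sublevel g s"
    and vol: "emeasure (gvolume g) K = emeasure (gvolume g) (sublevel g b :: 'n ambient set)" and e: "e > 0"
  obtains L :: "'n ambient set" where "L \<in> sets (gvolume g)" "L \<subseteq> sublevel g s"
    "emeasure (gvolume g) L = emeasure (gvolume g) K" "cut_functional g N L \<le> cut_functional g N K"
    "measure (gvolume g) (sublevel g b - L) < e"
proof -
  let ?\<mu> = "gvolume g :: 'n ambient measure"
  let ?B = "sublevel g b :: 'n ambient set"
  obtain q k where k: "0 < k" "k \<le> 1" "k \<le> 1 + curvature g * q\<^sup>2"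
    and q: "(sublevel g s :: 'n ambient set) \<subseteq> chart_ball g q"
    using sublevel_subset_chart_ball[OF s] by blast
  have Bs: "?B \<subseteq> sublevel g s" using bs by (rule sublevel_mono)
  have fm: "A \<in> fmeasurable ?\<mu>" if "A \<in> sets ?\<mu>" "A \<subseteq> sublevel g s" for A
    using s by (rule fmeasurable_if_subset_sublevel[OF _ that])
  have B: "?B \<in> sets ?\<mu>" by (rule sublevel_sets)
  obtain c where c: "c > 0" and ov: "\<forall>A \<in> sets ?\<mu>. \<forall>D \<in> sets ?\<mu>.
    A \<subseteq> chart_ball g q \<and> D \<subseteq> chart_ball g q \<and> A \<inter> D = {} \<and> measure ?\<mu> A > 0 \<and> measure ?\<mu> D > 0 \<longrightarrow>
    (\<exists>v. normal_form g v > 0 \<and> fst v \<ge> 0 \<and> c * measure ?\<mu> A * measure ?\<mu> D \<le> measure ?\<mu> (D \<inter> reflect g v -` A))"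
    using exists_overlapping_reflection[OF k, where ?'n = 'n] by (elim exE conjE) (rule that)
  define \<K> where "\<K> = {L \<in> sets ?\<mu>. L \<subseteq> sublevel g s \<and> emeasure ?\<mu> L = emeasure ?\<mu> K \<and>
    cut_functional g N L \<le> cut_functional g N K}"
  define V where "V = measure ?\<mu> ?B"
  define m where "m L = measure ?\<mu> (L \<inter> ?B)" for L
  have D: "measure ?\<mu> (?B - L) = V - m L" and A: "measure ?\<mu> (L - ?B) = V - m L" if "L \<in> \<K>" for L
  proof -
    have "L \<in> sets ?\<mu>" "L \<subseteq> sublevel g s" using that by (simp_all add: \<K>_def)
    then have L: "L \<in> fmeasurable ?\<mu>" by (rule fm)
    have Bf: "?B \<in> fmeasurable ?\<mu>" using B Bs by (rule fm)
    have "measure ?\<mu> L = V" using that vol by (simp add: \<K>_def V_def measure_def)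
    then show "measure ?\<mu> (?B - L) = V - m L" "measure ?\<mu> (L - ?B) = V - m L"
      using measure_Diff_fmeasurable[OF Bf L] measure_Diff_fmeasurable[OF L Bf]
      unfolding m_def V_def by (simp_all add: Int_commute)
  qed
  have K0: "K \<in> \<K>" using K by (simp add: \<K>_def)
  have mV: "m L \<le> V" if "L \<in> \<K>" for L using D[OF that] measure_nonneg[of ?\<mu> "?B - L"] by simp
  then have bdd: "bdd_above (m ` \<K>)" by (rule bdd_aboveI2)
  define S where "S = Sup (m ` \<K>)"
  have mS: "m L \<le> S" if "L \<in> \<K>" for L unfolding S_def using that bdd by (rule cSUP_upper)
  have SV: "S \<le> V" unfolding S_def using K0 mV by (intro cSUP_least) auto
  have near: "\<exists>L \<in> \<K>. S - d < m L" if "d > 0" for d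
    using less_cSUP_iff[of \<K> m "S - d"] K0 bdd that by (auto simp: S_def)
  have "S = V"
  proof (rule ccontr)
    assume "S \<noteq> V"
    define d where "d = V - S"
    have d: "d > 0" using SV \<open>S \<noteq> V\<close> by (simp add: d_def)
    obtain L where L: "L \<in> \<K>" "S - c * d * d < m L" using near[of "c * d * d"] c d by auto
    have Lm: "L \<in> sets ?\<mu>" "L \<subseteq> sublevel g s" "emeasure ?\<mu> L = emeasure ?\<mu> K"
      "cut_functional g N L \<le> cut_functional g N K" using L(1) by (auto simp: \<K>_def)
    have ge: "measure ?\<mu> (?B - L) \<ge> d" "measure ?\<mu> (L - ?B) \<ge> d"
      using D[OF L(1)] A[OF L(1)] mS[OF L(1)] by (simp_all add: d_def)
    have "\<exists>v. normal_form g v > 0 \<and> fst v \<ge> 0 \<and>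
        c * measure ?\<mu> (L - ?B) * measure ?\<mu> (?B - L) \<le> measure ?\<mu> ((?B - L) \<inter> reflect g v -` (L - ?B))"
    proof (intro ov[rule_format] conjI)
      show "L - ?B \<in> sets ?\<mu>" "?B - L \<in> sets ?\<mu>" using Lm(1) B by auto
      show "L - ?B \<subseteq> chart_ball g q" "?B - L \<subseteq> chart_ball g q" using Lm(2) Bs q by blast+
      show "(L - ?B) \<inter> (?B - L) = {}" by blast
      show "measure ?\<mu> (L - ?B) > 0" "measure ?\<mu> (?B - L) > 0" using ge d by simp_all
    qed
    then obtain v where nv: "normal_form g v > 0" "fst v \<ge> 0"
      "c * measure ?\<mu> (L - ?B) * measure ?\<mu> (?B - L) \<le> measure ?\<mu> ((?B - L) \<inter> reflect g v -` (L - ?B))" by blast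
    interpret polarization g v L by unfold_locales (use nv Lm in auto)
    let ?E = "(?B - L) \<inter> reflect g v -` (L - ?B)"
    have Es: "?E \<in> sets ?\<mu>" using Lm(1) B reflect_vimage_sets[of "L - ?B"] by auto
    have P: "K' \<in> \<K>"
    proof -
      have "vol L < \<infinity>" using fm[OF Lm(1,2)] by (simp add: fmeasurable_def)
      then have "cut_functional g N K' \<le> cut_functional g N K"
        using cut_functional_polarize_le[OF _ N] Lm(4) by (blast intro: order_trans)
      then show ?thesis
        using polarize_sets polarize_sublevel[OF nv(1,2) Lm(2)] vol_polarize Lm(3) by (simp add: \<K>_def)
    qed
    have fin: "vol X = ennreal (measure ?\<mu> X)" if "X \<in> sets ?\<mu>" "X \<subseteq> sublevel g s" for X
      using fm[OF that] by (simp add: emeasure_eq_measure2)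
    have "L \<inter> ?B \<in> sets ?\<mu>" "K' \<inter> ?B \<in> sets ?\<mu>" using Lm(1) B polarize_sets by auto
    moreover have "L \<inter> ?B \<subseteq> sublevel g s" "K' \<inter> ?B \<subseteq> sublevel g s" "?E \<subseteq> sublevel g s" using Bs by auto
    ultimately have *: "vol (L \<inter> ?B) = ennreal (m L)" "vol (K' \<inter> ?B) = ennreal (m K')"
      "vol ?E = ennreal (measure ?\<mu> ?E)" unfolding m_def using Es by (blast intro: fin)+
    have "vol (L \<inter> ?B) + vol ?E \<le> vol (K' \<inter> ?B)"
      using nv by (intro vol_gain[OF B] reflect_sublevel) auto
    then have "ennreal (m L) + ennreal (measure ?\<mu> ?E) \<le> ennreal (m K')" by (simp only: *)
    then have "ennreal (m L + measure ?\<mu> ?E) \<le> ennreal (m K')"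
      using ennreal_plus[of "m L" "measure ?\<mu> ?E"] by (simp only: m_def measure_nonneg)
    then have "m L + measure ?\<mu> ?E \<le> m K'" by (subst (asm) ennreal_le_iff) (simp_all add: m_def)
    moreover have "c * d * d \<le> c * measure ?\<mu> (L - ?B) * measure ?\<mu> (?B - L)"
      using c d ge by (intro mult_mono) auto
    ultimately have "S < m K'" using nv(3) L(2) by linarith
    then show False using mS[OF P] by simp
  qed
  then obtain L where L: "L \<in> \<K>" "V - e < m L" using near[OF e] by auto
  then have "measure ?\<mu> (?B - L) < e" using D by simp
  then show ?thesis using that[of L] L(1) by (simp add: \<K>_def)
qed

text \<open>
  Sets \<open>L n\<close> of the volume of the ball with \<open>cut_functional g N (L n) \<le> cut_functional g N K\<close> converge to the
  ball in measure.  The volume in each half-space converges, and Fatou's lemma gives the claim; it applies although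
  the measure of all hyperplanes may be infinite.
\<close>
theorem cut_functional_sublevel_le:
  fixes K :: "'n::finite ambient set"
  assumes s: "g = Spherical \<Longrightarrow> s < 0" and bs: "b \<le> s" and N: "N > 0"
    and K: "K \<in> sets (gvolume g)" "K \<subseteq> sublevel g s"
    and vol: "emeasure (gvolume g) K = emeasure (gvolume g) (sublevel g b :: 'n ambient set)"
  shows "cut_functional g N (sublevel g b :: 'n ambient set) \<le> cut_functional g N K"
proof -
  let ?\<mu> = "gvolume g :: 'n ambient measure"
  let ?B = "sublevel g b :: 'n ambient set"
  have fm: "A \<in> fmeasurable ?\<mu>" if "A \<in> sets ?\<mu>" "A \<subseteq> sublevel g s" for A
    using s by (rule fmeasurable_if_subset_sublevel[OF _ that])
  have B: "?B \<in> sets ?\<mu>" "?B \<subseteq> sublevel g s" using sublevel_mono[OF bs] by (auto simp: sublevel_sets)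
  have "\<exists>L. L \<in> sets ?\<mu> \<and> L \<subseteq> sublevel g s \<and> emeasure ?\<mu> L = emeasure ?\<mu> K \<and>
      cut_functional g N L \<le> cut_functional g N K \<and> measure ?\<mu> (?B - L) < inverse (real (Suc n))" for n
    by (rule polarize_towards_sublevel[OF s bs N K vol, of "inverse (real (Suc n))"]) (assumption, simp, blast)
  then obtain L where L: "\<And>n. L n \<in> sets ?\<mu>" "\<And>n. L n \<subseteq> sublevel g s"
    "\<And>n. emeasure ?\<mu> (L n) = emeasure ?\<mu> K" "\<And>n. cut_functional g N (L n) \<le> cut_functional g N K"
    "\<And>n. measure ?\<mu> (?B - L n) < inverse (real (Suc n))" by metis
  have meas: "measure ?\<mu> (L n) = measure ?\<mu> ?B" for n
    using L(3)[of n] vol by (simp add: measure_def)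
  have lim: "(\<lambda>n. side_prob g (L n) w) \<longlonglongrightarrow> side_prob g ?B w" for w
  proof -
    let ?H = "halfspace g w"
    have "\<bar>measure ?\<mu> (L n \<inter> ?H) - measure ?\<mu> (?B \<inter> ?H)\<bar> \<le> inverse (real (Suc n))" for n
    proof -
      have sub: "A \<inter> ?H \<in> fmeasurable ?\<mu>" "A \<in> fmeasurable ?\<mu>" if "A \<in> sets ?\<mu>" "A \<subseteq> sublevel g s" for A
        using that halfspace_sets by (auto intro!: fm)
      note f = sub[OF L(1,2)] sub[OF B]
      \<comment> \<open>intersecting with a half-space changes no volume by more than the difference of the sets\<close>
      have one: "measure ?\<mu> (X \<inter> ?H) \<le> measure ?\<mu> (Y \<inter> ?H) + measure ?\<mu> (X - Y)"
        if "X \<in> fmeasurable ?\<mu>" "Y \<in> fmeasurable ?\<mu>" "X \<inter> ?H \<in> fmeasurable ?\<mu>" "Y \<inter> ?H \<in> fmeasurable ?\<mu>" for X Y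
      proof -
        have "measure ?\<mu> (X \<inter> ?H) \<le> measure ?\<mu> ((Y \<inter> ?H) \<union> (X - Y))"
          using that by (intro measure_mono_fmeasurable) (auto dest: fmeasurableD)
        also have "\<dots> \<le> measure ?\<mu> (Y \<inter> ?H) + measure ?\<mu> (X - Y)"
          using that by (intro measure_Un_le) (auto dest: fmeasurableD)
        finally show ?thesis .
      qed
      have "measure ?\<mu> (L n - ?B) = measure ?\<mu> (?B - L n)"
        using measure_Diff_fmeasurable[OF f(2)[of n] f(4)] measure_Diff_fmeasurable[OF f(4) f(2)[of n]] meas[of n] by (simp add: Int_commute)
      then show ?thesis
        using one[of "L n" ?B, OF f(2,4,1,3)] one[of ?B "L n", OF f(4,2,3,1)] L(5)[of n] by linarith
    qed
    then have "(\<lambda>n. measure ?\<mu> (L n \<inter> ?H) - measure ?\<mu> (?B \<inter> ?H)) \<longlonglongrightarrow> 0"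
      by (intro Lim_null_comparison[OF always_eventually LIMSEQ_inverse_real_of_nat]) (simp add: real_norm_def)
    then have "(\<lambda>n. measure ?\<mu> (L n \<inter> ?H)) \<longlonglongrightarrow> measure ?\<mu> (?B \<inter> ?H)" by (simp add: LIM_zero_iff)
    then show ?thesis
      unfolding side_prob_def meas divide_inverse by (rule tendsto_mult_right)
  qed
  let ?f = "\<lambda>A w. ennreal (split_prob N (side_prob g A w)) * indicator (normals g) w"
  have "liminf (\<lambda>n. ?f (L n) w) = ?f ?B w" for w
  proof (rule lim_imp_Liminf)
    have "(\<lambda>n. split_prob N (side_prob g (L n) w)) \<longlonglongrightarrow> split_prob N (side_prob g ?B w)"
      unfolding split_prob_def by (intro tendsto_intros lim)
    then have "(\<lambda>n. ennreal (split_prob N (side_prob g (L n) w))) \<longlonglongrightarrow> ennreal (split_prob N (side_prob g ?B w))"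
      by (rule tendsto_ennrealI)
    then show "(\<lambda>n. ?f (L n) w) \<longlonglongrightarrow> ?f ?B w" by (cases "w \<in> normals g") simp_all
  qed simp
  then have "cut_functional g N ?B = (\<integral>\<^sup>+ w. liminf (\<lambda>n. ?f (L n) w) \<partial>lborel)"
    unfolding cut_functional_def by simp
  also have "\<dots> \<le> liminf (\<lambda>n. \<integral>\<^sup>+ w. ?f (L n) w \<partial>lborel)"
    by (rule nn_integral_liminf) (use measurable_side_prob[OF L(1)] in measurable)
  also have "\<dots> \<le> cut_functional g N K"
    using L(4) unfolding cut_functional_def by (intro Liminf_le) (auto intro: always_eventually)
  finally show ?thesis .
qed

section \<open>Geodesic segments\<close>

text \<open>
  Generalized trigonometric functions: the solutions of \<open>f'' = - curvature g * f\<close> with initial values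
  \<open>(0, 1)\<close> and \<open>(1, 0)\<close>.
\<close>
fun sn :: "geometry \<Rightarrow> real \<Rightarrow> real" where
  "sn Spherical = sin" | "sn Euclidean = (\<lambda>t. t)" | "sn Hyperbolic = sinh"

fun cs :: "geometry \<Rightarrow> real \<Rightarrow> real" where
  "cs Spherical = cos" | "cs Euclidean = (\<lambda>t. 1)" | "cs Hyperbolic = cosh"

lemma sn_add: "sn g (s + t) = sn g s * cs g t + cs g s * sn g t"
  by (cases g) (simp_all add: sin_add sinh_add)

lemma cs_add: "cs g (s + t) = cs g s * cs g t - curvature g * sn g s * sn g t"
  by (cases g) (simp_all add: cos_add cosh_add)

lemma sn_diff: "sn g (s - t) = sn g s * cs g t - cs g s * sn g t"
  by (cases g) (simp_all add: sin_diff sinh_diff)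

lemma cs_diff: "cs g (s - t) = cs g s * cs g t + curvature g * sn g s * sn g t"
  by (cases g) (simp_all add: cos_diff cosh_diff)

lemma cs_squared: "(cs g t)\<^sup>2 = 1 - curvature g * (sn g t)\<^sup>2"
  by (cases g) (simp_all add: cos_squared_eq cosh_square_eq)

lemma sn_0 [simp]: "sn g 0 = 0" and cs_0 [simp]: "cs g 0 = 1"
  by (cases g; simp)+

lemma continuous_sn:
  fixes f :: "real \<Rightarrow> real"
  assumes "continuous_on S f"
  shows "continuous_on S (\<lambda>t. sn g (f t))"
  by (cases g) (simp_all add: assms continuous_on_sin continuous_on_sinh)

text \<open>
  With the sign of its spatial part changed, \<open>w\<close> becomes a normal vector of a hyperplane through \<open>x\<close>, and these
  have positive normal form.
\<close>
lemma Hyperbolic_orthogonal: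
  assumes "x \<in> model_space Hyperbolic" "lorentz x w = 0"
  shows "lorentz w w \<le> 0" "lorentz w w = 0 \<Longrightarrow> w = 0"
proof -
  let ?v = "(fst w, - snd w)"
  have v: "x \<bullet> ?v = 0" "normal_form Hyperbolic ?v = - lorentz w w"
    using assms(2) by (simp_all add: inner_prod_def lorentz_def)
  have w: "?v = 0 \<longleftrightarrow> w = 0" by (simp add: prod_eq_iff)
  have neg: "lorentz w w < 0" if "w \<noteq> 0"
    using normal_form_pos[OF _ assms(1) v(1)] v(2) w that by simp
  then show "lorentz w w \<le> 0" by (cases "w = 0") (auto simp: lorentz_def)
  show "w = 0" if "lorentz w w = 0" using neg that by force
qed

text \<open>
  The reversed Cauchy-Schwarz inequality, from the component of \<open>y\<close> that is orthogonal to \<open>x\<close>.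
\<close>
lemma Hyperbolic_lorentz_ge_1:
  assumes x: "x \<in> model_space Hyperbolic" and y: "y \<in> model_space Hyperbolic"
  shows "lorentz x y \<ge> 1" "lorentz x y = 1 \<Longrightarrow> x = y"
proof -
  have xx: "lorentz x x = 1" "lorentz y y = 1" "fst x > 0" "fst y > 0" using x y by auto
  define c where "c = lorentz x y"
  have c: "lorentz x y = c" "lorentz y x = c" by (simp_all add: c_def lorentz_commute)
  let ?w = "y - c *\<^sub>R x"
  have o: "lorentz x ?w = 0" using xx c by (simp add: lorentz_linear)
  have w: "lorentz ?w ?w = 1 - c\<^sup>2" using xx c by (simp add: lorentz_linear power2_eq_square)
  have "1 \<le> c\<^sup>2" using Hyperbolic_orthogonal(1)[OF x o] w by simp
  moreover have "c > 0" unfolding c_def by (rule lorentz_pos) (simp_all add: xx)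
  ultimately show "lorentz x y \<ge> 1" unfolding c by (intro power2_le_imp_le[of 1 c]) auto
  show "x = y" if "lorentz x y = 1"
  proof -
    have "c = 1" using that c by simp
    then have "?w = 0" using Hyperbolic_orthogonal(2)[OF x o] w by simp
    then show ?thesis using \<open>c = 1\<close> by simp
  qed
qed

lemma model_form_eq_cs_gdist:
  assumes "x \<in> model_space g" "y \<in> model_space g"
  shows "model_form g x y = cs g (gdist g x y)"
proof (cases g)
  case Spherical
  then have "\<bar>x \<bullet> y\<bar> \<le> 1" using assms Cauchy_Schwarz_ineq2[of x y] by (simp add: norm_eq_1[symmetric])
  then show ?thesis using Spherical by (simp add: model_form_Spherical cos_arccos_abs)
next
  case Euclidean
  then show ?thesis using assms by (simp add: model_form_Euclidean)
next
  case Hyperbolic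
  then show ?thesis using assms Hyperbolic_lorentz_ge_1(1)[of x y]
    by (simp add: model_form_Hyperbolic cosh_arcosh_real del: model_space.simps)
qed

lemma gdist_nonneg:
  assumes "x \<in> model_space g" "y \<in> model_space g"
  shows "0 \<le> gdist g x y"
proof (cases g)
  case Spherical
  then have "\<bar>x \<bullet> y\<bar> \<le> 1" using assms Cauchy_Schwarz_ineq2[of x y] by (simp add: norm_eq_1[symmetric])
  then show ?thesis using Spherical by (simp add: arccos_lbound abs_le_iff)
next
  case Hyperbolic
  then show ?thesis using assms Hyperbolic_lorentz_ge_1(1)[of x y]
    by (simp add: arcosh_nonneg_real del: model_space.simps)
qed simp

text \<open>
  Pairs of points that are joined by a unique shortest geodesic of positive length.
\<close>
locale geodesic_pair =
  fixes g and x y :: "'n::finite ambient"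
  assumes x: "x \<in> model_space g" and y: "y \<in> model_space g" and ne: "x \<noteq> y"
    and anti: "g = Spherical \<Longrightarrow> x \<noteq> - y"
begin

abbreviation "d \<equiv> gdist g x y"

lemma d_pos: "0 < d" and d_less_pi: "g = Spherical \<Longrightarrow> d < pi"
proof -
  have sph: "\<bar>x \<bullet> y\<bar> \<le> 1" "x \<bullet> y \<noteq> 1" "x \<bullet> y \<noteq> - 1" if "g = Spherical"
  proof -
    have xx: "x \<bullet> x = 1" "y \<bullet> y = 1" using x y that by auto
    then show "\<bar>x \<bullet> y\<bar> \<le> 1" using Cauchy_Schwarz_ineq2[of x y] by (simp add: norm_eq_1[symmetric])
    have "(x - y) \<bullet> (x - y) = 2 - 2 * (x \<bullet> y)" "(x + y) \<bullet> (x + y) = 2 + 2 * (x \<bullet> y)"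
      using xx by (simp_all add: algebra_simps inner_commute)
    moreover have "x - y \<noteq> 0" "x + y \<noteq> 0" using ne anti[OF that] by (auto simp: eq_neg_iff_add_eq_0)
    ultimately show "x \<bullet> y \<noteq> 1" "x \<bullet> y \<noteq> - 1" by (metis inner_gt_zero_iff less_irrefl diff_self mult.right_neutral, 
        metis inner_gt_zero_iff less_irrefl add.right_inverse mult_minus_right mult.right_neutral)
  qed
  have "d \<noteq> 0"
  proof
    assume d0: "d = 0"
    then have m: "model_form g x y = 1" using model_form_eq_cs_gdist[OF x y] by simp
    show False
    proof (cases g)
      case Spherical then show ?thesis using sph m by (simp add: model_form_Spherical)
    next
      case Euclidean then show ?thesis using d0 ne by simp
    next
      case Hyperbolic then show ?thesis
        using m Hyperbolic_lorentz_ge_1(2)[of x y] x y ne by (simp add: model_form_Hyperbolic del: model_space.simps)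
    qed
  qed
  then show "0 < d" using gdist_nonneg[OF x y] by simp
  show "d < pi" if g: "g = Spherical"
  proof -
    have "x \<bullet> y = cos d" using model_form_eq_cs_gdist[OF x y] unfolding g model_form_Spherical cs.simps .
    then have "d \<noteq> pi" using sph(3)[OF g] by (metis cos_pi)
    moreover have "d \<le> pi" using sph[OF g] g by (simp add: arccos_ubound abs_le_iff)
    ultimately show ?thesis by simp
  qed
qed

lemma sn_d_pos: "0 < sn g d"
proof (cases g)
  case Spherical
  then show ?thesis using sin_gt_zero[OF d_pos d_less_pi[OF Spherical]] by (simp only: sn.simps)
qed (use d_pos in \<open>simp_all del: gdist.simps\<close>)

lemma sn_nonneg: "0 \<le> t \<Longrightarrow> t \<le> d \<Longrightarrow> 0 \<le> sn g t"
proof (cases g)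
  case Spherical
  then show "0 \<le> t \<Longrightarrow> t \<le> d \<Longrightarrow> 0 \<le> sn g t" using sin_ge_zero[of t] d_less_pi[OF Spherical] by (simp only: sn.simps)
qed auto

lemma model_form_xy: "model_form g x y = cs g d" "model_form g y x = cs g d"
    "model_form g x x = 1" "model_form g y y = 1"
  using model_form_eq_cs_gdist[OF x y] model_form_self x y by (simp_all add: model_form_commute)

definition geodesic :: "real \<Rightarrow> 'n ambient" where
  "geodesic t = (sn g (d - t) / sn g d) *\<^sub>R x + (sn g t / sn g d) *\<^sub>R y"

lemma geodesic_0 [simp]: "geodesic 0 = x" and geodesic_d [simp]: "geodesic d = y"
  using sn_d_pos by (simp_all add: geodesic_def)

lemma model_form_add:
  "model_form g (u + w) z = model_form g u z + model_form g w z"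
  "model_form g z (u + w) = model_form g z u + model_form g z w"
  by (simp_all add: model_form_def algebra_simps)

lemma model_form_geodesic: "model_form g (geodesic s) (geodesic t) = cs g (s - t)"
proof -
  define S where "S = sn g d"
  define C where "C = cs g d"
  define k where "k = curvature g"
  have S: "S \<noteq> 0" using sn_d_pos by (simp add: S_def)
  have C: "C\<^sup>2 = 1 - k * S\<^sup>2" by (simp add: C_def S_def k_def cs_squared)
  define a b a' b' where "a = cs g s" "b = sn g s" "a' = cs g t" "b' = sn g t"
  have "model_form g (geodesic s) (geodesic t) =
      ((S * a - C * b) * (S * a' - C * b') + b * b' + C * ((S * a - C * b) * b' + b * (S * a' - C * b'))) / S\<^sup>2"
    unfolding geodesic_def model_form_add model_form_scale_left model_form_scale_right model_form_xy sn_diff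
      S_def[symmetric] C_def[symmetric] a_b_a'_b'_def[symmetric]
    using S by (simp add: power2_eq_square field_simps)
  also have "(S * a - C * b) * (S * a' - C * b') + b * b' + C * ((S * a - C * b) * b' + b * (S * a' - C * b'))
      = S\<^sup>2 * (a * a') + b * b' * (1 - C\<^sup>2)"
    by (simp add: power2_eq_square algebra_simps)
  also have "\<dots> = S\<^sup>2 * (a * a' + k * b * b')" by (simp add: C algebra_simps)
  also have "\<dots> / S\<^sup>2 = cs g (s - t)" using S by (simp add: cs_diff a_b_a'_b'_def k_def)
  finally show ?thesis .
qed

lemma geodesic_model:
  assumes t: "0 \<le> t" "t \<le> d"
  shows "geodesic t \<in> model_space g"
proof -
  have m: "model_form g (geodesic t) (geodesic t) = 1" by (simp add: model_form_geodesic)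
  have c: "0 \<le> sn g (d - t) / sn g d" "0 \<le> sn g t / sn g d"
    using sn_nonneg[of t] sn_nonneg[of "d - t"] sn_d_pos t by simp_all
  show ?thesis
  proof (cases g)
    case Spherical then show ?thesis using m by (simp add: model_form_Spherical)
  next
    case Euclidean
    then show ?thesis unfolding geodesic_def
      using x y d_pos by (simp add: diff_divide_distrib del: gdist.simps)
  next
    case Hyperbolic
    have "fst x > 0" "fst y > 0" using x y Hyperbolic by auto
    then have "fst (geodesic t) \<ge> 0" unfolding geodesic_def fst_add fst_scaleR real_scaleR_def
      using c by (intro add_nonneg_nonneg mult_nonneg_nonneg) auto
    moreover have "fst (geodesic t) \<noteq> 0" using m Hyperbolic by (auto simp: model_form_def simp flip: power2_eq_square)
       (smt (verit) inner_ge_zero)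
    ultimately show ?thesis using m Hyperbolic by (simp add: model_form_Hyperbolic)
  qed
qed

lemma gdist_geodesic:
  assumes s: "0 \<le> s" "s \<le> d" and t: "0 \<le> t" "t \<le> d"
  shows "gdist g (geodesic s) (geodesic t) = \<bar>s - t\<bar>"
proof (cases g)
  case Spherical
  have "\<bar>s - t\<bar> \<le> pi" using s t d_less_pi[OF Spherical] by (simp only: abs_le_iff) linarith
  then have "arccos (cos \<bar>s - t\<bar>) = \<bar>s - t\<bar>" by (intro arccos_cos) auto
  then show ?thesis using model_form_geodesic[of s t] Spherical by (simp add: model_form_Spherical)
next
  case Euclidean
  have "geodesic s - geodesic t = ((t - s) / d) *\<^sub>R (x - y)"
    unfolding geodesic_def using Euclidean by (simp add: algebra_simps diff_divide_distrib del: gdist.simps)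
  then have "norm (geodesic s - geodesic t) = \<bar>(t - s) / d\<bar> * norm (x - y)" by (simp del: gdist.simps)
  also have "norm (x - y) = d" using Euclidean by simp
  finally show ?thesis using d_pos Euclidean by (simp add: abs_divide)
next
  case Hyperbolic
  have "arcosh (cosh \<bar>s - t\<bar>) = \<bar>s - t\<bar>" by (rule arcosh_cosh_real) simp
  then show ?thesis using model_form_geodesic[of s t] Hyperbolic by (simp add: model_form_Hyperbolic)
qed

lemma geodesic_in_segment: "0 \<le> t \<Longrightarrow> t \<le> d \<Longrightarrow> geodesic t \<in> geodesic_segment g x y"
  unfolding geodesic_segment_def using gdist_geodesic geodesic_model
  by (intro CollectI exI[of _ geodesic] exI[of _ t]) auto

text \<open>
  Equality in the triangle inequality determines \<open>z\<close>.  In the curved geometries the difference of \<open>z\<close> and the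
  geodesic point is a null vector, which gives the claim on the sphere; in hyperbolic space it is moreover
  orthogonal to \<open>z\<close>, and there the form is definite.
\<close>
lemma segment_point_eq_geodesic:
  assumes z: "z \<in> model_space g" and u: "gdist g x z = u" "gdist g z y = d - u"
  shows "z = geodesic u"
proof (cases "g = Euclidean")
  case False
  \<comment> \<open>w is sn g d times the difference of z and the geodesic point\<close>
  define w where "w = sn g d *\<^sub>R z - sn g (d - u) *\<^sub>R x - sn g u *\<^sub>R y"
  define a where "a = d - u"
  have d: "d = a + u" by (simp add: a_def)
  have mz: "model_form g x z = cs g u" "model_form g z x = cs g u" "model_form g y z = cs g a"
    "model_form g z y = cs g a" "model_form g z z = 1"
    using model_form_eq_cs_gdist[OF x z] model_form_eq_cs_gdist[OF z y] model_form_self[OF z] u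
    by (simp_all add: model_form_commute a_def)
  note mf = w_def model_form_diff_left model_form_diff_right model_form_scale_left model_form_scale_right mz model_form_xy
  have "model_form g z w = sn g d - sn g a * cs g u - sn g u * cs g a"
    unfolding mf by (simp add: a_def)
  then have zw: "model_form g z w = 0" unfolding d sn_add by simp
  have "model_form g w w = (sn g d)\<^sup>2 + (sn g a)\<^sup>2 + (sn g u)\<^sup>2
      - 2 * sn g d * (sn g a * cs g u + cs g a * sn g u) + 2 * sn g a * sn g u * cs g d"
    unfolding mf by (simp add: a_def power2_eq_square algebra_simps)
  also have "\<dots> = (sn g a)\<^sup>2 * (1 - (cs g u)\<^sup>2) + (sn g u)\<^sup>2 * (1 - (cs g a)\<^sup>2) - 2 * curvature g * (sn g a)\<^sup>2 * (sn g u)\<^sup>2"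
    unfolding d sn_add cs_add by (simp add: power2_eq_square algebra_simps)
  also have "\<dots> = 0" by (simp add: cs_squared algebra_simps)
  finally have ww: "model_form g w w = 0" .
  have "w = 0"
  proof (cases g)
    case Spherical then show ?thesis using ww by (simp add: model_form_Spherical)
  next
    case Hyperbolic then show ?thesis
      using ww zw z Hyperbolic_orthogonal(2)[of z w] by (simp add: model_form_Hyperbolic del: model_space.simps)
  qed (use False in simp)
  then have "sn g d *\<^sub>R z = sn g (d - u) *\<^sub>R x + sn g u *\<^sub>R y" by (simp add: w_def algebra_simps)
  moreover have "z = (1 / sn g d) *\<^sub>R (sn g d *\<^sub>R z)" using sn_d_pos by simp
  ultimately have "z = (1 / sn g d) *\<^sub>R (sn g (d - u) *\<^sub>R x + sn g u *\<^sub>R y)" by (simp only:)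
  then show ?thesis by (simp add: geodesic_def scaleR_add_right)
next
  case True
  then have D: "dist x z = u" "dist z y = d - u" "dist x y = d" using u by (simp_all add: dist_norm)
  then have "norm (x - y) *\<^sub>R (x - z) = norm (x - z) *\<^sub>R (x - y)"
    using norm_triangle_eq[of "x - z" "z - y"]
    by (simp add: dist_norm) (simp add: algebra_simps)
  then have "d *\<^sub>R (x - z) = u *\<^sub>R (x - y)" using D by (simp add: dist_norm)
  then have "d *\<^sub>R z = (d - u) *\<^sub>R x + u *\<^sub>R y" by (simp add: algebra_simps)
  moreover have "z = (1 / d) *\<^sub>R (d *\<^sub>R z)" using d_pos by (simp del: gdist.simps)
  ultimately have "z = (1 / d) *\<^sub>R ((d - u) *\<^sub>R x + u *\<^sub>R y)" by (simp only:)
  then show ?thesis unfolding geodesic_def using True by (simp add: scaleR_add_right del: gdist.simps)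
qed

lemma geodesic_segment_eq: "geodesic_segment g x y = geodesic ` {0..d}"
proof (intro equalityI subsetI)
  fix z assume "z \<in> geodesic_segment g x y"
  then obtain \<gamma> u where *: "z = \<gamma> u" "u \<in> {0..d}" "\<gamma> ` {0..d} \<subseteq> model_space g" "\<gamma> 0 = x" "\<gamma> d = y"
      "\<And>s t. s \<in> {0..d} \<Longrightarrow> t \<in> {0..d} \<Longrightarrow> gdist g (\<gamma> s) (\<gamma> t) = \<bar>s - t\<bar>"
    unfolding geodesic_segment_def by blast
  have "z \<in> model_space g" using * by blast
  moreover have "gdist g x z = u" using *(6)[of 0 u] * d_pos by (simp del: gdist.simps)
  moreover have "gdist g z y = d - u" using *(6)[of u d] * d_pos by (simp del: gdist.simps)
  ultimately have "z = geodesic u" by (rule segment_point_eq_geodesic)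
  then show "z \<in> geodesic ` {0..d}" using *(2) by blast
qed (auto simp del: gdist.simps intro: geodesic_in_segment)

lemma continuous_on_geodesic: "continuous_on S geodesic"
  unfolding geodesic_def using sn_d_pos by (intro continuous_intros continuous_sn) auto

lemma compact_geodesic_segment: "compact (geodesic_segment g x y)"
  unfolding geodesic_segment_eq by (intro compact_continuous_image continuous_on_geodesic compact_Icc)

lemma segment_meets:
  assumes "x \<bullet> v \<ge> 0" "y \<bullet> v \<le> 0"
  shows "\<exists>z \<in> geodesic_segment g x y. z \<bullet> v = 0"
proof -
  have "\<exists>t. 0 \<le> t \<and> t \<le> d \<and> geodesic t \<bullet> v = 0"
    using assms d_pos by (intro IVT2' continuous_intros continuous_on_geodesic) (auto simp del: gdist.simps)
  then show ?thesis using geodesic_in_segment by blast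
qed

text \<open>
  Points of the segment are linear combinations of the end points with nonnegative coefficients.
\<close>
lemma segment_in_halfspace:
  assumes "x \<bullet> v > 0" "y \<bullet> v > 0"
  shows "geodesic_segment g x y \<subseteq> halfspace g v"
proof
  fix z assume "z \<in> geodesic_segment g x y"
  then obtain t where t: "0 \<le> t" "t \<le> d" "z = geodesic t" unfolding geodesic_segment_eq by auto
  have c: "0 \<le> sn g (d - t) / sn g d" "0 \<le> sn g t / sn g d"
    using sn_nonneg[of t] sn_nonneg[of "d - t"] sn_d_pos t by simp_all
  have zM: "z \<in> model_space g" using geodesic_model t by simp
  have zv: "z \<bullet> v = (sn g (d - t) / sn g d) * (x \<bullet> v) + (sn g t / sn g d) * (y \<bullet> v)"
    by (simp add: t(3) geodesic_def inner_add_left)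
  have "z \<noteq> 0" using zM by (cases g) (auto simp: lorentz_def)
  then have "sn g (d - t) / sn g d \<noteq> 0 \<or> sn g t / sn g d \<noteq> 0"
    unfolding t(3) geodesic_def by (metis add.right_neutral scaleR_zero_left)
  then have "z \<bullet> v > 0" unfolding zv using c assms
    by (smt (verit) mult_nonneg_nonneg mult_pos_pos)
  then show "z \<in> halfspace g v" using zM by (simp add: halfspace_def)
qed

end

section \<open>Convex hulls of random points\<close>

definition strictly_one_sided :: "'n::finite ambient \<Rightarrow> 'n ambient set \<Rightarrow> bool" where
  "strictly_one_sided v X \<longleftrightarrow> (\<forall>x\<in>X. 0 < x \<bullet> v) \<or> (\<forall>x\<in>X. x \<bullet> v < 0)"

definition antipodal_free :: "geometry \<Rightarrow> 'n::finite ambient set \<Rightarrow> bool" where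
  "antipodal_free g X \<longleftrightarrow> (g = Spherical \<longrightarrow> (\<forall>x\<in>X. \<forall>y\<in>X. x \<noteq> - y))"

lemma geodesic_segment_refl:
  assumes "x \<in> model_space g"
  shows "geodesic_segment g x x \<subseteq> {x}"
proof -
  have "gdist g x x = 0" using assms by (cases g) auto
  then show ?thesis unfolding geodesic_segment_def by auto
qed

lemma gconvex_halfspace: "gconvex g (halfspace g v)"
  unfolding gconvex_def
proof (intro conjI ballI impI)
  show "halfspace g v \<subseteq> model_space g" unfolding halfspace_def by blast
  fix x y assume xy: "x \<in> halfspace g v" "y \<in> halfspace g v" "g = Spherical \<longrightarrow> x \<noteq> - y"
  then have M: "x \<in> model_space g" "y \<in> model_space g" "0 < x \<bullet> v" "0 < y \<bullet> v"
    by (simp_all add: halfspace_def)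
  show "geodesic_segment g x y \<subseteq> halfspace g v"
  proof (cases "x = y")
    case True
    then show ?thesis using geodesic_segment_refl[OF M(1)] xy(1) by blast
  next
    case False
    interpret geodesic_pair g x y by unfold_locales (use M False xy in auto)
    show ?thesis using M by (intro segment_in_halfspace)
  qed
qed

lemma subset_gconv: "X \<subseteq> gconv g X"
  unfolding gconv_def by (rule hull_subset)

lemma segment_subset_gconv:
  assumes "x \<in> X" "y \<in> X" "g = Spherical \<Longrightarrow> x \<noteq> - y"
  shows "geodesic_segment g x y \<subseteq> gconv g X"
  unfolding gconv_def hull_def using assms unfolding gconvex_def by blast

lemma gconv_disjoint_perp_if_one_sided:
  assumes X: "X \<subseteq> model_space g" and v: "strictly_one_sided v X"
  shows "gconv g X \<inter> perp g v = {}"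
proof -
  have "gconv g X \<inter> perp g w = {}" if "\<forall>x\<in>X. 0 < x \<bullet> w" for w
  proof -
    have "X \<subseteq> halfspace g w" using X that unfolding halfspace_def by blast
    then have "gconv g X \<subseteq> halfspace g w"
      unfolding gconv_def by (rule hull_minimal) (rule gconvex_halfspace)
    then show ?thesis unfolding halfspace_def perp_def by fastforce
  qed
  from this[of v] this[of "- v"] show ?thesis
    using v unfolding strictly_one_sided_def perp_def by auto
qed

text \<open>
  A hyperplane misses the convex hull of \<open>X\<close> if and only if all points of \<open>X\<close> lie strictly on one side: half-spaces are
  convex, and a segment between points on different sides meets the hyperplane.  The set of hyperplanes that meet
  the hull is measurable because the compact union \<open>C\<close> of the segments is met by the same hyperplanes.
\<close>
lemma U1_gconv:
  fixes X :: "'n::finite ambient set"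
  assumes X: "finite X" "X \<noteq> {}" "X \<subseteq> model_space g" "antipodal_free g X"
  shows "U1 g (gconv g X) =
    inverse (emeasure (unnormalized_hyperplane_measure g) (reference_hyperplanes g :: 'n ambient set set)) *
    (\<integral>\<^sup>+ v \<in> normals g. indicator {v. \<not> strictly_one_sided v X} v \<partial>lborel)"
proof -
  define C where "C = X \<union> (\<Union>x\<in>X. \<Union>y\<in>X - {x}. geodesic_segment g x y)"
  have pair: "geodesic_pair g x y" if "x \<in> X" "y \<in> X - {x}" for x y
    using that X unfolding geodesic_pair_def antipodal_free_def by blast
  have CM: "C \<subseteq> model_space g"
    unfolding C_def geodesic_segment_def using X(3) by blast
  have inner: "compact (\<Union>y\<in>X - {x}. geodesic_segment g x y)" if "x \<in> X" for x
    using X(1) geodesic_pair.compact_geodesic_segment[OF pair[OF that]] by (intro compact_UN) blast+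
  then have cC: "compact C"
    unfolding C_def by (intro compact_Un finite_imp_compact[OF X(1)]) (rule compact_UN[OF X(1) inner])
  have CX: "C \<subseteq> gconv g X"
    unfolding C_def
  proof (intro Un_least UN_least subset_gconv)
    fix x y assume xy: "x \<in> X" "y \<in> X - {x}"
    then show "geodesic_segment g x y \<subseteq> gconv g X"
      using X(4) by (intro segment_subset_gconv) (auto simp only: antipodal_free_def)
  qed
  have meets: "perp g v \<inter> C \<noteq> {}" if v: "\<not> strictly_one_sided v X" for v
  proof -
    obtain x y where xy: "x \<in> X" "y \<in> X" "x \<bullet> v \<ge> 0" "y \<bullet> v \<le> 0"
      using v unfolding strictly_one_sided_def by (metis linorder_not_less)
    have "\<exists>z \<in> C. z \<bullet> v = 0"
    proof (cases "x = y")
      case True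
      then show ?thesis using xy unfolding C_def by force
    next
      case False
      then have "\<exists>z \<in> geodesic_segment g x y. z \<bullet> v = 0"
        using geodesic_pair.segment_meets[OF pair] xy by blast
      then show ?thesis using xy False unfolding C_def by blast
    qed
    then show ?thesis using CM unfolding perp_def by blast
  qed
  have hit_iff: "perp g v \<inter> C \<noteq> {} \<longleftrightarrow> \<not> strictly_one_sided v X"
    "perp g v \<inter> gconv g X \<noteq> {} \<longleftrightarrow> \<not> strictly_one_sided v X" for v
    using meets[of v] gconv_disjoint_perp_if_one_sided[OF X(3), of v] CX by blast+
  have hC: "hitting g C \<in> sets (hyperplane_algebra g)" by (rule hitting_measurable[OF cC CM])
  have "U1 g (gconv g X) = (\<integral>\<^sup>+ H. chi (C \<inter> H) \<partial>hyperplane_measure g)"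
    unfolding U1_def
  proof (rule nn_integral_cong)
    fix H :: "'n ambient set" assume "H \<in> space (hyperplane_measure g)"
    then obtain v where "H = perp g v" by (auto simp: hyperplanes_eq)
    then show "chi (gconv g X \<inter> H) = chi (C \<inter> H)"
      using hit_iff[of v] by (simp add: chi_def Int_commute)
  qed
  also have "\<dots> = emeasure (hyperplane_measure g) (hitting g C)"
    using U1_eq_hitting[OF cC CM] by (simp add: U1_def)
  also have "\<dots> = inverse (emeasure (unnormalized_hyperplane_measure g) (reference_hyperplanes g :: 'n ambient set set)) *
      emeasure lborel {v \<in> normals g. perp g v \<in> hitting g C}"
    by (simp add: hyperplane_measure_def Let_def emeasure_unnormalized[OF hC])
  also have "{v \<in> normals g. perp g v \<in> hitting g C} = {v \<in> normals g. \<not> strictly_one_sided v X}"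
    using hit_iff by (auto simp: hitting_def hyperplanes_eq)
  also have "emeasure lborel {v \<in> normals g. \<not> strictly_one_sided v X} =
      (\<integral>\<^sup>+ v \<in> normals g. indicator {v. \<not> strictly_one_sided v X} v \<partial>lborel)"
  proof -
    have "{v \<in> normals g. \<not> strictly_one_sided v X} = perp g -` hitting g C \<inter> space (restrict_space lborel (normals g))"
      using hit_iff by (auto simp: hitting_def hyperplanes_eq space_restrict_space)
    also have "\<dots> \<in> sets (restrict_space lborel (normals g))" by (rule measurable_sets[OF perp_measurable hC])
    finally have m: "{v \<in> normals g. \<not> strictly_one_sided v X} \<in> sets lborel" by (simp add: sets_restrict_space_iff)
    have "(\<integral>\<^sup>+ v \<in> normals g. indicator {v. \<not> strictly_one_sided v X} v \<partial>lborel) =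
        (\<integral>\<^sup>+ v. indicator {v \<in> normals g. \<not> strictly_one_sided v X} v \<partial>lborel)"
      by (intro nn_integral_cong) (auto split: split_indicator)
    then show ?thesis using m by simp
  qed
  finally show ?thesis .
qed

lemma perp_null_sets:
  fixes v :: "'n::finite ambient"
  assumes "v \<noteq> 0"
  shows "perp g v \<in> null_sets (gvolume g)"
proof -
  have cl: "closed {x :: 'n ambient. x \<bullet> v = 0}" by (intro closed_Collect_eq continuous_intros)
  then have p: "perp g v \<in> sets borel" "perp g v \<subseteq> model_space g"
    using sets.Int[OF model_space_borel borel_closed[OF cl]] by (auto simp: perp_def Collect_conj_eq)
  have "negligible {x. v \<bullet> x = 0}" using assms by (intro negligible_hyperplane) simp
  then have "{x. x \<bullet> v = 0} \<in> null_sets lborel"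
    using cl by (simp add: negligible_iff_null_sets inner_commute null_sets_completion_iff)
  then have "emeasure lborel {x. x \<bullet> v = 0} = 0" by (simp add: null_sets_def)
  moreover have "cone_over (perp g v) \<subseteq> {x. x \<bullet> v = 0}"
    unfolding cone_over_def perp_def by (intro subsetI) (elim CollectE exE conjE, simp)
  ultimately have "emeasure lborel (cone_over (perp g v)) = 0"
    using emeasure_mono[of "cone_over (perp g v)" "{x. x \<bullet> v = 0}" lborel] cl by simp
  then show ?thesis using p by (simp add: null_sets_def sets_gvolume_iff emeasure_gvolume)
qed

lemma side_prob_uminus:
  fixes v :: "'n::finite ambient"
  assumes v: "v \<noteq> 0" and L: "L \<in> sets (gvolume g)" "emeasure (gvolume g) L \<noteq> 0" "emeasure (gvolume g) L < \<infinity>"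
  shows "side_prob g L (- v) = 1 - side_prob g L v"
proof -
  let ?m = "measure (gvolume g)"
  have f: "L \<inter> halfspace g w \<in> fmeasurable (gvolume g)" for w
    using L(1,3) by (intro fmeasurable_Int_fmeasurable) (auto simp: fmeasurable_def)
  have "L = (L \<inter> halfspace g v \<union> L \<inter> halfspace g (- v)) \<union> (L \<inter> perp g v)"
    using L(1) unfolding sets_gvolume_iff halfspace_def perp_def by fastforce
  moreover have "L \<inter> perp g v \<in> null_sets (gvolume g)"
    using perp_null_sets[OF v] L(1) by (rule null_set_Int1)
  ultimately have "?m L = ?m (L \<inter> halfspace g v \<union> L \<inter> halfspace g (- v))"
    using measure_Un_null_set[of "L \<inter> halfspace g v \<union> L \<inter> halfspace g (- v)" "gvolume g" "L \<inter> perp g v"] f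
    by (metis fmeasurableD sets.Un)
  also have "\<dots> = ?m (L \<inter> halfspace g v) + ?m (L \<inter> halfspace g (- v))"
  proof (rule measure_Un_AE[OF AE_I2 f f])
    show "x \<notin> L \<inter> halfspace g v \<or> x \<notin> L \<inter> halfspace g (- v)" for x by (simp add: halfspace_def)
  qed
  finally have *: "?m L = ?m (L \<inter> halfspace g v) + ?m (L \<inter> halfspace g (- v))" .
  have "?m L \<noteq> 0" using L by (simp add: measure_def enn2real_eq_0_iff)
  then show ?thesis using * by (simp add: side_prob_def field_simps)
qed

text \<open>
  By Fubini's theorem, \<open>U\<^sub>1\<close> can be averaged over the random points for each hyperplane separately.  Independence gives
  the powers in \<open>split_prob\<close>; the points on the hyperplane form a null set, so both sides together have probability one.
\<close>
theorem expected_U1_eq_cut_functional: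
  fixes L :: "'n::finite ambient set"
  assumes L: "compact L" "L \<subseteq> model_space g" "emeasure (gvolume g) L > 0" "antipodal_free g L" and N: "N > 0"
  shows "expected_U1 g N L =
    inverse (emeasure (unnormalized_hyperplane_measure g) (reference_hyperplanes g :: 'n ambient set set)) *
    cut_functional g N L"
    (is "_ = ?c * _")
proof -
  let ?\<mu> = "gvolume g :: 'n ambient measure"
  let ?U = "uniform_measure ?\<mu> L"
  let ?P = "\<Pi>\<^sub>M i \<in> {..<N}. ?U"
  have Ls: "L \<in> sets ?\<mu>" using L by (simp add: sets_gvolume_iff compact_imp_closed)
  have fin: "emeasure ?\<mu> L < \<infinity>" using emeasure_gvolume_bounded[OF Ls compact_imp_bounded[OF L(1)]] .
  have pos: "emeasure ?\<mu> L \<noteq> 0" using L(3) by simp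
  interpret U: prob_space ?U using pos fin by (intro prob_space_uniform_measure) auto
  interpret P: finite_product_prob_space "\<lambda>_. ?U" "{..<N}" by unfold_locales simp
  have mU: "measure ?U A = measure ?\<mu> (L \<inter> A) / measure ?\<mu> L" if "A \<in> sets ?\<mu>" for A
    using pos fin that by (intro measure_uniform_measure) auto
  have "measure ?\<mu> L \<noteq> 0" using pos fin by (simp add: measure_def enn2real_eq_0_iff)
  then have "measure ?P (Pi\<^sub>E {..<N} (\<lambda>_. L)) = 1"
    using Ls by (subst P.finite_measure_PiM_emb) (auto simp: mU)
  then have AE: "AE X in ?P. X \<in> Pi\<^sub>E {..<N} (\<lambda>_. L)" by (rule P.AE_prob_1)
  let ?I = "\<lambda>X v. indicator {v. \<not> strictly_one_sided v (X ` {..<N})} v * indicator (normals g) v :: ennreal"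
  have id [measurable]: "(\<lambda>x. x) \<in> ?U \<rightarrow>\<^sub>M (borel :: 'n ambient measure)"
    by (simp add: measurable_cong_sets[OF sets_uniform_measure refl] measurable_gvolume_borel)
  have comp: "(\<lambda>z. fst z i) \<in> ?P \<Otimes>\<^sub>M (lborel :: 'n ambient measure) \<rightarrow>\<^sub>M (borel :: 'n ambient measure)" if "i \<in> {..<N}" for i
  proof -
    have "(\<lambda>z. fst z i) \<in> ?P \<Otimes>\<^sub>M (lborel :: 'n ambient measure) \<rightarrow>\<^sub>M ?U"
      by (rule measurable_compose[OF measurable_fst measurable_component_singleton[OF that]])
    then show ?thesis by (rule measurable_compose[where g = "\<lambda>x. x", OF _ id])
  qed
  have meas: "(\<lambda>(X, v). ?I X v) \<in> borel_measurable (?P \<Otimes>\<^sub>M lborel)"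
  proof -
    have [measurable]: "(\<lambda>z. fst z i \<bullet> snd z) \<in> borel_measurable (?P \<Otimes>\<^sub>M lborel)" if "i \<in> {..<N}" for i
      using comp[OF that] by measurable
    have "Measurable.pred (?P \<Otimes>\<^sub>M lborel) (\<lambda>z. (\<forall>i\<in>{..<N}. 0 < fst z i \<bullet> snd z) \<or> (\<forall>i\<in>{..<N}. fst z i \<bullet> snd z < 0))"
      by (intro pred_intros_logic pred_intros_countable_bounded pred_intros_finite) measurable
    then have "Measurable.pred (?P \<Otimes>\<^sub>M lborel) (\<lambda>z. strictly_one_sided (snd z) (fst z ` {..<N}))"
      by (simp add: strictly_one_sided_def)
    then have [measurable]: "{z \<in> space (?P \<Otimes>\<^sub>M lborel). \<not> strictly_one_sided (snd z) (fst z ` {..<N})} \<in> sets (?P \<Otimes>\<^sub>M lborel)"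
      by measurable
    have "(\<lambda>z. indicator {z \<in> space (?P \<Otimes>\<^sub>M lborel). \<not> strictly_one_sided (snd z) (fst z ` {..<N})} z *
        indicator (normals g) (snd z) :: ennreal) \<in> borel_measurable (?P \<Otimes>\<^sub>M lborel)" by measurable
    then show ?thesis
      by (rule measurable_cong[THEN iffD1, rotated]) (auto simp: indicator_def)
  qed
  have inner: "(\<integral>\<^sup>+ X. ?I X v \<partial>?P) = ennreal (split_prob N (side_prob g L v)) * indicator (normals g) v" for v
  proof (cases "v \<in> normals g")
    case True
    then have v: "v \<noteq> 0" by (intro normal_form_nonzero[of g]) (simp add: normals_def)
    define A where "A w = Pi\<^sub>E {..<N} (\<lambda>_. halfspace g w)" for w :: "'n ambient"
    have As: "A w \<in> sets ?P" for w
      unfolding A_def by (intro sets_PiM_I_finite) auto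
    have mA: "measure ?P (A w) = side_prob g L w ^ N" for w
      unfolding A_def by (subst P.finite_measure_PiM_emb) (auto simp: mU side_prob_def)
    have disj: "A v \<inter> A (- v) = {}"
    proof -
      have "X 0 \<in> halfspace g v \<and> X 0 \<in> halfspace g (- v)" if "X \<in> A v \<inter> A (- v)" for X
        using that N unfolding A_def by auto
      then show ?thesis by (fastforce simp: halfspace_def)
    qed
    have "measure ?P (space ?P - (A v \<union> A (- v))) = 1 - (side_prob g L v ^ N + side_prob g L (- v) ^ N)"
      using As by (subst P.prob_compl) (auto simp: P.finite_measure_Union[OF As As disj] mA)
    also have "\<dots> = split_prob N (side_prob g L v)"
      using side_prob_uminus[OF v Ls pos fin] by (simp add: split_prob_def)
    finally have m: "measure ?P (space ?P - (A v \<union> A (- v))) = split_prob N (side_prob g L v)" .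
    have "(\<integral>\<^sup>+ X. ?I X v \<partial>?P) = (\<integral>\<^sup>+ X. indicator (space ?P - (A v \<union> A (- v))) X \<partial>?P)"
    proof (rule nn_integral_cong)
      fix X assume X: "X \<in> space ?P"
      then have XM: "X \<in> Pi\<^sub>E {..<N} (\<lambda>_. model_space g)" by (simp add: space_PiM)
      have "X \<in> A w \<longleftrightarrow> (\<forall>i\<in>{..<N}. 0 < X i \<bullet> w)" for w
        using XM unfolding A_def halfspace_def PiE_def Pi_def by simp blast
      then have "X \<in> A v \<union> A (- v) \<longleftrightarrow> strictly_one_sided v (X ` {..<N})"
        by (simp add: strictly_one_sided_def)
      then show "?I X v = indicator (space ?P - (A v \<union> A (- v))) X"
        using X True by (simp add: indicator_def)
    qed
    also have "\<dots> = emeasure ?P (space ?P - (A v \<union> A (- v)))"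
      using As by (intro nn_integral_indicator) auto
    also have "\<dots> = ennreal (split_prob N (side_prob g L v))" by (simp add: P.emeasure_eq_measure m)
    finally show ?thesis using True by simp
  qed simp
  have sP: "sigma_finite_measure ?P"
    by (rule prob_space_imp_sigma_finite[OF P.prob_space_axioms])
  have sQ: "pair_sigma_finite ?P (lborel :: 'n ambient measure)"
    by (intro pair_sigma_finite.intro sP lborel.sigma_finite_measure_axioms)
  have "expected_U1 g N L = (\<integral>\<^sup>+ X. ?c * (\<integral>\<^sup>+ v. ?I X v \<partial>lborel) \<partial>?P)"
    unfolding expected_U1_def
  proof (rule nn_integral_cong_AE, rule AE_mp[OF AE AE_I2], rule impI)
    fix X assume "X \<in> Pi\<^sub>E {..<N} (\<lambda>_. L)"
    then have XL: "X ` {..<N} \<subseteq> L" by (simp add: PiE_def Pi_def image_subset_iff)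
    have "antipodal_free g (X ` {..<N})" using L(4) XL unfolding antipodal_free_def by blast
    moreover have "X ` {..<N} \<noteq> {}" using N by blast
    ultimately show "U1 g (gconv g (X ` {..<N})) = ?c * (\<integral>\<^sup>+ v. ?I X v \<partial>lborel)"
      using XL L(2) by (intro U1_gconv) (simp, assumption, blast, assumption)
  qed
  also have "\<dots> = ?c * (\<integral>\<^sup>+ X. (\<integral>\<^sup>+ v. ?I X v \<partial>lborel) \<partial>?P)"
    using meas by (intro nn_integral_cmult lborel.borel_measurable_nn_integral) (simp add: case_prod_beta')
  also have "(\<integral>\<^sup>+ X. (\<integral>\<^sup>+ v. ?I X v \<partial>lborel) \<partial>?P) = (\<integral>\<^sup>+ v. (\<integral>\<^sup>+ X. ?I X v \<partial>?P) \<partial>lborel)"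
    by (rule pair_sigma_finite.Fubini'[OF sQ meas, symmetric])
  also have "\<dots> = cut_functional g N L" unfolding inner cut_functional_def ..
  finally show ?thesis .
qed

section \<open>The comparison with balls\<close>

lemma sym_pair_id: "sym_pair g id (id :: 'n::finite ambient \<Rightarrow> 'n ambient)"
  using sym_pair_rotation[OF orthogonal_transformation_id, of g] by (simp add: id_def)

lemma exists_sym_pair_base_point:
  fixes p :: "'n::finite ambient"
  assumes "p \<in> model_space g"
  obtains T S where "sym_pair g T S" "T base_point = p"
proof (cases "p = base_point")
  case True
  then show ?thesis using that[OF sym_pair_id] by simp
next
  case False
  then show ?thesis using exists_reflection[OF assms False] that by blast
qed

lemma model_form_sym_pair:
  assumes "sym_pair g T S" "x \<in> model_space g" "y \<in> model_space g"
  shows "model_form g (T x) (T y) = model_form g x y"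
  using assms sym_pair_model[OF assms(1)] by (simp add: model_form_eq_cs_gdist sym_pairD(6)[OF assms(1)])

text \<open>
  The minimum with \<open>pi\<close> in the spherical case accounts for radii at which the ball is the whole sphere.
\<close>
lemma gball_eq_sublevel:
  assumes r: "r > 0"
  shows "\<exists>b. gball g base_point r = (sublevel g b :: 'n::finite ambient set)"
proof (cases g)
  case Spherical
  define r' where "r' = min r pi"
  have r': "0 < r'" "r' \<le> pi" using r by (simp_all add: r'_def)
  have "arccos (fst x) \<le> r \<longleftrightarrow> - fst x \<le> - cos r'" if "x \<in> model_space Spherical" for x :: "'n ambient"
  proof -
    have "\<bar>fst x\<bar> \<le> 1" using that norm_fst_le[of "fst x" "snd x"] by (simp add: norm_eq_1[symmetric])
    then have f: "- 1 \<le> fst x" "fst x \<le> 1" by linarith+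
    have a: "0 \<le> arccos (fst x)" "arccos (fst x) \<le> pi" "cos (arccos (fst x)) = fst x"
      using f by (simp_all add: arccos_lbound arccos_ubound)
    have "arccos (fst x) \<le> r \<longleftrightarrow> arccos (fst x) \<le> r'" using a by (auto simp: r'_def)
    also have "\<dots> \<longleftrightarrow> cos r' \<le> cos (arccos (fst x))" using r' a by (intro cos_mono_le_eq[symmetric]) auto
    finally show ?thesis using a by simp
  qed
  then have "gball g base_point r = (sublevel g (- cos r') :: 'n ambient set)"
    unfolding Spherical gball_def sublevel_def by (intro Collect_cong) (simp cong: conj_cong)
  then show ?thesis by blast
next
  case Euclidean
  have "norm y \<le> r \<longleftrightarrow> y \<bullet> y \<le> r\<^sup>2" for y :: "real ^ 'n"
    using r by (simp add: norm_le_square)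
  then have "gball g base_point r = (sublevel g (r\<^sup>2) :: 'n ambient set)"
    unfolding Euclidean gball_Euclidean sublevel_def by simp
  then show ?thesis by blast
next
  case Hyperbolic
  have "arcosh (fst x) \<le> r \<longleftrightarrow> fst x \<le> cosh r" if "x \<in> model_space Hyperbolic" for x :: "'n ambient"
  proof -
    have f: "fst x \<ge> 1" using that Hyperbolic_iff by blast
    have "arcosh (fst x) \<le> r \<longleftrightarrow> cosh (arcosh (fst x)) \<le> cosh r"
      using r f by (intro cosh_real_nonneg_le_iff[symmetric]) (simp_all add: arcosh_nonneg_real)
    then show ?thesis using f by (simp add: cosh_arcosh_real)
  qed
  then have "gball g base_point r = (sublevel g (cosh r) :: 'n ambient set)"
    unfolding Hyperbolic gball_def sublevel_def
    by (intro Collect_cong conj_cong refl) simp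
  then show ?thesis by blast
qed

lemma sym_pair_vimage_gball:
  assumes TS: "sym_pair g T S" and p: "T base_point = p"
  shows "T -` gball g p r = gball g base_point r"
proof (rule set_eqI)
  fix x
  show "x \<in> T -` gball g p r \<longleftrightarrow> x \<in> gball g base_point r"
    using sym_pairD(6)[OF TS base_point_model, of x] sym_pair_model[OF TS, of x]
    by (auto simp: gball_def p)
qed

lemma closed_model_space: "closed (model_space g :: 'n::finite ambient set)"
proof (cases g)
  case Spherical
  then show ?thesis by (simp, intro closed_Collect_eq continuous_intros)
next
  case Euclidean
  then show ?thesis by (simp, intro closed_Collect_eq continuous_intros)
next
  case Hyperbolic
  have "model_space g = {x :: 'n ambient. fst x \<ge> 1 \<and> (fst x)\<^sup>2 = 1 + snd x \<bullet> snd x}"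
    unfolding Hyperbolic using Hyperbolic_iff by blast
  also have "closed \<dots>"
    by (intro closed_Collect_conj closed_Collect_le closed_Collect_eq continuous_intros)
  finally show ?thesis .
qed

lemma continuous_on_polar_height: "continuous_on A (polar_height g)"
  by (cases g) (auto simp: polar_height.simps[abs_def] intro!: continuous_intros)

lemma model_space_Spherical: "model_space Spherical = (sphere 0 1 :: 'n::finite ambient set)"
  by (rule set_eqI) (simp add: norm_eq_1)

lemma compact_sublevel: "compact (sublevel g s :: 'n::finite ambient set)"
proof -
  have "closed {x :: 'n ambient. polar_height g x \<le> s}"
    by (intro closed_Collect_le continuous_on_polar_height continuous_on_const)
  moreover have "(sublevel g s :: 'n ambient set) = model_space g \<inter> {x. polar_height g x \<le> s}"
    unfolding sublevel_def by blast
  ultimately have "closed (sublevel g s :: 'n ambient set)"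
    by (simp only:) (intro closed_Int closed_model_space)
  moreover have "bounded (sublevel g s :: 'n ambient set)"
  proof (cases "g = Spherical")
    case True
    then have "(sublevel g s :: 'n ambient set) \<subseteq> sphere 0 1"
      using model_space_Spherical by (auto simp only: sublevel_def)
    then show ?thesis by (rule bounded_subset[OF bounded_sphere])
  next
    case False
    then obtain q k where "0 < k" "k \<le> 1" "k \<le> 1 + curvature g * q\<^sup>2"
      "(sublevel g s :: 'n ambient set) \<subseteq> chart_ball g q"
      using sublevel_subset_chart_ball[of g s] by blast
    then show ?thesis using bounded_chart_ball bounded_subset by blast
  qed
  ultimately show ?thesis by (simp add: compact_eq_bounded_closed)
qed

lemma proper_imp_antipodal_free:
  assumes "g = Spherical \<Longrightarrow> proper K"
  shows "antipodal_free g K"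
proof (cases "g = Spherical")
  case True
  obtain u where u: "K \<subseteq> {x. x \<bullet> u > 0}" using assms[OF True] unfolding proper_def by blast
  have "x \<noteq> - y" if "x \<in> K" "y \<in> K" for x y
  proof
    assume "x = - y"
    moreover have "x \<bullet> u > 0" "y \<bullet> u > 0" using u that by blast+
    ultimately show False by simp
  qed
  then show ?thesis unfolding antipodal_free_def by blast
qed (simp add: antipodal_free_def)

text \<open>
  On the sphere the pole of an open hemisphere that contains \<open>K\<close> is moved to the base point.  By compactness \<open>K\<close> keeps
  a positive distance from the equator, which makes \<open>s\<close> negative.
\<close>
lemma move_into_sublevel:
  fixes K :: "'n::finite ambient set"
  assumes K: "compact K" "K \<subseteq> model_space g" "g = Spherical \<Longrightarrow> proper K"
  obtains T S s where "sym_pair g T S" "T -` K \<subseteq> sublevel g s" "g = Spherical \<Longrightarrow> s < 0"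
proof -
  obtain u where u: "u \<in> model_space g" "g = Spherical \<Longrightarrow> K \<subseteq> {x. x \<bullet> u > 0}"
    using K(3) base_point_model unfolding proper_def by (cases "g = Spherical") blast+
  obtain T S where TS: "sym_pair g T S" and Tu: "T base_point = u"
    using exists_sym_pair_base_point[OF u(1)] by blast
  have sub: "T -` K \<subseteq> model_space g" using K(2) sym_pair_model[OF TS] by blast
  have "\<exists>T S s. sym_pair g T S \<and> T -` K \<subseteq> sublevel g s \<and> (g = Spherical \<longrightarrow> s < 0)"
  proof (cases "K = {}")
    case True
    then show ?thesis using TS by (intro exI[of _ T] exI[of _ S] exI[of _ "- 1"]) simp
  next
    case False
    have "continuous_on K (\<lambda>x. x \<bullet> u)" by (intro continuous_intros)
    then obtain a where a: "a \<in> K" "\<And>x. x \<in> K \<Longrightarrow> a \<bullet> u \<le> x \<bullet> u"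
      using continuous_attains_inf[OF K(1) False] by blast
    obtain c where c: "c \<in> K" "\<And>x. x \<in> K \<Longrightarrow> polar_height g x \<le> polar_height g c"
      using continuous_attains_sup[OF K(1) False continuous_on_polar_height] by blast
    show ?thesis
    proof (cases "g = Spherical")
      case True
      have "polar_height g x \<le> - (a \<bullet> u)" if "x \<in> T -` K" for x
      proof -
        have "T x \<bullet> T base_point = x \<bullet> base_point"
          using model_form_sym_pair[OF TS _ base_point_model, of x] that sub
          unfolding True model_form_Spherical by blast
        then show ?thesis using a(2)[of "T x"] that True by (simp add: Tu)
      qed
      moreover have "a \<bullet> u > 0" using u(2)[OF True] a(1) by blast
      ultimately show ?thesis using TS sub
        by (intro exI[of _ T] exI[of _ S] exI[of _ "- (a \<bullet> u)"]) (simp add: sublevel_def subset_iff)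
    next
      case False
      have "K \<subseteq> sublevel g (polar_height g c)" using K(2) c(2) unfolding sublevel_def by blast
      then show ?thesis using sym_pair_id False
        by (intro exI[of _ id] exI[of _ "polar_height g c"]) simp
    qed
  qed
  then show ?thesis using that by blast
qed

text \<open>
  The band between the equator and a parallel has positive volume, as the cone over it contains a nonempty open set.
  With this, a ball with the volume of a proper compact set is smaller than a hemisphere.
\<close>
lemma emeasure_hemisphere_strict:
  assumes "m > 0"
  shows "emeasure (gvolume Spherical) (sublevel Spherical (- m) :: 'n::finite ambient set) <
    emeasure (gvolume Spherical) (sublevel Spherical 0 :: 'n ambient set)"
proof -
  let ?\<mu> = "gvolume Spherical :: 'n ambient measure"
  let ?M = "model_space Spherical :: 'n ambient set"
  define Z where "Z = (sublevel Spherical 0 - sublevel Spherical (- m) :: 'n ambient set)"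
  have Zs: "Z \<in> sets ?\<mu>" unfolding Z_def by (intro sets.Diff sublevel_sets)
  have Zeq: "Z = {x \<in> ?M. 0 \<le> fst x \<and> fst x < m}"
    unfolding Z_def sublevel_def by auto
  \<comment> \<open>the open cone over the interior of Z, cut off by the unit sphere\<close>
  define W where "W = {v :: 'n ambient. 0 < fst v \<and> fst v < m * norm v \<and> norm v < 1}"
  have "open W" unfolding W_def by (intro open_Collect_conj open_Collect_less continuous_intros)
  moreover have "W \<noteq> {}"
  proof -
    define d where "d = min (m / 4) (1 / 4)"
    have d: "0 < d" "d \<le> m / 4" "d \<le> 1 / 4" using assms by (simp_all add: d_def)
    let ?v = "(d, (1 / 2) *\<^sub>R axis undefined 1) :: 'n ambient"
    have n: "norm ?v \<ge> 1 / 2" using norm_snd_le[of "(1 / 2) *\<^sub>R axis undefined 1 :: real ^ 'n" d] by simp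
    have "m / 4 < m * (1 / 2)" using assms by simp
    also have "\<dots> \<le> m * norm ?v" using n assms by (intro mult_left_mono) auto
    finally have "fst ?v < m * norm ?v" unfolding fst_conv using d(2) by linarith
    moreover have "norm ?v \<le> norm d + norm ((1 / 2) *\<^sub>R axis undefined 1 :: real ^ 'n)" by (rule norm_Pair_le)
    then have "norm ?v < 1" using d by simp
    ultimately have "?v \<in> W" using d by (simp add: W_def)
    then show ?thesis by blast
  qed
  ultimately have "emeasure lborel W > 0" by (rule emeasure_open_pos)
  also have "emeasure lborel W \<le> emeasure lborel (cone_over Z)"
  proof (rule emeasure_mono)
    have ZM: "Z \<subseteq> ?M" using Zs by (simp add: sets_gvolume_iff)
    show "cone_over Z \<in> sets lborel" using Zs cone_over_borel[OF _ ZM] by (simp add: sets_gvolume_iff)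
    show "W \<subseteq> cone_over Z"
    proof
      fix v assume v: "v \<in> W"
      then have n: "0 < norm v" "norm v < 1" "0 < fst v" "fst v < m * norm v" by (auto simp: W_def)
      have "v /\<^sub>R norm v \<in> ?M" using radial_model[of Spherical v] n(1) by simp
      moreover have "0 \<le> fst (v /\<^sub>R norm v)" "fst (v /\<^sub>R norm v) < m"
        using n by (simp_all add: field_simps)
      ultimately have "v /\<^sub>R norm v \<in> Z" by (simp add: Zeq del: model_space.simps)
      then show "v \<in> cone_over Z" unfolding cone_over_eq[OF ZM] using n by simp
    qed
  qed
  finally have "emeasure ?\<mu> Z \<noteq> 0"
    using Zs by (auto simp: emeasure_gvolume sets_gvolume_iff)
  have "bounded (sublevel Spherical (- m) :: 'n ambient set)"
    by (rule compact_imp_bounded[OF compact_sublevel])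
  then have fin: "emeasure ?\<mu> (sublevel Spherical (- m)) < \<infinity>"
    by (rule emeasure_gvolume_bounded[OF sublevel_sets])
  have "emeasure ?\<mu> (sublevel Spherical (- m)) + 0 < emeasure ?\<mu> (sublevel Spherical (- m)) + emeasure ?\<mu> Z"
    using fin \<open>emeasure ?\<mu> Z \<noteq> 0\<close>
    by (metis add.right_neutral ennreal_add_left_cancel_less infinity_ennreal_def less_irrefl not_gr_zero)
  also have "\<dots> = emeasure ?\<mu> (sublevel Spherical (- m) \<union> Z)"
    by (rule plus_emeasure[OF sublevel_sets Zs]) (auto simp: Z_def)
  also have "sublevel Spherical (- m) \<union> Z = sublevel Spherical 0"
    using sublevel_mono[of "- m" 0 Spherical] assms unfolding Z_def by auto
  finally show ?thesis by simp
qed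

lemma expected_U1_0: "expected_U1 g 0 (K :: 'n::finite ambient set) = 0"
proof -
  have "gconvex g ({} :: 'n ambient set)" by (simp add: gconvex_def)
  then have "gconv g {} = ({} :: 'n ambient set)" unfolding gconv_def by (rule hull_same)
  then show ?thesis by (simp add: expected_U1_def U1_def chi_def)
qed

theorem corollary1p2:
  fixes K :: "'n::finite ambient set" and g :: geometry and N :: nat
    and p :: "'n ambient" and r :: real
  assumes "compact K" and "K \<subseteq> model_space g" and "emeasure (gvolume g) K > 0"
    and "g = Spherical \<Longrightarrow> proper K"
    and "p \<in> model_space g" and "r > 0"
    and "emeasure (gvolume g) K = emeasure (gvolume g) (gball g p r)"
  shows "expected_U1 g N K \<ge> expected_U1 g N (gball g p r)"
proof (cases "N = 0")
  case True
  then show ?thesis by (simp add: expected_U1_0)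
next
  case False
  then have N: "N > 0" by simp
  let ?B = "gball g p r"
  obtain T S where TS: "sym_pair g T S" "T base_point = p"
    using exists_sym_pair_base_point[OF assms(5)] by blast
  obtain b where b: "gball g base_point r = (sublevel g b :: 'n ambient set)"
    using gball_eq_sublevel[OF assms(6)] by blast
  obtain R S' s where R: "sym_pair g R S'" "R -` K \<subseteq> sublevel g s" "g = Spherical \<Longrightarrow> s < 0"
    using move_into_sublevel[OF assms(1,2,4)] by blast
  \<comment> \<open>preimages under T and R bring the ball and K into position, by different isometries\<close>
  have TB: "T -` ?B = sublevel g b" using sym_pair_vimage_gball[OF TS] b by simp
  have "T ` sublevel g b = ?B"
    unfolding TB[symmetric] using bij_is_surj[OF sym_pair_bij[OF TS(1)]] by (rule surj_image_vimage_eq)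
  moreover have "continuous_on (sublevel g b) T"
    using sym_pairD(1)[OF TS(1)] linear_continuous_on linear_conv_bounded_linear by blast
  ultimately have cB: "compact ?B" using compact_continuous_image[OF _ compact_sublevel] by metis
  have BM: "?B \<subseteq> model_space g" unfolding gball_def by blast
  have Ks: "K \<in> sets (gvolume g)" and Bs: "?B \<in> sets (gvolume g)"
    using assms(1,2) cB BM by (simp_all add: sets_gvolume_iff compact_imp_closed)
  have vol: "emeasure (gvolume g) (R -` K) = emeasure (gvolume g) (sublevel g b :: 'n ambient set)"
    using emeasure_gvolume_sym_pair[OF R(1) Ks] emeasure_gvolume_sym_pair[OF TS(1) Bs] assms(7) TB by simp
  \<comment> \<open>the ball is smaller than a hemisphere, because K is\<close>
  have b0: "b < 0" if g: "g = Spherical"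
  proof (rule ccontr)
    assume "\<not> b < 0"
    then have "emeasure (gvolume g) (sublevel g 0 :: 'n ambient set) \<le> emeasure (gvolume g) (sublevel g b :: 'n ambient set)"
      by (intro emeasure_mono sublevel_mono sublevel_sets) simp
    also have "\<dots> \<le> emeasure (gvolume g) (sublevel g s :: 'n ambient set)"
      unfolding vol[symmetric] by (rule emeasure_mono[OF R(2) sublevel_sets])
    also have "\<dots> < emeasure (gvolume g) (sublevel g 0 :: 'n ambient set)"
      using emeasure_hemisphere_strict[of "- s", where ?'n = 'n] R(3)[OF g] g by simp
    finally show False by simp
  qed
  have "antipodal_free g ?B"
  proof (rule proper_imp_antipodal_free)
    assume g: "g = Spherical"
    have "x \<bullet> p > 0" if x: "x \<in> ?B" for x
    proof -
      obtain a where a: "a \<in> sublevel g b" "x = T a" using x \<open>T ` sublevel g b = ?B\<close> by blast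
      then have "a \<in> model_space g" "fst a > 0" using b0[OF g] by (auto simp: sublevel_def g)
      then show ?thesis
        using model_form_sym_pair[OF TS(1) _ base_point_model, of a] by (simp add: g a(2) TS(2) model_form_Spherical)
    qed
    then show "proper ?B" using BM assms(5) unfolding proper_def g by blast
  qed
  moreover have "emeasure (gvolume g) ?B > 0" using assms(3,7) by simp
  ultimately have B: "expected_U1 g N ?B =
      inverse (emeasure (unnormalized_hyperplane_measure g) (reference_hyperplanes g :: 'n ambient set set)) *
      cut_functional g N ?B"
    by (intro expected_U1_eq_cut_functional[OF cB BM _ _ N])
  have "cut_functional g N ?B = cut_functional g N (sublevel g b :: 'n ambient set)"
    using cut_functional_sym_pair[OF TS(1) Bs] TB by simp
  also have "\<dots> \<le> cut_functional g N (R -` K)"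
  proof (rule cut_functional_sublevel_le[where s = "max s b"])
    show "g = Spherical \<Longrightarrow> max s b < 0" using R(3) b0 by simp
    show "R -` K \<in> sets (gvolume g)" by (rule sym_pair_vimage_sets[OF R(1) Ks])
    show "R -` K \<subseteq> sublevel g (max s b)" using R(2) sublevel_mono[of s "max s b" g] by auto
  qed (use N vol in auto)
  also have "\<dots> = cut_functional g N K" by (rule cut_functional_sym_pair[OF R(1) Ks])
  finally have le: "cut_functional g N ?B \<le> cut_functional g N K" .
  have "antipodal_free g K" by (rule proper_imp_antipodal_free) (rule assms(4))
  then have "expected_U1 g N K =
      inverse (emeasure (unnormalized_hyperplane_measure g) (reference_hyperplanes g :: 'n ambient set set)) *
      cut_functional g N K"
    by (rule expected_U1_eq_cut_functional[OF assms(1-3) _ N])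
  then show ?thesis unfolding B using le by (simp add: mult_left_mono)
qed

end
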